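(* For any $d\geq 1$, the assignment $\tilde s_i\mapsto\Phi(s_i)$, $\tilde E_i\mapsto\Phi(E_i)$ ($i=1,\dots,n-1$) defines a morphism of algebras $$\Psi\colon \mathrm{TB}_n\to\operatorname{End}_{A\rtimes\mathfrak{S}_d}(V^{\otimes n}).$$ This morphism is surjective if the morphism $\Phi\colon\Bbbk\mathcal{FB}_{d,n}\to\operatorname{End}_A(V^{\otimes n})$ is surjective.
   Context: Let $d\geq 1$ and let $\Bbbk$ be a field in which $d$ is invertible and which contains a primitive $d$-th root of unity $\zeta$. Groups. $\mathcal{B}_n$ is the braid group with generators $s_1,\dots,s_{n-1}$ and relations $s_is_j=s_js_i$ if $|i-j|>1$, $s_is_js_i=s_js_is_j$ if $|i-j|=1$. The framed braid group $\mathcal{FB}_{d,n}$ has generators $s_1,\dots,s_{n-1},t_1,\dots,t_n$, the braid relations on the $s_i$, and $t_i^d=1$, $t_it_j=t_jt_i$, $s_it_j=t_{s_i(j)}s_i$, where $s_i$ acts on indices as the transposition $(i,i+1)$. In $\Bbbk\mathcal{FB}_{d,n}$ put $E_i=\frac1d\sum_{a=1}^d t_i^at_{i+1}^{-a}$. Modules. $A^{(0)}$ is a unital $\Bbbk$-bialgebra with counit $\epsilon$, $V^{(0)}$ an $A^{(0)}$-module, $A=A^{(0)}\boxtimes\cdots\boxtimes A^{(0)}$ ($d$ tensor factors, componentwise structure), and $V=V_1\oplus\cdots\oplus V_d$ where each $V_b$ is a copy of $V^{(0)}$ with $A$-action $(a_1\otimes\cdots\otimes a_d)\cdot v=\bigl(\prod_{c\neq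 b}\epsilon(a_c)\bigr)a_b\cdot v$ for $v\in V_b$. The symmetric group $\mathfrak{S}_d$ acts on $A$ by permuting tensor factors, $\sigma\cdot(x_1\otimes\cdots\otimes x_d)=x_{\sigma^{-1}(1)}\otimes\cdots\otimes x_{\sigma^{-1}(d)}$; $A\rtimes\mathfrak{S}_d$ is the smash product, with multiplication $(a\otimes g)(b\otimes h)=a\,{}^{g}b\otimes gh$. $\mathfrak{S}_d$ acts on $V$ by permuting the $d$ summands ($\sigma$ identifies $V_b$ with $V_{\sigma(b)}$) and diagonally on $V^{\otimes n}$, so $V^{\otimes n}$ is an $A\rtimes\mathfrak{S}_d$-module. Standing assumption. There is $\check R\in\operatorname{End}(V^{(0)}\otimes V^{(0)})$ such that for every $n\geq 2$ the assignment $s_i\mapsto\check R_i$ ($\check R$ acting on tensor factors $i,i+1$) defines an algebra morphism $\Bbbk\mathcal{B}_n\to\operatorname{End}_{A^{(0)}}((V^{(0)})^{\otimes n})$. The morphism $\Phi$. $\Phi\colon\Bbbk\mathcal{FB}_{d,n}\to\operatorname{End}_A(V^{\otimes n})$ is the algebra morphism $t_i\mapsto\tau_i$, $s_i\mapsto\sigma_i$, where $\tau_i$ acts on the $i$-th tensor factor by $\tau(v)=\zeta^{b-1}v$ for $v\in V_b$, and $\sigma_i$ acts on factors $i,i+1$ by $\sigma(v\otimes w)=w\otimes v$ if $v\in V_b$, $w\in V_c$, $b\ne c$, and $\sigma(v\otimes w)=\check R(v\otimes w)$ (in $V_b\otimes V_b$) if $v,w\in V_b$. Tied braid algebra. $\mathrm{TB}_n$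 is the $\Bbbk$-algebra with invertible generators $\tilde s_1,\dots,\tilde s_{n-1}$ satisfying the braid relations, and generators $\tilde E_1,\dots,\tilde E_{n-1}$ with relations: $\tilde E_i\tilde E_j=\tilde E_j\tilde E_i$; $\tilde E_i^2=\tilde E_i$; $\tilde s_i\tilde E_i=\tilde E_i\tilde s_i$; $\tilde s_i\tilde E_j=\tilde E_j\tilde s_i$ for $|i-j|>1$; and, for $|i-j|=1$: $\tilde E_i\tilde s_j\tilde s_i=\tilde s_j\tilde s_i\tilde E_j$, $\tilde E_i\tilde s_j\tilde s_i^{-1}=\tilde s_j\tilde s_i^{-1}\tilde E_j$, $\tilde E_i\tilde E_j\tilde s_i=\tilde E_j\tilde s_i\tilde E_j=\tilde s_i\tilde E_j\tilde E_i$. *)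

theory Defs
  imports
    Complex_Main
    "HOL-Algebra.QuotRing"
    "HOL-Algebra.Module"
    "HOL-Combinatorics.Permutations"
    "HOL-Library.Function_Algebras"
    "HOL-Library.FuncSet"
begin

section \<open>Vector spaces on a carrier and their tensor powers\<close>

text \<open>
  A vector space is a linear subspace \<open>vcar V\<close> of a type with an abelian group structure; the
  addition is the one of the type, the scalar multiplication is \<open>vscale V\<close>.
\<close>

record ('k, 'v) vspace =
  vcar :: "'v set"
  vscale :: "'k \<Rightarrow> 'v \<Rightarrow> 'v"

definition is_vspace :: "('k::field, 'v::ab_group_add, 'z) vspace_scheme \<Rightarrow> bool" where
  "is_vspace V \<longleftrightarrow> vector_space (vscale V) \<and> Modules.module.subspace (vscale V) (vcar V)"

definition linear_maps ::
  "('k::field, 'v::ab_group_add, 'y) vspace_scheme \<Rightarrow> ('k, 'w::ab_group_add, 'z) vspace_scheme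
    \<Rightarrow> ('v \<Rightarrow> 'w) set" where
  "linear_maps V W = {f \<in> vcar V \<rightarrow>\<^sub>E vcar W.
     (\<forall>x\<in>vcar V. \<forall>y\<in>vcar V. f (x + y) = f x + f y) \<and>
     (\<forall>c. \<forall>x\<in>vcar V. f (vscale V c x) = vscale W c (f x))}"

definition scalars :: "('k::field, 'k) vspace" where
  "scalars = \<lparr>vcar = UNIV, vscale = (*)\<rparr>"

definition lists_on :: "('k, 'v, 'z) vspace_scheme \<Rightarrow> nat \<Rightarrow> 'v list set" where
  "lists_on V n = {vs. length vs = n \<and> set vs \<subseteq> vcar V}"

definition multilinear ::
  "('k::field, 'v::ab_group_add, 'y) vspace_scheme \<Rightarrow> nat \<Rightarrow> ('k, 'w::ab_group_add, 'z) vspace_scheme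
    \<Rightarrow> ('v list \<Rightarrow> 'w) \<Rightarrow> bool" where
  "multilinear V n W F \<longleftrightarrow>
     (\<forall>vs\<in>lists_on V n. F vs \<in> vcar W) \<and>
     (\<forall>vs\<in>lists_on V n. \<forall>i<n. \<forall>x\<in>vcar V. \<forall>y\<in>vcar V.
        F (vs[i := x + y]) = F (vs[i := x]) + F (vs[i := y])) \<and>
     (\<forall>vs\<in>lists_on V n. \<forall>i<n. \<forall>c. \<forall>x\<in>vcar V.
        F (vs[i := vscale V c x]) = vscale W c (F (vs[i := x])))"

text \<open>
  Over a field, the \<open>n\<close>-th tensor power of \<open>V\<close> embeds into the dual of the space of \<open>n\<close>-linear forms
  on \<open>V\<close>, the pure tensor of \<open>v\<^sub>1, \<dots>, v\<^sub>n\<close> being evaluation at \<open>(v\<^sub>1, \<dots>, v\<^sub>n)\<close>. The tensor power is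
  realised as the span of these evaluations.  Its universal property is proved in
  \<open>tensor_power_universal\<close> below; all maps on tensor powers are afterwards defined through
  it, by prescribing them on pure tensors.
\<close>

type_synonym ('v, 'k) tensor = "('v list \<Rightarrow> 'k) \<Rightarrow> 'k"

definition pure_tensor ::
  "('k::field, 'v::ab_group_add, 'z) vspace_scheme \<Rightarrow> 'v list \<Rightarrow> ('v, 'k) tensor" where
  "pure_tensor V vs = (\<lambda>\<phi>. if multilinear V (length vs) scalars \<phi> then \<phi> vs else 0)"

definition tensor_scale :: "'k::field \<Rightarrow> ('v, 'k) tensor \<Rightarrow> ('v, 'k) tensor" where
  "tensor_scale c t = (\<lambda>\<phi>. c * t \<phi>)"

definition tensor_power ::
  "('k::field, 'v::ab_group_add, 'z) vspace_scheme \<Rightarrow> nat \<Rightarrow> ('k, ('v, 'k) tensor) vspace" where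
  "tensor_power V n =
     \<lparr>vcar = Modules.module.span tensor_scale (pure_tensor V ` lists_on V n), vscale = tensor_scale\<rparr>"

definition tensor_lift ::
  "('k::field, 'v::ab_group_add, 'y) vspace_scheme \<Rightarrow> nat \<Rightarrow> ('k, 'w::ab_group_add, 'z) vspace_scheme
    \<Rightarrow> ('v list \<Rightarrow> 'w) \<Rightarrow> ('v, 'k) tensor \<Rightarrow> 'w" where
  "tensor_lift V n W F =
     (THE f. f \<in> linear_maps (tensor_power V n) W \<and> (\<forall>vs\<in>lists_on V n. f (pure_tensor V vs) = F vs))"

lemma vector_space_tensor_scale: "vector_space (tensor_scale :: 'k::field \<Rightarrow> ('v, 'k) tensor \<Rightarrow> _)"
  by unfold_locales (auto simp: tensor_scale_def plus_fun_def fun_eq_iff algebra_simps)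

lemma is_vspace_tensor_power:
  fixes V :: "('k::field, 'v::ab_group_add, 'z) vspace_scheme"
  shows "is_vspace (tensor_power V n)"
proof -
  interpret vector_space "tensor_scale :: 'k \<Rightarrow> ('v, 'k) tensor \<Rightarrow> _"
    by (rule vector_space_tensor_scale)
  show ?thesis
    unfolding is_vspace_def tensor_power_def by (simp add: vector_space_axioms)
qed

lemma exists_functional:
  assumes "vector_space (sc :: 'k::field \<Rightarrow> 'w::ab_group_add \<Rightarrow> 'w)" "u \<noteq> 0"
  shows "\<exists>l. Vector_Spaces.linear sc (*) l \<and> l u = 1"
proof -
  interpret vector_space_pair sc "(*) :: 'k \<Rightarrow> 'k \<Rightarrow> 'k"
    using assms(1) by (auto simp: vector_space_pair_def vector_space_def algebra_simps)
  have "vs1.independent {u}" using assms(2) by simp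
  from linear_independent_extend[OF this, of "\<lambda>_. 1"] show ?thesis by auto
qed

theorem tensor_power_universal:
  fixes V :: "('k::field, 'v::ab_group_add, 'y) vspace_scheme"
    and W :: "('k, 'w::ab_group_add, 'z) vspace_scheme"
  assumes W: "is_vspace W" and F: "multilinear V n W F"
  shows "\<exists>!f. f \<in> linear_maps (tensor_power V n) W \<and> (\<forall>vs\<in>lists_on V n. f (pure_tensor V vs) = F vs)"
proof -
  interpret T: vector_space "tensor_scale :: 'k::field \<Rightarrow> ('v, 'k) tensor \<Rightarrow> _"
    by (rule vector_space_tensor_scale)
  interpret W: vector_space "vscale W" using W by (simp add: is_vspace_def)
  have sW: "W.subspace (vcar W)" using W by (simp add: is_vspace_def)
  let ?T = "vcar (tensor_power V n)"
  let ?lin = "Vector_Spaces.linear (vscale W) ((*) :: 'k \<Rightarrow> _)"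
  have T_def: "?T = T.span (pure_tensor V ` lists_on V n)" by (simp add: tensor_power_def)
  have vsc: "vscale (tensor_power V n) = tensor_scale" by (simp add: tensor_power_def)
  define rel where "rel t w \<longleftrightarrow> w \<in> vcar W \<and> (\<forall>l. ?lin l \<longrightarrow> t (\<lambda>vs. l (F vs)) = l w)" for t w
  have ladd: "l (x + y) = l x + l y" and lsc: "l (vscale W c x) = c * l x" if "?lin l" for l x y c
    using that by (auto simp: Vector_Spaces.linear_iff)
  have ml: "multilinear V n scalars (\<lambda>vs. l (F vs))" if "?lin l" for l
    using F unfolding multilinear_def scalars_def by (auto simp: ladd[OF that] lsc[OF that])
  have rel_pure: "rel (pure_tensor V vs) (F vs)" if "vs \<in> lists_on V n" for vs
    using that ml F by (auto simp: rel_def pure_tensor_def lists_on_def multilinear_def)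
  have rel_add: "rel (s + t) (x + y)" if "rel s x" "rel t y" for s t x y
    using that W.subspace_add[OF sW] by (auto simp: rel_def ladd)
  have rel_scale: "rel (tensor_scale c t) (vscale W c x)" if "rel t x" for c t x
    using that W.subspace_scale[OF sW] by (auto simp: rel_def lsc tensor_scale_def)
  have rel_0: "rel 0 0"
    using W.subspace_0[OF sW] lsc[of _ 0 0] by (auto simp: rel_def)
  have rel_unique: "x = y" if "rel t x" "rel t y" for t x y
  proof (rule ccontr)
    assume "x \<noteq> y"
    then obtain l where l: "?lin l" "l (x - y) = 1"
      using exists_functional[OF W.vector_space_axioms, of "x - y"] by auto
    have "l x = l (x - y) + l y" using ladd[OF l(1), of "x - y" y] by simp
    with l that show False by (auto simp: rel_def)
  qed
  have rel_ex: "\<exists>x. rel t x" if "t \<in> ?T" for t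
  proof -
    have "T.subspace {t. \<exists>x. rel t x}"
      unfolding T.subspace_def using rel_0 rel_add rel_scale by blast
    moreover have "pure_tensor V ` lists_on V n \<subseteq> {t. \<exists>x. rel t x}" using rel_pure by blast
    ultimately show ?thesis using T.span_minimal that unfolding T_def by blast
  qed
  have subT: "T.subspace ?T" by (simp add: T_def)
  define f where "f = (\<lambda>t\<in>?T. THE x. rel t x)"
  have relf: "rel t (f t)" if "t \<in> ?T" for t
  proof -
    have "\<exists>!x. rel t x" using rel_ex[OF that] rel_unique by blast
    then show ?thesis using theI'[of "rel t"] that by (simp add: f_def)
  qed
  have feq: "f t = x" if "t \<in> ?T" "rel t x" for t x
    using relf rel_unique that by blast
  have pT: "pure_tensor V vs \<in> ?T" if "vs \<in> lists_on V n" for vs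
    using that unfolding T_def by (intro T.span_base imageI)
  have "f \<in> linear_maps (tensor_power V n) W"
    unfolding linear_maps_def vsc
  proof (intro CollectI conjI ballI allI)
    show "f \<in> ?T \<rightarrow>\<^sub>E vcar W"
      using relf by (auto simp: rel_def) (simp add: f_def)
    show "f (x + y) = f x + f y" if "x \<in> ?T" "y \<in> ?T" for x y
      using that T.subspace_add[OF subT] by (intro feq rel_add relf)
    show "f (tensor_scale c x) = vscale W c (f x)" if "x \<in> ?T" for c x
      using that T.subspace_scale[OF subT] by (intro feq rel_scale relf)
  qed
  moreover have "\<forall>vs\<in>lists_on V n. f (pure_tensor V vs) = F vs"
    using feq pT rel_pure by blast
  moreover have "g = f" if g: "g \<in> linear_maps (tensor_power V n) W"
      "\<forall>vs\<in>lists_on V n. g (pure_tensor V vs) = F vs" for g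
  proof
    fix t
    have "T.subspace {t \<in> ?T. rel t (g t)}"
    proof -
      have "g (tensor_scale 0 0) = vscale W 0 (g 0)"
        using g(1) T.subspace_0[OF subT] unfolding linear_maps_def vsc by blast
      then have "g 0 = 0" by simp
      then show ?thesis
        using g(1) rel_add rel_scale rel_0 T.subspace_0[OF subT] T.subspace_add[OF subT] T.subspace_scale[OF subT]
        unfolding T.subspace_def linear_maps_def vsc by auto
    qed
    moreover have "pure_tensor V ` lists_on V n \<subseteq> {t \<in> ?T. rel t (g t)}"
      using g(2) rel_pure pT by auto
    ultimately have "t \<in> ?T \<Longrightarrow> rel t (g t)" using T.span_minimal unfolding T_def by blast
    then show "g t = f t"
      using feq g(1) by (cases "t \<in> ?T") (auto simp: linear_maps_def f_def PiE_def extensional_def)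
  qed
  ultimately show ?thesis by blast
qed

lemma tensor_lift:
  assumes "is_vspace W" "multilinear V n W F"
  shows "tensor_lift V n W F \<in> linear_maps (tensor_power V n) W"
    and "\<And>vs. vs \<in> lists_on V n \<Longrightarrow> tensor_lift V n W F (pure_tensor V vs) = F vs"
  using theI'[OF tensor_power_universal[OF assms]] by (auto simp: tensor_lift_def)

text \<open>The canonical map from \<open>V \<otimes> V\<^bsup>\<otimes>n\<^esup>\<close> to \<open>V\<^bsup>\<otimes>(n+1)\<^esup>\<close>.\<close>

definition tensor_cons ::
  "('k::field, 'v::ab_group_add, 'z) vspace_scheme \<Rightarrow> nat \<Rightarrow> 'v \<Rightarrow> ('v, 'k) tensor \<Rightarrow> ('v, 'k) tensor" where
  "tensor_cons V n v = tensor_lift V n (tensor_power V (Suc n)) (\<lambda>vs. pure_tensor V (v # vs))"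

definition tensor_map ::
  "('k::field, 'v::ab_group_add, 'y) vspace_scheme \<Rightarrow> ('k, 'w::ab_group_add, 'z) vspace_scheme \<Rightarrow> nat
    \<Rightarrow> ('v \<Rightarrow> 'w) \<Rightarrow> ('v, 'k) tensor \<Rightarrow> ('w, 'k) tensor" where
  "tensor_map V W n f = tensor_lift V n (tensor_power W n) (\<lambda>vs. pure_tensor W (map f vs))"

text \<open>
  An endomorphism \<open>f\<close> of \<open>V\<close> acting on the \<open>i\<close>-th factor of \<open>V\<^bsup>\<otimes>n\<^esup>\<close>, and an endomorphism \<open>g\<close> of
  \<open>V \<otimes> V\<close> acting on the factors \<open>i\<close> and \<open>i + 1\<close>.  Tensor factors are numbered from 1, list
  entries from 0.
\<close>

definition on_factor ::
  "('k::field, 'v::ab_group_add, 'z) vspace_scheme \<Rightarrow> nat \<Rightarrow> ('v \<Rightarrow> 'v) \<Rightarrow> nat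
    \<Rightarrow> ('v, 'k) tensor \<Rightarrow> ('v, 'k) tensor" where
  "on_factor V n f i =
     tensor_lift V n (tensor_power V n) (\<lambda>vs. pure_tensor V (vs[i - 1 := f (vs ! (i - 1))]))"

definition on_factors ::
  "('k::field, 'v::ab_group_add, 'z) vspace_scheme \<Rightarrow> nat
    \<Rightarrow> (('v, 'k) tensor \<Rightarrow> ('v, 'k) tensor) \<Rightarrow> nat \<Rightarrow> ('v, 'k) tensor \<Rightarrow> ('v, 'k) tensor" where
  "on_factors V n g i =
     tensor_lift V n (tensor_power V n) (\<lambda>vs.
       tensor_lift V 2 (tensor_power V n)
         (\<lambda>ws. pure_tensor V (take (i - 1) vs @ ws @ drop (i + 1) vs))
         (g (pure_tensor V [vs ! (i - 1), vs ! i])))"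


section \<open>Bialgebras and their modules\<close>

record ('k, 'a) vspace_alg = "('k, 'a) vspace" +
  amult :: "'a \<Rightarrow> 'a \<Rightarrow> 'a"
  aone :: "'a"

record ('k, 'a) bialg = "('k, 'a) vspace_alg" +
  comult :: "'a \<Rightarrow> ('a, 'k) tensor"
  counit :: "'a \<Rightarrow> 'k"

definition is_algebra :: "('k::field, 'a::ab_group_add, 'z) vspace_alg_scheme \<Rightarrow> bool" where
  "is_algebra A \<longleftrightarrow> is_vspace A \<and> aone A \<in> vcar A \<and>
     (\<forall>x\<in>vcar A. \<forall>y\<in>vcar A. amult A x y \<in> vcar A) \<and>
     (\<forall>x\<in>vcar A. \<forall>y\<in>vcar A. \<forall>z\<in>vcar A. amult A (amult A x y) z = amult A x (amult A y z)) \<and>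
     (\<forall>x\<in>vcar A. amult A (aone A) x = x \<and> amult A x (aone A) = x) \<and>
     (\<forall>x\<in>vcar A. \<forall>y\<in>vcar A. \<forall>z\<in>vcar A.
        amult A (x + y) z = amult A x z + amult A y z \<and> amult A x (y + z) = amult A x y + amult A x z) \<and>
     (\<forall>c. \<forall>x\<in>vcar A. \<forall>y\<in>vcar A.
        amult A (vscale A c x) y = vscale A c (amult A x y) \<and>
        amult A x (vscale A c y) = vscale A c (amult A x y))"

definition tensor_mult ::
  "('k::field, 'a::ab_group_add, 'z) vspace_alg_scheme \<Rightarrow> nat
    \<Rightarrow> ('a, 'k) tensor \<Rightarrow> ('a, 'k) tensor \<Rightarrow> ('a, 'k) tensor" where
  "tensor_mult A n s t =
     tensor_lift A n (tensor_power A n) (\<lambda>xs.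
       tensor_lift A n (tensor_power A n) (\<lambda>ys. pure_tensor A (map2 (amult A) xs ys)) t) s"

definition is_bialgebra :: "('k::field, 'a::ab_group_add, 'z) bialg_scheme \<Rightarrow> bool" where
  "is_bialgebra A \<longleftrightarrow> is_algebra A \<and>
     restrict (comult A) (vcar A) \<in> linear_maps A (tensor_power A 2) \<and>
     restrict (counit A) (vcar A) \<in> linear_maps A scalars \<and>
     \<comment> \<open>coassociativity\<close>
     (\<forall>x\<in>vcar A.
        tensor_lift A 2 (tensor_power A 3)
          (\<lambda>ys. tensor_lift A 2 (tensor_power A 3)
                   (\<lambda>zs. pure_tensor A [zs ! 0, zs ! 1, ys ! 1]) (comult A (ys ! 0))) (comult A x)
      = tensor_lift A 2 (tensor_power A 3)
          (\<lambda>ys. tensor_lift A 2 (tensor_power A 3)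
                   (\<lambda>zs. pure_tensor A [ys ! 0, zs ! 0, zs ! 1]) (comult A (ys ! 1))) (comult A x)) \<and>
     \<comment> \<open>counitality\<close>
     (\<forall>x\<in>vcar A.
        tensor_lift A 2 A (\<lambda>ys. vscale A (counit A (ys ! 0)) (ys ! 1)) (comult A x) = x \<and>
        tensor_lift A 2 A (\<lambda>ys. vscale A (counit A (ys ! 1)) (ys ! 0)) (comult A x) = x) \<and>
     \<comment> \<open>comultiplication and counit are morphisms of unital algebras\<close>
     comult A (aone A) = pure_tensor A [aone A, aone A] \<and>
     counit A (aone A) = 1 \<and>
     (\<forall>x\<in>vcar A. \<forall>y\<in>vcar A.
        comult A (amult A x y) = tensor_mult A 2 (comult A x) (comult A y) \<and>
        counit A (amult A x y) = counit A x * counit A y)"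

definition is_module ::
  "('k::field, 'a::ab_group_add, 'y) vspace_alg_scheme \<Rightarrow> ('k, 'm::ab_group_add, 'z) vspace_scheme
    \<Rightarrow> ('a \<Rightarrow> 'm \<Rightarrow> 'm) \<Rightarrow> bool" where
  "is_module A M act \<longleftrightarrow> is_vspace M \<and>
     (\<forall>a\<in>vcar A. restrict (act a) (vcar M) \<in> linear_maps M M) \<and>
     (\<forall>v\<in>vcar M. restrict (\<lambda>a. act a v) (vcar A) \<in> linear_maps A M) \<and>
     (\<forall>v\<in>vcar M. act (aone A) v = v) \<and>
     (\<forall>a\<in>vcar A. \<forall>b\<in>vcar A. \<forall>v\<in>vcar M. act (amult A a b) v = act a (act b v))"

text \<open>
  The module structure on \<open>M\<^bsup>\<otimes>n\<^esup>\<close> defined by the comultiplication: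
  \<open>M\<^bsup>\<otimes>0\<^esup>\<close> carries the counit and \<open>M\<^bsup>\<otimes>(n+1)\<^esup> = M \<otimes> M\<^bsup>\<otimes>n\<^esup>\<close>.
\<close>

primrec tensor_act_pure ::
  "('k::field, 'a::ab_group_add, 'y) bialg_scheme \<Rightarrow> ('k, 'm::ab_group_add, 'z) vspace_scheme
    \<Rightarrow> ('a \<Rightarrow> 'm \<Rightarrow> 'm) \<Rightarrow> 'm list \<Rightarrow> 'a \<Rightarrow> ('m, 'k) tensor" where
  "tensor_act_pure A M act [] = (\<lambda>a. tensor_scale (counit A a) (pure_tensor M []))"
| "tensor_act_pure A M act (v # vs) = (\<lambda>a.
     tensor_lift A 2 (tensor_power M (Suc (length vs)))
       (\<lambda>xs. tensor_cons M (length vs) (act (xs ! 0) v) (tensor_act_pure A M act vs (xs ! 1)))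
       (comult A a))"

definition tensor_act ::
  "('k::field, 'a::ab_group_add, 'y) bialg_scheme \<Rightarrow> ('k, 'm::ab_group_add, 'z) vspace_scheme
    \<Rightarrow> ('a \<Rightarrow> 'm \<Rightarrow> 'm) \<Rightarrow> nat \<Rightarrow> 'a \<Rightarrow> ('m, 'k) tensor \<Rightarrow> ('m, 'k) tensor" where
  "tensor_act A M act n a = tensor_lift M n (tensor_power M n) (\<lambda>vs. tensor_act_pure A M act vs a)"


section \<open>The bialgebra \<open>A\<close>, the module \<open>V\<close> and the smash product\<close>

text \<open>
  \<open>shuffle A [\<Delta> a\<^sub>1, \<dots>, \<Delta> a\<^sub>d]\<close> regroups the factors of \<open>\<Delta> a\<^sub>1 \<otimes> \<dots> \<otimes> \<Delta> a\<^sub>d\<close>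
  into an element of \<open>A\<^bsup>\<otimes>d\<^esup> \<otimes> A\<^bsup>\<otimes>d\<^esup>\<close>.
\<close>

primrec shuffle ::
  "('k::field, 'a::ab_group_add, 'z) vspace_scheme \<Rightarrow> ('a, 'k) tensor list
    \<Rightarrow> (('a, 'k) tensor, 'k) tensor" where
  "shuffle A [] = pure_tensor (tensor_power A 0) [pure_tensor A [], pure_tensor A []]"
| "shuffle A (t # ts) =
     (let m = length ts; T = tensor_power (tensor_power A (Suc m)) 2 in
      tensor_lift A 2 T (\<lambda>xs.
        tensor_lift (tensor_power A m) 2 T (\<lambda>ps.
          pure_tensor (tensor_power A (Suc m))
            [tensor_cons A m (xs ! 0) (ps ! 0), tensor_cons A m (xs ! 1) (ps ! 1)])
          (shuffle A ts)) t)"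

definition tensor_bialg ::
  "nat \<Rightarrow> ('k::field, 'a::ab_group_add) bialg \<Rightarrow> ('k, ('a, 'k) tensor) bialg" where
  "tensor_bialg d A =
     \<lparr>vcar = vcar (tensor_power A d),
      vscale = vscale (tensor_power A d),
      amult = tensor_mult A d,
      aone = pure_tensor A (replicate d (aone A)),
      comult = tensor_lift A d (tensor_power (tensor_power A d) 2)
        (\<lambda>xs. shuffle (vspace.truncate A) (map (comult A) xs)),
      counit = tensor_lift A d scalars (\<lambda>xs. prod_list (map (counit A) xs))\<rparr>"

text \<open>
  \<open>V = V\<^sub>1 \<oplus> \<dots> \<oplus> V\<^sub>d\<close>, a vector being the function sending \<open>b \<in> {1..d}\<close> to its component in
  \<open>V\<^sub>b\<close>.
\<close>

definition sum_space ::
  "nat \<Rightarrow> ('k::field, 'v::ab_group_add) vspace \<Rightarrow> ('k, nat \<Rightarrow> 'v) vspace" where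
  "sum_space d V0 =
     \<lparr>vcar = {v. (\<forall>b\<in>{1..d}. v b \<in> vcar V0) \<and> (\<forall>b. b \<notin> {1..d} \<longrightarrow> v b = 0)},
      vscale = (\<lambda>c v b. vscale V0 c (v b))\<rparr>"

definition sum_inj :: "nat \<Rightarrow> 'v::ab_group_add \<Rightarrow> nat \<Rightarrow> 'v" where
  "sum_inj b x = (\<lambda>c. if c = b then x else 0)"

definition sum_act ::
  "nat \<Rightarrow> ('k::field, 'a::ab_group_add) bialg \<Rightarrow> ('k, 'v::ab_group_add) vspace \<Rightarrow> ('a \<Rightarrow> 'v \<Rightarrow> 'v)
    \<Rightarrow> ('a, 'k) tensor \<Rightarrow> (nat \<Rightarrow> 'v) \<Rightarrow> (nat \<Rightarrow> 'v)" where
  "sum_act d A0 V0 act a v =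
     tensor_lift A0 d (sum_space d V0)
       (\<lambda>xs b. if b \<in> {1..d}
          then vscale V0 (\<Prod>c\<in>{1..d} - {b}. counit A0 (xs ! (c - 1))) (act (xs ! (b - 1)) (v b))
          else 0) a"

definition perm_act_alg ::
  "nat \<Rightarrow> ('k::field, 'a::ab_group_add) bialg \<Rightarrow> (nat \<Rightarrow> nat) \<Rightarrow> ('a, 'k) tensor \<Rightarrow> ('a, 'k) tensor" where
  "perm_act_alg d A0 \<sigma> =
     tensor_lift A0 d (tensor_power A0 d)
       (\<lambda>xs. pure_tensor A0 (map (\<lambda>c. xs ! (Hilbert_Choice.inv \<sigma> c - 1)) [1..<Suc d]))"

definition perm_act_sum :: "(nat \<Rightarrow> nat) \<Rightarrow> (nat \<Rightarrow> 'v) \<Rightarrow> (nat \<Rightarrow> 'v)" where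
  "perm_act_sum \<sigma> v = (\<lambda>b. v (Hilbert_Choice.inv \<sigma> b))"

text \<open>
  The symmetric group consists of the permutations of \<open>{1..d}\<close>. The element
  \<open>\<Sum>\<^sub>g a\<^sub>g \<otimes> g\<close> of the smash product is the function sending \<open>g\<close> to \<open>a\<^sub>g\<close>. The coefficient of \<open>x\<close>
  in \<open>(\<Sum>\<^sub>g a\<^sub>g \<otimes> g) (\<Sum>\<^sub>h b\<^sub>h \<otimes> h)\<close> collects the terms with \<open>h = g\<^sup>-\<^sup>1 x\<close>.
\<close>

definition smash ::
  "nat \<Rightarrow> ('k::field, 'a::ab_group_add) bialg
    \<Rightarrow> ('k, (nat \<Rightarrow> nat) \<Rightarrow> ('a, 'k) tensor) vspace_alg" where
  "smash d A0 = (let A = tensor_bialg d A0; G = {g. g permutes {1..d}} in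
     \<lparr>vcar = {u. (\<forall>g\<in>G. u g \<in> vcar A) \<and> (\<forall>g. g \<notin> G \<longrightarrow> u g = 0)},
      vscale = (\<lambda>c u g. vscale A c (u g)),
      amult = (\<lambda>u w x. if x \<in> G
        then \<Sum>g\<in>G. amult A (u g) (perm_act_alg d A0 g (w (Hilbert_Choice.inv g \<circ> x))) else 0),
      aone = (\<lambda>g. if g = id then aone A else 0)\<rparr>)"

definition A_act ::
  "nat \<Rightarrow> ('k::field, 'a::ab_group_add) bialg \<Rightarrow> ('k, 'v::ab_group_add) vspace \<Rightarrow> ('a \<Rightarrow> 'v \<Rightarrow> 'v) \<Rightarrow> nat
    \<Rightarrow> ('a, 'k) tensor \<Rightarrow> (nat \<Rightarrow> 'v, 'k) tensor \<Rightarrow> (nat \<Rightarrow> 'v, 'k) tensor" where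
  "A_act d A0 V0 act n = tensor_act (tensor_bialg d A0) (sum_space d V0) (sum_act d A0 V0 act) n"

definition smash_act ::
  "nat \<Rightarrow> ('k::field, 'a::ab_group_add) bialg \<Rightarrow> ('k, 'v::ab_group_add) vspace \<Rightarrow> ('a \<Rightarrow> 'v \<Rightarrow> 'v) \<Rightarrow> nat
    \<Rightarrow> ((nat \<Rightarrow> nat) \<Rightarrow> ('a, 'k) tensor) \<Rightarrow> (nat \<Rightarrow> 'v, 'k) tensor \<Rightarrow> (nat \<Rightarrow> 'v, 'k) tensor" where
  "smash_act d A0 V0 act n u t =
     (\<Sum>g | g permutes {1..d}.
        A_act d A0 V0 act n (u g)
          (tensor_map (sum_space d V0) (sum_space d V0) n (perm_act_sum g) t))"


section \<open>Algebras of endomorphisms, monoid algebras and presentations\<close>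

text \<open>
  Algebras whose elements are maps or cosets are records of the type of HOL-Algebra that carries a
  ring structure and a scalar multiplication by all of \<open>'k\<close>.
\<close>

definition alg_hom ::
  "('k, 'a, 'y) module_scheme \<Rightarrow> ('k, 'b, 'z) module_scheme \<Rightarrow> ('a \<Rightarrow> 'b) set" where
  "alg_hom A B = {f \<in> ring_hom A B. f \<in> extensional (carrier A) \<and>
     (\<forall>c. \<forall>x\<in>carrier A. f (c \<odot>\<^bsub>A\<^esub> x) = c \<odot>\<^bsub>B\<^esub> f x)}"

definition End_alg ::
  "('k::field, 'a::ab_group_add, 'y) vspace_alg_scheme \<Rightarrow> ('k, 'm::ab_group_add, 'z) vspace_scheme
    \<Rightarrow> ('a \<Rightarrow> 'm \<Rightarrow> 'm) \<Rightarrow> ('k, 'm \<Rightarrow> 'm) module" where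
  "End_alg A M act =
     \<lparr>carrier = {f \<in> linear_maps M M. \<forall>a\<in>vcar A. \<forall>x\<in>vcar M. f (act a x) = act a (f x)},
      monoid.mult = (\<lambda>f g. compose (vcar M) f g),
      one = (\<lambda>x\<in>vcar M. x),
      zero = (\<lambda>x\<in>vcar M. 0),
      add = (\<lambda>f g. \<lambda>x\<in>vcar M. f x + g x),
      smult = (\<lambda>c f. \<lambda>x\<in>vcar M. vscale M c (f x))\<rparr>"

text \<open>The algebra of a monoid (in particular of a group): finitely supported functions with convolution.\<close>

definition monoid_alg :: "('g, 'z) monoid_scheme \<Rightarrow> ('k::field, 'g \<Rightarrow> 'k) module" where
  "monoid_alg G =
     \<lparr>carrier = {f. finite {g. f g \<noteq> 0} \<and> {g. f g \<noteq> 0} \<subseteq> carrier G},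
      monoid.mult = (\<lambda>f h x. \<Sum>g | f g \<noteq> 0. \<Sum>g' | h g' \<noteq> 0. if g \<otimes>\<^bsub>G\<^esub> g' = x then f g * h g' else 0),
      one = (\<lambda>x. if x = \<one>\<^bsub>G\<^esub> then 1 else 0),
      zero = (\<lambda>x. 0),
      add = (\<lambda>f h x. f x + h x),
      smult = (\<lambda>c f x. c * f x)\<rparr>"

definition basis_elt :: "'g \<Rightarrow> 'g \<Rightarrow> 'k::field" where
  "basis_elt g = (\<lambda>x. if x = g then 1 else 0)"

text \<open>
  The group presented by generators \<open>X\<close> and relations \<open>R\<close>. Words are lists of letters \<open>(x, True)\<close> for
  \<open>x\<close> and \<open>(x, False)\<close> for \<open>x\<^sup>-\<^sup>1\<close>; a pair \<open>(u, v)\<close> in \<open>R\<close> is the relation \<open>u = v\<close>.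
\<close>

type_synonym 'g word = "('g \<times> bool) list"

inductive pres_equiv :: "'g set \<Rightarrow> ('g word \<times> 'g word) set \<Rightarrow> 'g word \<Rightarrow> 'g word \<Rightarrow> bool"
  for X R where
  refl: "u \<in> lists (X \<times> UNIV) \<Longrightarrow> pres_equiv X R u u"
| sym: "pres_equiv X R u v \<Longrightarrow> pres_equiv X R v u"
| trans: "pres_equiv X R u v \<Longrightarrow> pres_equiv X R v w \<Longrightarrow> pres_equiv X R u w"
| cong: "pres_equiv X R u v \<Longrightarrow> pres_equiv X R u' v' \<Longrightarrow> pres_equiv X R (u @ u') (v @ v')"
| cancel: "x \<in> X \<Longrightarrow> pres_equiv X R [(x, b), (x, \<not> b)] []"
| rel: "(u, v) \<in> R \<Longrightarrow> pres_equiv X R u v"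

definition pres_class :: "'g set \<Rightarrow> ('g word \<times> 'g word) set \<Rightarrow> 'g word \<Rightarrow> 'g word set" where
  "pres_class X R u = {v. pres_equiv X R u v}"

definition pres_group :: "'g set \<Rightarrow> ('g word \<times> 'g word) set \<Rightarrow> 'g word set monoid" where
  "pres_group X R =
     \<lparr>carrier = pres_class X R ` lists (X \<times> UNIV),
      monoid.mult = (\<lambda>P Q. {w. \<exists>u\<in>P. \<exists>v\<in>Q. pres_equiv X R (u @ v) w}),
      one = pres_class X R []\<rparr>"

definition quot_alg :: "('k, 'a, 'z) module_scheme \<Rightarrow> 'a set \<Rightarrow> ('k, 'a set) module" where
  "quot_alg A I =
     \<lparr>carrier = carrier (A Quot I), monoid.mult = monoid.mult (A Quot I), one = one (A Quot I),
      zero = zero (A Quot I), add = add (A Quot I),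
      smult = (\<lambda>c P. \<Union>x\<in>P. I +>\<^bsub>A\<^esub> (c \<odot>\<^bsub>A\<^esub> x))\<rparr>"

definition free_monoid :: "'g set \<Rightarrow> 'g list monoid" where
  "free_monoid X = \<lparr>carrier = lists X, monoid.mult = (@), one = []\<rparr>"

text \<open>
  The algebra presented by generators \<open>X\<close> and relations \<open>u = v\<close> between monomials, for
  \<open>(u, v)\<close> in \<open>R\<close>, as a quotient of the free algebra on \<open>X\<close>.
\<close>

definition pres_ideal :: "'g set \<Rightarrow> ('g list \<times> 'g list) set \<Rightarrow> ('g list \<Rightarrow> 'k::field) set" where
  "pres_ideal X R =
     Idl\<^bsub>monoid_alg (free_monoid X)\<^esub> {(\<lambda>w. basis_elt u w - basis_elt v w) |u v. (u, v) \<in> R}"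

definition pres_alg ::
  "'g set \<Rightarrow> ('g list \<times> 'g list) set \<Rightarrow> ('k::field, ('g list \<Rightarrow> 'k) set) module" where
  "pres_alg X R = quot_alg (monoid_alg (free_monoid X)) (pres_ideal X R)"

definition pres_alg_gen ::
  "'g set \<Rightarrow> ('g list \<times> 'g list) set \<Rightarrow> 'g \<Rightarrow> ('g list \<Rightarrow> 'k::field) set" where
  "pres_alg_gen X R x = pres_ideal X R +>\<^bsub>monoid_alg (free_monoid X)\<^esub> basis_elt [x]"


section \<open>Braid groups, framed braid groups and tied braid algebras\<close>

abbreviation adjacent :: "nat \<Rightarrow> nat \<Rightarrow> bool" where
  "adjacent i j \<equiv> i = Suc j \<or> j = Suc i"

abbreviation distant :: "nat \<Rightarrow> nat \<Rightarrow> bool" where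
  "distant i j \<equiv> Suc i < j \<or> Suc j < i"

definition braid_rels :: "nat \<Rightarrow> (nat \<Rightarrow> 'x) \<Rightarrow> ('x list \<times> 'x list) set" where
  "braid_rels n s =
     {([s i, s j], [s j, s i]) |i j. i \<in> {1..<n} \<and> j \<in> {1..<n} \<and> distant i j} \<union>
     {([s i, s j, s i], [s j, s i, s j]) |i j. i \<in> {1..<n} \<and> j \<in> {1..<n} \<and> adjacent i j}"

definition braid_group :: "nat \<Rightarrow> nat word set monoid" where
  "braid_group n = pres_group {1..<n} (braid_rels n (\<lambda>i. (i, True)))"

definition braid_gen :: "nat \<Rightarrow> nat \<Rightarrow> nat word set" where
  "braid_gen n i = pres_class {1..<n} (braid_rels n (\<lambda>i. (i, True))) [(i, True)]"

datatype framed_gen = FS nat | FT nat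

definition framed_gens :: "nat \<Rightarrow> framed_gen set" where
  "framed_gens n = FS ` {1..<n} \<union> FT ` {1..n}"

definition framed_rels :: "nat \<Rightarrow> nat \<Rightarrow> (framed_gen word \<times> framed_gen word) set" where
  "framed_rels d n =
     braid_rels n (\<lambda>i. (FS i, True)) \<union>
     {(replicate d (FT i, True), []) |i. i \<in> {1..n}} \<union>
     {([(FT i, True), (FT j, True)], [(FT j, True), (FT i, True)]) |i j. i \<in> {1..n} \<and> j \<in> {1..n}} \<union>
     {([(FS i, True), (FT j, True)], [(FT (transpose i (Suc i) j), True), (FS i, True)]) |i j.
        i \<in> {1..<n} \<and> j \<in> {1..n}}"

definition framed_braid_group :: "nat \<Rightarrow> nat \<Rightarrow> framed_gen word set monoid" where
  "framed_braid_group d n = pres_group (framed_gens n) (framed_rels d n)"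

definition framed_s :: "nat \<Rightarrow> nat \<Rightarrow> nat \<Rightarrow> framed_gen word set" where
  "framed_s d n i = pres_class (framed_gens n) (framed_rels d n) [(FS i, True)]"

definition framed_t :: "nat \<Rightarrow> nat \<Rightarrow> nat \<Rightarrow> framed_gen word set" where
  "framed_t d n i = pres_class (framed_gens n) (framed_rels d n) [(FT i, True)]"

definition framed_E :: "nat \<Rightarrow> nat \<Rightarrow> nat \<Rightarrow> framed_gen word set \<Rightarrow> 'k::field" where
  "framed_E d n i = (let G = framed_braid_group d n in
     (\<lambda>g. inverse (of_nat d) * (\<Sum>a = 1..d.
        basis_elt (framed_t d n i [^]\<^bsub>G\<^esub> a \<otimes>\<^bsub>G\<^esub> inv\<^bsub>G\<^esub> (framed_t d n (Suc i) [^]\<^bsub>G\<^esub> a)) g)))"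

text \<open>\<open>TSinv i\<close> is the inverse of the generator \<open>TS i\<close>.\<close>

datatype tied_gen = TS nat | TSinv nat | TE nat

definition tied_gens :: "nat \<Rightarrow> tied_gen set" where
  "tied_gens n = TS ` {1..<n} \<union> TSinv ` {1..<n} \<union> TE ` {1..<n}"

definition tied_rels :: "nat \<Rightarrow> (tied_gen list \<times> tied_gen list) set" where
  "tied_rels n =
     {([TS i, TSinv i], []) |i. i \<in> {1..<n}} \<union>
     {([TSinv i, TS i], []) |i. i \<in> {1..<n}} \<union>
     braid_rels n TS \<union>
     {([TE i, TE j], [TE j, TE i]) |i j. i \<in> {1..<n} \<and> j \<in> {1..<n}} \<union>
     {([TE i, TE i], [TE i]) |i. i \<in> {1..<n}} \<union>
     {([TS i, TE i], [TE i, TS i]) |i. i \<in> {1..<n}} \<union>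
     {([TS i, TE j], [TE j, TS i]) |i j. i \<in> {1..<n} \<and> j \<in> {1..<n} \<and> distant i j} \<union>
     {([TE i, TS j, TS i], [TS j, TS i, TE j]) |i j.
        i \<in> {1..<n} \<and> j \<in> {1..<n} \<and> adjacent i j} \<union>
     {([TE i, TS j, TSinv i], [TS j, TSinv i, TE j]) |i j.
        i \<in> {1..<n} \<and> j \<in> {1..<n} \<and> adjacent i j} \<union>
     {([TE i, TE j, TS i], [TE j, TS i, TE j]) |i j.
        i \<in> {1..<n} \<and> j \<in> {1..<n} \<and> adjacent i j} \<union>
     {([TE j, TS i, TE j], [TS i, TE j, TE i]) |i j.
        i \<in> {1..<n} \<and> j \<in> {1..<n} \<and> adjacent i j}"

definition TB :: "nat \<Rightarrow> ('k::field, (tied_gen list \<Rightarrow> 'k) set) module" where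
  "TB n = pres_alg (tied_gens n) (tied_rels n)"

definition TB_s :: "nat \<Rightarrow> nat \<Rightarrow> (tied_gen list \<Rightarrow> 'k::field) set" where
  "TB_s n i = pres_alg_gen (tied_gens n) (tied_rels n) (TS i)"

definition TB_E :: "nat \<Rightarrow> nat \<Rightarrow> (tied_gen list \<Rightarrow> 'k::field) set" where
  "TB_E n i = pres_alg_gen (tied_gens n) (tied_rels n) (TE i)"


section \<open>The operators on \<open>V\<^bsup>\<otimes>n\<^esup>\<close>\<close>

definition tau :: "nat \<Rightarrow> ('k::field, 'v::ab_group_add) vspace \<Rightarrow> 'k \<Rightarrow> (nat \<Rightarrow> 'v) \<Rightarrow> (nat \<Rightarrow> 'v)" where
  "tau d V0 \<zeta> v = (\<lambda>b. if b \<in> {1..d} then vscale V0 (\<zeta> ^ (b - 1)) (v b) else 0)"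

text \<open>
  On \<open>V\<^sub>b \<otimes> V\<^sub>c\<close> with \<open>b \<noteq> c\<close> this is the flip, on \<open>V\<^sub>b \<otimes> V\<^sub>b\<close> it is the given endomorphism \<open>R\<close>.
\<close>

definition sigma ::
  "nat \<Rightarrow> ('k::field, 'v::ab_group_add) vspace \<Rightarrow> (('v, 'k) tensor \<Rightarrow> ('v, 'k) tensor)
    \<Rightarrow> (nat \<Rightarrow> 'v, 'k) tensor \<Rightarrow> (nat \<Rightarrow> 'v, 'k) tensor" where
  "sigma d V0 R = (let V = sum_space d V0 in
     tensor_lift V 2 (tensor_power V 2) (\<lambda>vs.
       \<Sum>b\<in>{1..d}. \<Sum>c\<in>{1..d}.
         if b \<noteq> c then pure_tensor V [sum_inj c ((vs ! 1) c), sum_inj b ((vs ! 0) b)]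
         else tensor_map V0 V 2 (sum_inj b) (R (pure_tensor V0 [(vs ! 0) b, (vs ! 1) b]))))"

definition primitive_root :: "nat \<Rightarrow> 'k::field \<Rightarrow> bool" where
  "primitive_root d \<zeta> \<longleftrightarrow> \<zeta> ^ d = 1 \<and> (\<forall>m\<in>{1..<d}. \<zeta> ^ m \<noteq> 1)"

definition braid_rep ::
  "('k::field, 'a::ab_group_add) bialg \<Rightarrow> ('k, 'v::ab_group_add) vspace \<Rightarrow> ('a \<Rightarrow> 'v \<Rightarrow> 'v)
    \<Rightarrow> (('v, 'k) tensor \<Rightarrow> ('v, 'k) tensor) \<Rightarrow> bool" where
  "braid_rep A0 V0 act R \<longleftrightarrow>
     (\<forall>m\<ge>2. \<exists>\<rho>\<in>alg_hom (monoid_alg (braid_group m))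
                      (End_alg A0 (tensor_power V0 m) (tensor_act A0 V0 act m)).
        \<forall>i\<in>{1..<m}. \<rho> (basis_elt (braid_gen m i)) = on_factors V0 m R i)"

definition End_A ::
  "nat \<Rightarrow> ('k::field, 'a::ab_group_add) bialg \<Rightarrow> ('k, 'v::ab_group_add) vspace \<Rightarrow> ('a \<Rightarrow> 'v \<Rightarrow> 'v) \<Rightarrow> nat
    \<Rightarrow> ('k, (nat \<Rightarrow> 'v, 'k) tensor \<Rightarrow> (nat \<Rightarrow> 'v, 'k) tensor) module" where
  "End_A d A0 V0 act n =
     End_alg (tensor_bialg d A0) (tensor_power (sum_space d V0) n) (A_act d A0 V0 act n)"

definition End_smash ::
  "nat \<Rightarrow> ('k::field, 'a::ab_group_add) bialg \<Rightarrow> ('k, 'v::ab_group_add) vspace \<Rightarrow> ('a \<Rightarrow> 'v \<Rightarrow> 'v) \<Rightarrow> nat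
    \<Rightarrow> ('k, (nat \<Rightarrow> 'v, 'k) tensor \<Rightarrow> (nat \<Rightarrow> 'v, 'k) tensor) module" where
  "End_smash d A0 V0 act n =
     End_alg (smash d A0) (tensor_power (sum_space d V0) n) (smash_act d A0 V0 act n)"

end

theory Submission
  imports Defs
begin

text \<open>
  Why the theorem is true.  The tensor power \<open>V\<^bsup>\<otimes>n\<^esup>\<close> is the direct sum of its homogeneous parts
  \<open>V\<^bsub>b\<^sub>1\<^esub> \<otimes> \<dots> \<otimes> V\<^bsub>b\<^sub>n\<^esub>\<close>, indexed by the words \<open>b\<close> of length \<open>n\<close> in \<open>{1..d}\<close>.  A function \<open>\<phi>\<close> of such words
  gives the operator \<open>diag \<phi>\<close> that multiplies the part of degree \<open>b\<close> by \<open>\<phi> b\<close>.  The operator \<open>\<tau>\<^sub>i\<close> is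
  diagonal with eigenvalue \<open>\<zeta>\<close> to the power \<open>b\<^sub>i - 1\<close>, and the sum of the powers of a nontrivial \<open>d\<close>-th root
  of unity vanishes; hence \<open>\<Phi>(E\<^sub>i)\<close> is diagonal with eigenvalue 1 or 0 according to whether \<open>b\<^sub>i = b\<^sub>i\<^sub>+\<^sub>1\<close>
  (lemma \<open>\<Phi>_E\<close>).  The operators \<open>\<sigma>\<^sub>i\<close> and their inverses exchange the entries \<open>i\<close> and \<open>i + 1\<close> of the
  degree, a permutation \<open>g\<close> of the summands applies \<open>g\<close> to each entry, and moving a diagonal operator
  past one of them composes \<open>\<phi>\<close> with this substitution (\<open>s_op_diag\<close>, \<open>s_inv_diag\<close>, \<open>perm_diag\<close>).  So the
  relations of the tied braid algebra that contain some \<open>E\<^sub>i\<close> become identities between functions of \<open>b\<close>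
  (\<open>eps_swap\<close>); the other relations hold in the framed braid group.

  An endomorphism is linear over the smash product if and only if it is linear over \<open>A\<close> and commutes
  with the symmetric group (\<open>End_smash_iff\<close>).  The \<open>\<sigma>\<^sub>i\<close> commute with it because their definition treats
  the \<open>d\<close> summands alike (\<open>s_op_perm\<close>), and \<open>\<Phi>(E\<^sub>i)\<close> does because renaming the letters of a word does not
  change which of them are equal.

  Surjectivity.  By the commutation rules every element of the image of \<open>\<Phi>\<close> is a sum of operators
  \<open>diag \<phi> \<circ> w\<close> with \<open>w\<close> a monomial in the \<open>\<sigma>\<^sub>i\<close> and their inverses (\<open>rho_normal_form\<close>).  Choose a
  representative \<open>rep b\<close> of each orbit of the symmetric group on words.  If such a sum commutes with the
  symmetric group, its component in degree \<open>b\<close> is the one in degree \<open>rep b\<close> conjugated by a permutation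
  that maps \<open>rep b\<close> to \<open>b\<close>; since the \<open>w\<close> commute with permutations, the sum does not change when every \<open>\<phi>\<close>
  is replaced by \<open>\<phi> \<circ> rep\<close> (\<open>transported_exists\<close>).  This takes the place of averaging over the symmetric
  group, whose order may vanish in the field.  Two words are in the same orbit if and only if the same
  pairs of their entries are equal (\<open>same_pattern_permutation\<close>), so \<open>\<phi> \<circ> rep\<close> is a polynomial in the
  indicator functions of \<open>b\<^sub>i = b\<^sub>j\<close>.  The diagonal operators of these are conjugates of the \<open>\<Phi>(E\<^sub>k)\<close> by
  products of the \<open>\<sigma>\<^sub>k\<close>, and therefore \<open>diag (\<phi> \<circ> rep)\<close> lies in the image of the tied braid algebra
  (\<open>diag_rep\<close>).

  The first half of the file makes this argument meaningful: operators on tensor powers are prescribed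
  on pure tensors, so each of them comes with a proof of multilinearity; and maps out of the tied braid
  algebra are obtained from the universal property of a presentation (\<open>pres_alg_lift\<close>,
  \<open>pres_alg_hom_eqI\<close>).
\<close>

section \<open>Linear and multilinear maps on carriers\<close>

text \<open>
  Membership in \<open>linear_maps\<close> also demands a fixed value outside the carrier.  Compositions and
  parameter-dependent families are easier to handle without that part.
\<close>

definition linmap ::
  "('k::field, 'v::ab_group_add, 'y) vspace_scheme \<Rightarrow> ('k, 'w::ab_group_add, 'z) vspace_scheme
    \<Rightarrow> ('v \<Rightarrow> 'w) \<Rightarrow> bool" where
  "linmap V W f \<longleftrightarrow>
     (\<forall>x\<in>vcar V. f x \<in> vcar W) \<and>
     (\<forall>x\<in>vcar V. \<forall>y\<in>vcar V. f (x + y) = f x + f y) \<and>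
     (\<forall>c. \<forall>x\<in>vcar V. f (vscale V c x) = vscale W c (f x))"

lemma linmapI:
  assumes "\<And>x. x \<in> vcar V \<Longrightarrow> f x \<in> vcar W"
    and "\<And>x y. x \<in> vcar V \<Longrightarrow> y \<in> vcar V \<Longrightarrow> f (x + y) = f x + f y"
    and "\<And>c x. x \<in> vcar V \<Longrightarrow> f (vscale V c x) = vscale W c (f x)"
  shows "linmap V W f"
  using assms by (auto simp: linmap_def)

lemma linmap_closed: "linmap V W f \<Longrightarrow> x \<in> vcar V \<Longrightarrow> f x \<in> vcar W"
  and linmap_add: "linmap V W f \<Longrightarrow> x \<in> vcar V \<Longrightarrow> y \<in> vcar V \<Longrightarrow> f (x + y) = f x + f y"
  and linmap_scale: "linmap V W f \<Longrightarrow> x \<in> vcar V \<Longrightarrow> f (vscale V c x) = vscale W c (f x)"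
  by (auto simp: linmap_def)

lemma
  assumes V: "is_vspace V"
  shows vspace_zero: "0 \<in> vcar V"
    and vspace_add: "x \<in> vcar V \<Longrightarrow> y \<in> vcar V \<Longrightarrow> x + y \<in> vcar V"
    and vspace_scale: "x \<in> vcar V \<Longrightarrow> vscale V c x \<in> vcar V"
    and scale_add_right: "vscale V c (x + y) = vscale V c x + vscale V c y"
    and scale_add_left: "vscale V (a + c) x = vscale V a x + vscale V c x"
    and scale_scale: "vscale V a (vscale V c x) = vscale V (a * c) x"
    and scale_one: "vscale V 1 x = x"
proof -
  interpret vector_space "vscale V" using V by (simp add: is_vspace_def)
  have S: "subspace (vcar V)" using V by (simp add: is_vspace_def)
  show "0 \<in> vcar V" by (rule subspace_0[OF S])
  show "x \<in> vcar V \<Longrightarrow> y \<in> vcar V \<Longrightarrow> x + y \<in> vcar V" by (rule subspace_add[OF S])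
  show "x \<in> vcar V \<Longrightarrow> vscale V c x \<in> vcar V" by (rule subspace_scale[OF S])
  show "vscale V c (x + y) = vscale V c x + vscale V c y" by (rule scale_right_distrib)
  show "vscale V (a + c) x = vscale V a x + vscale V c x" by (rule scale_left_distrib)
  show "vscale V a (vscale V c x) = vscale V (a * c) x" by (rule scale_scale)
  show "vscale V 1 x = x" by (rule scale_one)
qed

lemma scale_zero_left: "is_vspace V \<Longrightarrow> vscale V 0 x = 0"
  using scale_add_left[of V 0 0 x] by auto

lemma scale_zero_right: "is_vspace V \<Longrightarrow> vscale V c 0 = 0"
  using scale_add_right[of V c 0 0] by auto

lemma scale_minus_one: "is_vspace V \<Longrightarrow> vscale V (- 1) x = - x"
  using scale_add_left[of V 1 "- 1" x]
  by (simp add: scale_zero_left scale_one eq_neg_iff_add_eq_0 add.commute)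

lemma vspace_sum: "is_vspace V \<Longrightarrow> (\<And>i. i \<in> I \<Longrightarrow> f i \<in> vcar V) \<Longrightarrow> sum f I \<in> vcar V"
  by (induction I rule: infinite_finite_induct) (auto simp: vspace_zero vspace_add)

lemma is_vspace_scalars: "is_vspace (scalars :: ('k::field, 'k) vspace)"
proof -
  interpret vector_space "(*) :: 'k \<Rightarrow> _" by unfold_locales (auto simp: algebra_simps)
  show ?thesis by (simp add: is_vspace_def scalars_def vector_space_axioms subspace_UNIV)
qed

lemma linmap_zero:
  assumes "is_vspace V" "is_vspace W" "linmap V W f"
  shows "f 0 = 0"
  using linmap_scale[OF assms(3) vspace_zero[OF assms(1)], of 0] assms
  by (simp add: scale_zero_left)

lemma linmap_sum:
  assumes "is_vspace V" "is_vspace W" "linmap V W f" "\<And>i. i \<in> I \<Longrightarrow> x i \<in> vcar V"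
  shows "f (sum x I) = (\<Sum>i\<in>I. f (x i))"
  using assms(4)
  by (induction I rule: infinite_finite_induct)
    (auto simp: linmap_zero[OF assms(1-3)] linmap_add[OF assms(3)] vspace_sum[OF assms(1)])

lemma linmap_comp: "linmap V W f \<Longrightarrow> linmap W U g \<Longrightarrow> linmap V U (\<lambda>x. g (f x))"
  by (simp add: linmap_def)

lemma linmap_id: "linmap V V (\<lambda>x. x)"
  by (simp add: linmap_def)

lemma linmap_const_zero: "is_vspace W \<Longrightarrow> linmap V W (\<lambda>x. 0)"
  by (simp add: linmap_def vspace_zero scale_zero_right)

lemma linmap_plus:
  "is_vspace W \<Longrightarrow> linmap V W f \<Longrightarrow> linmap V W g \<Longrightarrow> linmap V W (\<lambda>x. f x + g x)"
  by (simp add: linmap_def vspace_add scale_add_right algebra_simps)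

lemma linmap_cmult:
  "is_vspace W \<Longrightarrow> linmap V W f \<Longrightarrow> linmap V W (\<lambda>x. vscale W c (f x))"
  by (simp add: linmap_def vspace_scale scale_scale mult.commute scale_add_right)

lemma linmap_setsum:
  "is_vspace W \<Longrightarrow> (\<And>i. i \<in> I \<Longrightarrow> linmap V W (f i)) \<Longrightarrow> linmap V W (\<lambda>x. \<Sum>i\<in>I. f i x)"
  by (induction I rule: infinite_finite_induct) (auto simp: linmap_const_zero linmap_plus)

lemma linmap_cong: "(\<And>x. x \<in> vcar V \<Longrightarrow> f x = g x) \<Longrightarrow> is_vspace V \<Longrightarrow> linmap V W f = linmap V W g"
  by (simp add: linmap_def vspace_add vspace_scale)

lemma linear_maps_iff: "f \<in> linear_maps V W \<longleftrightarrow> f \<in> extensional (vcar V) \<and> linmap V W f"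
  by (auto simp: linear_maps_def linmap_def PiE_def)

lemma restrict_linear_maps_iff:
  "is_vspace V \<Longrightarrow> restrict f (vcar V) \<in> linear_maps V W \<longleftrightarrow> linmap V W f"
  unfolding linear_maps_iff by (simp add: linmap_cong[of V "restrict f (vcar V)" f])

lemma linear_mapsD: "f \<in> linear_maps V W \<Longrightarrow> linmap V W f"
  by (simp add: linear_maps_iff)

lemma lists_on_update:
  "vs \<in> lists_on V n \<Longrightarrow> x \<in> vcar V \<Longrightarrow> vs[i := x] \<in> lists_on V n"
  using set_update_subset_insert[of vs i x] by (auto simp: lists_on_def)

lemma lists_on_nth: "vs \<in> lists_on V n \<Longrightarrow> i < n \<Longrightarrow> vs ! i \<in> vcar V"
  by (auto simp: lists_on_def)

lemma lists_on_Nil [simp]: "vs \<in> lists_on V 0 \<longleftrightarrow> vs = []"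
  by (auto simp: lists_on_def)

lemma lists_on_Cons [simp]: "v # vs \<in> lists_on V (Suc n) \<longleftrightarrow> v \<in> vcar V \<and> vs \<in> lists_on V n"
  by (auto simp: lists_on_def)

lemma lists_on_Suc: "vs \<in> lists_on V (Suc n) \<longleftrightarrow> (\<exists>x xs. vs = x # xs \<and> x \<in> vcar V \<and> xs \<in> lists_on V n)"
  by (cases vs) (auto simp: lists_on_def)

lemma lists_on_2: "vs \<in> lists_on V 2 \<longleftrightarrow> (\<exists>x y. vs = [x, y] \<and> x \<in> vcar V \<and> y \<in> vcar V)"
  by (auto simp: numeral_2_eq_2 lists_on_Suc)

lemma multilinear_iff:
  "multilinear V n W F \<longleftrightarrow>
     (\<forall>vs\<in>lists_on V n. F vs \<in> vcar W \<and> (\<forall>i<n. linmap V W (\<lambda>x. F (vs[i := x]))))"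
  by (auto simp: multilinear_def linmap_def lists_on_update)

lemma multilinearI:
  assumes "\<And>vs. vs \<in> lists_on V n \<Longrightarrow> F vs \<in> vcar W"
    and "\<And>vs i. vs \<in> lists_on V n \<Longrightarrow> i < n \<Longrightarrow> linmap V W (\<lambda>x. F (vs[i := x]))"
  shows "multilinear V n W F"
  using assms by (auto simp: multilinear_iff)

lemma multilinear_closed: "multilinear V n W F \<Longrightarrow> vs \<in> lists_on V n \<Longrightarrow> F vs \<in> vcar W"
  and multilinear_linmap:
    "multilinear V n W F \<Longrightarrow> vs \<in> lists_on V n \<Longrightarrow> i < n \<Longrightarrow> linmap V W (\<lambda>x. F (vs[i := x]))"
  by (auto simp: multilinear_iff)

lemma multilinear_zero:
  assumes "is_vspace V" "is_vspace W" "multilinear V n W F" "vs \<in> lists_on V n" "i < n" "vs ! i = 0"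
  shows "F vs = 0"
  using linmap_zero[OF assms(1,2) multilinear_linmap[OF assms(3-5)]] assms(6)
  by (metis list_update_id)

lemma multilinear_cong:
  assumes "\<And>vs. vs \<in> lists_on V n \<Longrightarrow> F vs = G vs" "is_vspace V"
  shows "multilinear V n W F = multilinear V n W G"
  using assms by (simp add: multilinear_def lists_on_update vspace_add vspace_scale)

lemma multilinear_compose:
  "multilinear V n W F \<Longrightarrow> linmap W U g \<Longrightarrow> multilinear V n U (\<lambda>vs. g (F vs))"
  by (auto simp: multilinear_iff linmap_closed intro: linmap_comp[of V W _ U g])

lemma multilinear_cmult:
  "is_vspace W \<Longrightarrow> multilinear V n W F \<Longrightarrow> multilinear V n W (\<lambda>vs. vscale W c (F vs))"
  by (simp add: multilinear_iff vspace_scale linmap_cmult)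

lemma multilinear_sum:
  "is_vspace W \<Longrightarrow> (\<And>j. j \<in> J \<Longrightarrow> multilinear V n W (F j)) \<Longrightarrow>
    multilinear V n W (\<lambda>vs. \<Sum>j\<in>J. F j vs)"
  by (auto simp: multilinear_iff intro!: vspace_sum linmap_setsum)

lemma multilinear_Nil: "multilinear V 0 W F \<longleftrightarrow> F [] \<in> vcar W"
  by (auto simp: multilinear_iff lists_on_def)

text \<open>
  The recursion along the list of arguments that is followed by all functions of pure tensors defined by
  primitive recursion.
\<close>

lemma multilinear_Suc_iff:
  "multilinear V (Suc n) W F \<longleftrightarrow>
     (\<forall>v\<in>vcar V. multilinear V n W (\<lambda>vs. F (v # vs))) \<and>
     (\<forall>vs\<in>lists_on V n. linmap V W (\<lambda>v. F (v # vs)))" (is "?L \<longleftrightarrow> ?R")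
proof
  assume L: ?L
  show ?R
  proof (intro conjI ballI)
    fix v assume v: "v \<in> vcar V"
    show "multilinear V n W (\<lambda>vs. F (v # vs))"
    proof (rule multilinearI)
      fix vs assume "vs \<in> lists_on V n"
      then show "F (v # vs) \<in> vcar W" using L v by (auto simp: multilinear_iff)
    next
      fix vs i assume "vs \<in> lists_on V n" "i < n"
      then show "linmap V W (\<lambda>x. F (v # vs[i := x]))"
        using multilinear_linmap[OF L, of "v # vs" "Suc i"] v by simp
    qed
  next
    fix vs assume vs: "vs \<in> lists_on V n"
    show "linmap V W (\<lambda>v. F (v # vs))"
    proof (cases "vcar V = {}")
      case False
      then obtain u where "u \<in> vcar V" by auto
      then show ?thesis using multilinear_linmap[OF L, of "u # vs" 0] vs by simp
    qed (simp add: linmap_def)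
  qed
next
  assume R: ?R
  show ?L
  proof (rule multilinearI)
    fix vs assume "vs \<in> lists_on V (Suc n)"
    then show "F vs \<in> vcar W" using R by (auto simp: lists_on_Suc multilinear_iff)
  next
    fix vs i assume "vs \<in> lists_on V (Suc n)" "i < Suc n"
    then show "linmap V W (\<lambda>x. F (vs[i := x]))"
      using R by (cases i) (auto simp: lists_on_Suc multilinear_iff)
  qed
qed

lemma multilinear_2I:
  assumes "\<And>x. x \<in> vcar V \<Longrightarrow> linmap V W (B x)" "\<And>y. y \<in> vcar V \<Longrightarrow> linmap V W (\<lambda>x. B x y)"
  shows "multilinear V 2 W (\<lambda>xs. B (xs ! 0) (xs ! 1))"
  using assms linmap_closed[OF assms(1)]
  by (auto simp: numeral_2_eq_2 multilinear_Suc_iff multilinear_Nil lists_on_Suc)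

text \<open>
  A bialgebra is also used as a plain vector space, and tensor powers of the two occur side by side.
  They agree because only the carrier and the scalar multiplication enter.
\<close>

lemma multilinear_space_cong:
  assumes "vcar V = vcar V'" "vscale V = vscale V'" "vcar W = vcar W'" "vscale W = vscale W'"
  shows "multilinear V n W = multilinear V' n W'"
  using assms by (simp add: multilinear_def lists_on_def fun_eq_iff)

lemma lists_on_space_cong: "vcar V = vcar V' \<Longrightarrow> lists_on V n = lists_on V' n"
  by (simp add: lists_on_def)

lemma pure_tensor_space_cong:
  assumes "vcar V = vcar V'" "vscale V = vscale V'"
  shows "pure_tensor V = pure_tensor V'"
  by (simp add: pure_tensor_def fun_eq_iff multilinear_space_cong[OF assms HOL.refl HOL.refl])

lemma tensor_power_space_cong:
  assumes "vcar V = vcar V'" "vscale V = vscale V'"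
  shows "tensor_power V = tensor_power V'"
  by (simp add: tensor_power_def fun_eq_iff pure_tensor_space_cong[OF assms]
      lists_on_space_cong[OF assms(1)])

lemma linmap_space_cong:
  assumes "vcar V = vcar V'" "vscale V = vscale V'" "vcar W = vcar W'" "vscale W = vscale W'"
  shows "linmap V W = linmap V' W'"
  using assms by (simp add: linmap_def fun_eq_iff)

section \<open>Tensor powers\<close>

lemma vscale_tensor_power [simp]: "vscale (tensor_power V n) = tensor_scale"
  by (simp add: tensor_power_def)

lemma pure_tensor_closed:
  fixes V :: "('k::field, 'v::ab_group_add, 'z) vspace_scheme"
  shows "vs \<in> lists_on V n \<Longrightarrow> pure_tensor V vs \<in> vcar (tensor_power V n)"
proof -
  interpret vector_space "tensor_scale :: 'k \<Rightarrow> ('v, 'k) tensor \<Rightarrow> _"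
    by (rule vector_space_tensor_scale)
  show "vs \<in> lists_on V n \<Longrightarrow> pure_tensor V vs \<in> vcar (tensor_power V n)"
    by (auto simp: tensor_power_def intro: span_base)
qed

lemma multilinear_pure_tensor: "multilinear V n (tensor_power V n) (pure_tensor V)"
proof (rule multilinearI)
  fix vs i assume vs: "vs \<in> lists_on V n" "i < n"
  then have [simp]: "length vs = n" by (simp add: lists_on_def)
  show "linmap V (tensor_power V n) (\<lambda>x. pure_tensor V (vs[i := x]))"
  proof (rule linmapI)
    show "pure_tensor V (vs[i := x]) \<in> vcar (tensor_power V n)" if "x \<in> vcar V" for x
      using that vs by (intro pure_tensor_closed lists_on_update)
    show "pure_tensor V (vs[i := x + y]) = pure_tensor V (vs[i := x]) + pure_tensor V (vs[i := y])"
      if "x \<in> vcar V" "y \<in> vcar V" for x y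
      using that vs by (auto simp: pure_tensor_def fun_eq_iff multilinear_def)
    show "pure_tensor V (vs[i := vscale V c x]) = vscale (tensor_power V n) c (pure_tensor V (vs[i := x]))"
      if "x \<in> vcar V" for c x
      using that vs by (auto simp: pure_tensor_def fun_eq_iff multilinear_def tensor_scale_def scalars_def)
  qed
qed (rule pure_tensor_closed)

lemma tensor_power_induct [consumes 1, case_names pure zero add scale]:
  fixes V :: "('k::field, 'v::ab_group_add, 'z) vspace_scheme"
  assumes t: "t \<in> vcar (tensor_power V n)"
    and pure: "\<And>vs. vs \<in> lists_on V n \<Longrightarrow> P (pure_tensor V vs)"
    and zero: "P 0"
    and add: "\<And>s t. s \<in> vcar (tensor_power V n) \<Longrightarrow> t \<in> vcar (tensor_power V n) \<Longrightarrow> P s \<Longrightarrow> P t \<Longrightarrow> P (s + t)"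
    and scale: "\<And>c t. t \<in> vcar (tensor_power V n) \<Longrightarrow> P t \<Longrightarrow> P (tensor_scale c t)"
  shows "P t"
proof -
  interpret vector_space "tensor_scale :: 'k \<Rightarrow> ('v, 'k) tensor \<Rightarrow> _"
    by (rule vector_space_tensor_scale)
  have "subspace {t \<in> vcar (tensor_power V n). P t}"
    unfolding subspace_def using zero add scale
    by (auto simp: tensor_power_def intro: span_zero span_add span_scale)
  moreover have "pure_tensor V ` lists_on V n \<subseteq> {t \<in> vcar (tensor_power V n). P t}"
    using pure pure_tensor_closed by auto
  ultimately have "vcar (tensor_power V n) \<subseteq> {t \<in> vcar (tensor_power V n). P t}"
    unfolding tensor_power_def using span_minimal by simp
  then show ?thesis using t by auto
qed

lemma linmap_tensor_eq:
  assumes "is_vspace W" "linmap (tensor_power V n) W f" "linmap (tensor_power V n) W g"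
    and "\<And>vs. vs \<in> lists_on V n \<Longrightarrow> f (pure_tensor V vs) = g (pure_tensor V vs)"
    and "t \<in> vcar (tensor_power V n)"
  shows "f t = g t"
  using assms(5)
proof (induction rule: tensor_power_induct)
  case zero
  then show ?case using linmap_zero[OF is_vspace_tensor_power assms(1)] assms(2,3) by metis
next
  case (scale c t)
  then show ?case using linmap_scale[OF assms(2), of t c] linmap_scale[OF assms(3), of t c] by simp
next
  case (add s t)
  then show ?case using linmap_add[OF assms(2), of s t] linmap_add[OF assms(3), of s t] by metis
qed (rule assms(4))

lemma linmap_tensor_lift:
  "is_vspace W \<Longrightarrow> multilinear V n W F \<Longrightarrow> linmap (tensor_power V n) W (tensor_lift V n W F)"
  by (rule linear_mapsD[OF tensor_lift(1)])

lemma tensor_lift_extensional: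
  "is_vspace W \<Longrightarrow> multilinear V n W F \<Longrightarrow> tensor_lift V n W F \<in> extensional (vcar (tensor_power V n))"
  using tensor_lift(1) by (auto simp: linear_maps_iff)

lemma tensor_lift_closed:
  "is_vspace W \<Longrightarrow> multilinear V n W F \<Longrightarrow> t \<in> vcar (tensor_power V n) \<Longrightarrow> tensor_lift V n W F t \<in> vcar W"
  by (rule linmap_closed[OF linmap_tensor_lift])

text \<open>
  A map prescribed on pure tensors depends linearly on parameters on which its values on pure
  tensors depend linearly.  Iterated lifts are shown to be well defined with this.
\<close>

lemma linmap_tensor_lift_parameter:
  assumes W: "is_vspace W" and U: "is_vspace U"
    and ml: "\<And>x. x \<in> vcar U \<Longrightarrow> multilinear V n W (F x)"
    and lin: "\<And>vs. vs \<in> lists_on V n \<Longrightarrow> linmap U W (\<lambda>x. F x vs)"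
    and t: "t \<in> vcar (tensor_power V n)"
  shows "linmap U W (\<lambda>x. tensor_lift V n W (F x) t)"
  using t
proof (induction rule: tensor_power_induct)
  case (pure vs)
  show ?case
    by (subst linmap_cong[OF _ U, of _ "\<lambda>x. F x vs"]) (use pure in \<open>simp_all add: tensor_lift(2)[OF W ml] lin\<close>)
next
  case zero
  show ?case
    by (subst linmap_cong[OF _ U, of _ "\<lambda>x. 0"])
      (simp_all add: linmap_zero[OF is_vspace_tensor_power W linmap_tensor_lift[OF W ml]] linmap_const_zero W)
next
  case (add s t)
  show ?case
    by (subst linmap_cong[OF _ U, of _ "\<lambda>x. tensor_lift V n W (F x) s + tensor_lift V n W (F x) t"])
      (use add in \<open>simp_all add: linmap_add[OF linmap_tensor_lift[OF W ml]] linmap_plus W\<close>)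
next
  case (scale c t)
  show ?case
    by (subst linmap_cong[OF _ U, of _ "\<lambda>x. vscale W c (tensor_lift V n W (F x) t)"])
      (use scale linmap_scale[OF linmap_tensor_lift[OF W ml]] in \<open>simp_all add: linmap_cmult W\<close>)
qed

lemma multilinear_tensor_lift_parameter:
  assumes W: "is_vspace W" and U: "is_vspace U"
    and ml: "\<And>us. us \<in> lists_on U m \<Longrightarrow> multilinear V n W (F us)"
    and lin: "\<And>vs. vs \<in> lists_on V n \<Longrightarrow> multilinear U m W (\<lambda>us. F us vs)"
    and t: "t \<in> vcar (tensor_power V n)"
  shows "multilinear U m W (\<lambda>us. tensor_lift V n W (F us) t)"
proof (rule multilinearI)
  fix us assume "us \<in> lists_on U m"
  then show "tensor_lift V n W (F us) t \<in> vcar W" using W ml t by (intro tensor_lift_closed)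
next
  fix us i assume "us \<in> lists_on U m" "i < m"
  then show "linmap U W (\<lambda>x. tensor_lift V n W (F (us[i := x])) t)"
    by (intro linmap_tensor_lift_parameter W U t ml lists_on_update multilinear_linmap[OF lin])
qed

lemma multilinear_pure_tensor_Cons:
  "v \<in> vcar V \<Longrightarrow> multilinear V n (tensor_power V (Suc n)) (\<lambda>vs. pure_tensor V (v # vs))"
  using multilinear_pure_tensor[of V "Suc n"] by (simp add: multilinear_Suc_iff)

lemma linmap_tensor_cons:
  "v \<in> vcar V \<Longrightarrow> linmap (tensor_power V n) (tensor_power V (Suc n)) (tensor_cons V n v)"
  unfolding tensor_cons_def
  by (intro linmap_tensor_lift is_vspace_tensor_power multilinear_pure_tensor_Cons)

lemma linmap_tensor_cons_left:
  assumes "is_vspace V" "t \<in> vcar (tensor_power V n)"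
  shows "linmap V (tensor_power V (Suc n)) (\<lambda>v. tensor_cons V n v t)"
  unfolding tensor_cons_def
  using multilinear_pure_tensor[of V "Suc n"]
  by (intro linmap_tensor_lift_parameter is_vspace_tensor_power assms)
    (auto simp: multilinear_Suc_iff)

lemma tensor_cons_pure:
  "v \<in> vcar V \<Longrightarrow> vs \<in> lists_on V n \<Longrightarrow> tensor_cons V n v (pure_tensor V vs) = pure_tensor V (v # vs)"
  unfolding tensor_cons_def
  by (rule tensor_lift(2)[OF is_vspace_tensor_power multilinear_pure_tensor_Cons])

lemma lists_on_map: "linmap V W f \<Longrightarrow> vs \<in> lists_on V n \<Longrightarrow> map f vs \<in> lists_on W n"
  by (auto simp: lists_on_def linmap_def)

lemma multilinear_map:
  assumes "linmap V U f" "multilinear U n W F"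
  shows "multilinear V n W (\<lambda>vs. F (map f vs))"
proof (rule multilinearI)
  fix vs assume "vs \<in> lists_on V n"
  then show "F (map f vs) \<in> vcar W"
    by (intro multilinear_closed[OF assms(2)] lists_on_map[OF assms(1)])
next
  fix vs i assume "vs \<in> lists_on V n" "i < n"
  then have "linmap U W (\<lambda>x. F ((map f vs)[i := x]))"
    by (intro multilinear_linmap[OF assms(2)] lists_on_map[OF assms(1)])
  then show "linmap V W (\<lambda>x. F (map f (vs[i := x])))"
    using linmap_comp[OF assms(1)] by (simp add: map_update)
qed

lemma multilinear_tensor_map:
  "linmap V W f \<Longrightarrow> multilinear V n (tensor_power W n) (\<lambda>vs. pure_tensor W (map f vs))"
  by (rule multilinear_map[OF _ multilinear_pure_tensor])

lemma linmap_tensor_map: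
  "linmap V W f \<Longrightarrow> linmap (tensor_power V n) (tensor_power W n) (tensor_map V W n f)"
  unfolding tensor_map_def by (intro linmap_tensor_lift is_vspace_tensor_power multilinear_tensor_map)

lemma tensor_map_pure:
  "linmap V W f \<Longrightarrow> vs \<in> lists_on V n \<Longrightarrow> tensor_map V W n f (pure_tensor V vs) = pure_tensor W (map f vs)"
  unfolding tensor_map_def by (rule tensor_lift(2)[OF is_vspace_tensor_power multilinear_tensor_map])

lemma linmap_pure_tensor_2:
  "x \<in> vcar V \<Longrightarrow> linmap V (tensor_power V 2) (\<lambda>y. pure_tensor V [x, y])"
  "y \<in> vcar V \<Longrightarrow> linmap V (tensor_power V 2) (\<lambda>x. pure_tensor V [x, y])"
  using multilinear_linmap[OF multilinear_pure_tensor, of "[x, x]" V 2 1]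
    multilinear_linmap[OF multilinear_pure_tensor, of "[y, y]" V 2 0]
  by (auto simp: lists_on_2)

section \<open>The action of a bialgebra on tensor powers\<close>

text \<open>
  The conditions under which the iterated comultiplication is a well-defined family of linear operators
  on the tensor powers of \<open>M\<close>.
\<close>

locale comult_action =
  fixes A :: "('k::field, 'a::ab_group_add, 'y) bialg_scheme"
    and M :: "('k, 'm::ab_group_add, 'z) vspace_scheme"
    and act :: "'a \<Rightarrow> 'm \<Rightarrow> 'm"
  assumes vspace_A: "is_vspace A" and vspace_M: "is_vspace M"
    and linmap_comult: "linmap A (tensor_power A 2) (comult A)"
    and linmap_counit: "linmap A scalars (counit A)"
    and linmap_act: "a \<in> vcar A \<Longrightarrow> linmap M M (act a)"
    and linmap_act_left: "v \<in> vcar M \<Longrightarrow> linmap A M (\<lambda>a. act a v)"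
begin

lemma multilinear_act_cons:
  assumes v: "v \<in> vcar M" and lin: "linmap A (tensor_power M n) f"
  shows "multilinear A 2 (tensor_power M (Suc n)) (\<lambda>xs. tensor_cons M n (act (xs ! 0) v) (f (xs ! 1)))"
proof (rule multilinear_2I)
  fix x assume "x \<in> vcar A"
  then have "act x v \<in> vcar M" using v by (intro linmap_closed[OF linmap_act])
  then show "linmap A (tensor_power M (Suc n)) (\<lambda>y. tensor_cons M n (act x v) (f y))"
    by (rule linmap_comp[OF lin linmap_tensor_cons])
next
  fix y assume "y \<in> vcar A"
  then show "linmap A (tensor_power M (Suc n)) (\<lambda>x. tensor_cons M n (act x v) (f y))"
    by (intro linmap_comp[OF linmap_act_left[OF v] linmap_tensor_cons_left[OF vspace_M]] linmap_closed[OF lin])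
qed

text \<open>
  The action of \<open>a\<close> on \<open>v \<otimes> vs\<close> is the lift to \<open>comult a\<close> of an expression that is bilinear in the two
  legs of the comultiplication.  For this bilinearity the linearity in \<open>a\<close> for the shorter list is used,
  so linearity in \<open>a\<close> and in the vectors have to be proved by a common induction.
\<close>

lemma tensor_act_pure_multilinear:
  "(\<forall>a\<in>vcar A. multilinear M n (tensor_power M n) (\<lambda>vs. tensor_act_pure A M act vs a)) \<and>
   (\<forall>vs\<in>lists_on M n. linmap A (tensor_power M n) (tensor_act_pure A M act vs))"
proof (induction n)
  case 0
  have "linmap A (tensor_power M 0) (\<lambda>a. tensor_scale (counit A a) (pure_tensor M []))"
  proof (rule linmapI)
    fix x assume "x \<in> vcar A"
    show "tensor_scale (counit A x) (pure_tensor M []) \<in> vcar (tensor_power M 0)"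
      using vspace_scale[OF is_vspace_tensor_power pure_tensor_closed, of "[]" M 0] by simp
  qed (use linmap_counit in \<open>auto simp: linmap_def scalars_def tensor_scale_def fun_eq_iff algebra_simps\<close>)
  then show ?case using linmap_closed by (fastforce simp: multilinear_Nil)
next
  case (Suc n)
  define B where "B v vs x y = tensor_cons M n (act x v) (tensor_act_pure A M act vs y)" for v vs x y
  have B: "multilinear A 2 (tensor_power M (Suc n)) (\<lambda>xs. B v vs (xs ! 0) (xs ! 1))"
    if v: "v \<in> vcar M" and vs: "vs \<in> lists_on M n" for v vs
    unfolding B_def by (rule multilinear_act_cons[OF v conjunct2[OF Suc, rule_format, OF vs]])
  have eq: "tensor_act_pure A M act (v # vs) a =
      tensor_lift A 2 (tensor_power M (Suc n)) (\<lambda>xs. B v vs (xs ! 0) (xs ! 1)) (comult A a)"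
    if "vs \<in> lists_on M n" for v vs a
    using that by (simp add: B_def lists_on_def)
  have D: "comult A a \<in> vcar (tensor_power A 2)" if "a \<in> vcar A" for a
    by (rule linmap_closed[OF linmap_comult that])
  have 1: "linmap A (tensor_power M (Suc n)) (tensor_act_pure A M act (v # vs))"
    if "v \<in> vcar M" "vs \<in> lists_on M n" for v vs
    unfolding eq[OF that(2), abs_def]
    by (rule linmap_comp[OF linmap_comult linmap_tensor_lift[OF is_vspace_tensor_power B[OF that]]])
  have 2: "linmap M (tensor_power M (Suc n)) (\<lambda>v. tensor_act_pure A M act (v # vs) a)"
    if "a \<in> vcar A" "vs \<in> lists_on M n" for a vs
    unfolding eq[OF that(2)]
  proof (rule linmap_tensor_lift_parameter[OF is_vspace_tensor_power vspace_M B[OF _ that(2)] _ D[OF that(1)]])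
    fix xs assume "xs \<in> lists_on A 2"
    then obtain x y where xs: "xs = [x, y]" "x \<in> vcar A" "y \<in> vcar A" by (auto simp: lists_on_2)
    have "tensor_act_pure A M act vs y \<in> vcar (tensor_power M n)"
      using Suc that xs by (auto simp: linmap_closed)
    then show "linmap M (tensor_power M (Suc n)) (\<lambda>v. B v vs (xs ! 0) (xs ! 1))"
      unfolding B_def xs using linmap_comp[OF linmap_act linmap_tensor_cons_left[OF vspace_M]] xs
      by simp
  qed (use that in auto)
  have 3: "multilinear M n (tensor_power M (Suc n)) (\<lambda>vs. tensor_act_pure A M act (v # vs) a)"
    if "a \<in> vcar A" "v \<in> vcar M" for a v
  proof (subst multilinear_cong[OF eq vspace_M], assumption)
    show "multilinear M n (tensor_power M (Suc n))
      (\<lambda>vs. tensor_lift A 2 (tensor_power M (Suc n)) (\<lambda>xs. B v vs (xs ! 0) (xs ! 1)) (comult A a))"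
    proof (rule multilinear_tensor_lift_parameter[OF is_vspace_tensor_power vspace_M B[OF that(2)] _ D[OF that(1)]])
      fix xs assume "xs \<in> lists_on A 2"
      then obtain x y where xs: "xs = [x, y]" "x \<in> vcar A" "y \<in> vcar A" by (auto simp: lists_on_2)
      have "act x v \<in> vcar M" using that linmap_act[OF xs(2)] by (auto intro: linmap_closed)
      moreover have "multilinear M n (tensor_power M n) (\<lambda>vs. tensor_act_pure A M act vs y)"
        using Suc xs by blast
      ultimately show "multilinear M n (tensor_power M (Suc n)) (\<lambda>vs. B v vs (xs ! 0) (xs ! 1))"
        unfolding B_def xs using multilinear_compose linmap_tensor_cons by fastforce
    qed (use that in auto)
  qed
  show ?case
    using 1 2 3 by (auto simp: multilinear_Suc_iff lists_on_Suc simp del: tensor_act_pure.simps)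
qed

lemma linmap_tensor_act:
  "a \<in> vcar A \<Longrightarrow> linmap (tensor_power M n) (tensor_power M n) (tensor_act A M act n a)"
  unfolding tensor_act_def
  by (rule linmap_tensor_lift[OF is_vspace_tensor_power]) (use tensor_act_pure_multilinear in auto)

lemma linmap_tensor_act_left:
  "t \<in> vcar (tensor_power M n) \<Longrightarrow> linmap A (tensor_power M n) (\<lambda>a. tensor_act A M act n a t)"
  unfolding tensor_act_def
  by (rule linmap_tensor_lift_parameter[OF is_vspace_tensor_power vspace_A])
    (use tensor_act_pure_multilinear in auto)

text \<open>
  A group-like element acts factor by factor; so if it acts trivially on \<open>M\<close>, it does on every tensor power.
\<close>

lemma tensor_act_unit:
  assumes e: "e \<in> vcar A" "comult A e = pure_tensor A [e, e]" "counit A e = 1"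
    and act: "\<And>v. v \<in> vcar M \<Longrightarrow> act e v = v"
    and t: "t \<in> vcar (tensor_power M n)"
  shows "tensor_act A M act n e t = t"
proof -
  have pure: "tensor_act_pure A M act vs e = pure_tensor M vs" if "vs \<in> lists_on M n" for vs n
    using that
  proof (induction vs arbitrary: n)
    case Nil
    then show ?case by (simp add: e tensor_scale_def)
  next
    case (Cons v vs)
    then have v: "v \<in> vcar M" and vs: "vs \<in> lists_on M (length vs)" by (auto simp: lists_on_def)
    define B where
      "B x y = tensor_cons M (length vs) (act x v) (tensor_act_pure A M act vs y)" for x y
    have "multilinear A 2 (tensor_power M (Suc (length vs))) (\<lambda>xs. B (xs ! 0) (xs ! 1))"
      unfolding B_def
      by (rule multilinear_act_cons[OF v conjunct2[OF tensor_act_pure_multilinear, rule_format, OF vs]])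
    from tensor_lift(2)[OF is_vspace_tensor_power this, of "[e, e]"] show ?case
      using e act v vs Cons.IH[OF vs] by (simp add: B_def lists_on_2 tensor_cons_pure)
  qed
  show ?thesis
  proof (rule linmap_tensor_eq[OF is_vspace_tensor_power linmap_tensor_act[OF e(1)] linmap_id _ t])
    fix vs assume vs: "vs \<in> lists_on M n"
    have "multilinear M n (tensor_power M n) (\<lambda>vs. tensor_act_pure A M act vs e)"
      using tensor_act_pure_multilinear e(1) by blast
    from tensor_lift(2)[OF is_vspace_tensor_power this vs]
    show "tensor_act A M act n e (pure_tensor M vs) = pure_tensor M vs"
      unfolding tensor_act_def by (simp add: pure[OF vs])
  qed
qed

end

section \<open>The tensor power of a bialgebra and its action on a direct sum\<close>

lemma is_vspace_space_cong: "vcar V = vcar V' \<Longrightarrow> vscale V = vscale V' \<Longrightarrow> is_vspace V = is_vspace V'"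
  by (simp add: is_vspace_def)

text \<open>
  The second statement is the recursion on pure tensors.  It rests on the multilinearity of the maps
  that are lifted in the definition, which is established on the way to the first statement.
\<close>

lemma multilinear_shuffle:
  fixes A :: "('k::field, 'a::ab_group_add, 'z) vspace_scheme"
  assumes A: "is_vspace A"
  shows "multilinear (tensor_power A 2) m (tensor_power (tensor_power A m) 2) (shuffle A)"
    and "length ts = m \<Longrightarrow> x \<in> vcar A \<Longrightarrow> y \<in> vcar A \<Longrightarrow> ts \<in> lists_on (tensor_power A 2) m \<Longrightarrow>
      p \<in> vcar (tensor_power A m) \<Longrightarrow> q \<in> vcar (tensor_power A m) \<Longrightarrow>
      shuffle A ts = pure_tensor (tensor_power A m) [p, q] \<Longrightarrow>
      shuffle A (pure_tensor A [x, y] # ts) =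
        pure_tensor (tensor_power A (Suc m)) [tensor_cons A m x p, tensor_cons A m y q]"
proof -
  define K where "K m x y p q =
    pure_tensor (tensor_power A (Suc m)) [tensor_cons A m x p, tensor_cons A m y q]" for m x y p q
  define T where "T m = tensor_power (tensor_power A (Suc m)) 2" for m
  have T: "is_vspace (T m)" for m unfolding T_def by (rule is_vspace_tensor_power)
  have K1: "linmap (tensor_power A m) (T m) (K m x y p)" "linmap A (T m) (\<lambda>y. K m x y p q)"
    if "x \<in> vcar A" "y \<in> vcar A" "p \<in> vcar (tensor_power A m)" "q \<in> vcar (tensor_power A m)" for m x y p q
    unfolding K_def T_def
    by (rule linmap_comp[OF _ linmap_pure_tensor_2(1)], rule linmap_tensor_cons linmap_tensor_cons_left[OF A],
        (rule that linmap_closed[OF linmap_tensor_cons])+)+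
  have K2: "linmap (tensor_power A m) (T m) (\<lambda>p. K m x y p q)" "linmap A (T m) (\<lambda>x. K m x y p q)"
    if "x \<in> vcar A" "y \<in> vcar A" "p \<in> vcar (tensor_power A m)" "q \<in> vcar (tensor_power A m)" for m x y p q
    unfolding K_def T_def
    by (rule linmap_comp[OF _ linmap_pure_tensor_2(2)], rule linmap_tensor_cons linmap_tensor_cons_left[OF A],
        (rule that linmap_closed[OF linmap_tensor_cons])+)+
  have K3: "multilinear (tensor_power A m) 2 (T m) (\<lambda>ps. K m (xs ! 0) (xs ! 1) (ps ! 0) (ps ! 1))"
    if "xs \<in> lists_on A 2" for m xs
    using that by (intro multilinear_2I K1 K2) (auto simp: lists_on_2)
  have K4: "multilinear A 2 (T m) (\<lambda>xs. K m (xs ! 0) (xs ! 1) (ps ! 0) (ps ! 1))"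
    if "ps \<in> lists_on (tensor_power A m) 2" for m ps
    using that by (intro multilinear_2I K1 K2) (auto simp: lists_on_2)
  define L where "L m xs s =
    tensor_lift (tensor_power A m) 2 (T m) (\<lambda>ps. K m (xs ! 0) (xs ! 1) (ps ! 0) (ps ! 1)) s" for m xs s
  have L1: "linmap (tensor_power (tensor_power A m) 2) (T m) (L m xs)" if "xs \<in> lists_on A 2" for m xs
    unfolding L_def[abs_def] by (intro linmap_tensor_lift T K3 that)
  have L2: "multilinear A 2 (T m) (\<lambda>xs. L m xs s)"
    if "s \<in> vcar (tensor_power (tensor_power A m) 2)" for m s
    unfolding L_def by (rule multilinear_tensor_lift_parameter[OF T A K3 K4 that])
  have eq: "shuffle A (t # ts) = tensor_lift A 2 (T m) (\<lambda>xs. L m xs (shuffle A ts)) t"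
    if "length ts = m" for t ts m
    unfolding L_def K_def T_def using that by (simp add: Let_def)
  have ml: "multilinear (tensor_power A 2) m (tensor_power (tensor_power A m) 2) (shuffle A)" for m
  proof (induction m)
    case 0
    show ?case
      by (auto simp: multilinear_Nil lists_on_2 intro!: pure_tensor_closed)
  next
    case (Suc m)
    have S: "shuffle A ts \<in> vcar (tensor_power (tensor_power A m) 2)"
      if "ts \<in> lists_on (tensor_power A 2) m" for ts
      by (rule multilinear_closed[OF Suc that])
    have "multilinear (tensor_power A 2) m (T m) (\<lambda>ts. shuffle A (t # ts))"
      if t: "t \<in> vcar (tensor_power A 2)" for t
    proof (subst multilinear_cong[OF eq is_vspace_tensor_power])
      show "multilinear (tensor_power A 2) m (T m)
        (\<lambda>ts. tensor_lift A 2 (T m) (\<lambda>xs. L m xs (shuffle A ts)) t)"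
        by (rule multilinear_tensor_lift_parameter[OF T is_vspace_tensor_power L2[OF S] _ t])
          (auto intro: multilinear_compose[OF Suc L1])
    qed (simp add: lists_on_def)
    moreover have "linmap (tensor_power A 2) (T m) (\<lambda>t. shuffle A (t # ts))"
      if ts: "ts \<in> lists_on (tensor_power A 2) m" for ts
    proof -
      have "length ts = m" using ts by (simp add: lists_on_def)
      then show ?thesis
        unfolding eq[OF \<open>length ts = m\<close>] by (intro linmap_tensor_lift T L2 S ts)
    qed
    ultimately show ?case by (auto simp: multilinear_Suc_iff T_def simp del: shuffle.simps)
  qed
  show "multilinear (tensor_power A 2) m (tensor_power (tensor_power A m) 2) (shuffle A)"
    by (rule ml)
  assume l: "length ts = m" and xy: "x \<in> vcar A" "y \<in> vcar A"
    and ts: "ts \<in> lists_on (tensor_power A 2) m"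
    and pq: "p \<in> vcar (tensor_power A m)" "q \<in> vcar (tensor_power A m)"
    and sh: "shuffle A ts = pure_tensor (tensor_power A m) [p, q]"
  have "shuffle A (pure_tensor A [x, y] # ts) = L m [x, y] (shuffle A ts)"
    unfolding eq[OF l]
    by (rule tensor_lift(2)[OF T L2]) (use xy multilinear_closed[OF ml ts] in \<open>auto simp: lists_on_2\<close>)
  also have "\<dots> = K m x y p q"
    using tensor_lift(2)[OF T K3, of "[x, y]" "[p, q]" m] xy pq by (simp add: L_def sh lists_on_2)
  finally show "shuffle A (pure_tensor A [x, y] # ts) =
        pure_tensor (tensor_power A (Suc m)) [tensor_cons A m x p, tensor_cons A m y q]"
    by (simp add: K_def)
qed

lemma lists_on_replicate: "x \<in> vcar V \<Longrightarrow> replicate n x \<in> lists_on V n"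
  by (auto simp: lists_on_def)

lemma shuffle_replicate_unit:
  assumes A: "is_vspace A" and e: "e \<in> vcar A"
  shows "shuffle A (replicate m (pure_tensor A [e, e])) =
    pure_tensor (tensor_power A m) [pure_tensor A (replicate m e), pure_tensor A (replicate m e)]"
proof (induction m)
  case (Suc m)
  have "pure_tensor A [e, e] \<in> vcar (tensor_power A 2)"
    by (rule pure_tensor_closed) (use e in \<open>auto simp: lists_on_2\<close>)
  then have "shuffle A (pure_tensor A [e, e] # replicate m (pure_tensor A [e, e])) =
     pure_tensor (tensor_power A (Suc m))
       [tensor_cons A m e (pure_tensor A (replicate m e)), tensor_cons A m e (pure_tensor A (replicate m e))]"
    by (intro multilinear_shuffle(2)[OF A] Suc e lists_on_replicate pure_tensor_closed)
      (simp_all add: lists_on_2 e)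
  then show ?case by (simp add: tensor_cons_pure e lists_on_replicate del: shuffle.simps)
qed simp

lemma tensor_bialg_simps:
  "vcar (tensor_bialg d A) = vcar (tensor_power A d)"
  "vscale (tensor_bialg d A) = tensor_scale"
  "aone (tensor_bialg d A) = pure_tensor A (replicate d (aone A))"
  by (simp_all add: tensor_bialg_def)

lemma tensor_power_tensor_bialg: "tensor_power (tensor_bialg d A) n = tensor_power (tensor_power A d) n"
  by (intro fun_cong[OF tensor_power_space_cong]) (simp_all add: tensor_bialg_simps)

lemma pure_tensor_tensor_bialg: "pure_tensor (tensor_bialg d A) = pure_tensor (tensor_power A d)"
  by (intro pure_tensor_space_cong) (simp_all add: tensor_bialg_simps)

lemma is_vspace_tensor_bialg: "is_vspace (tensor_bialg d A)"
  using is_vspace_tensor_power[of A d]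
  by (subst is_vspace_space_cong[of _ "tensor_power A d"]) (simp_all add: tensor_bialg_simps)

lemma bialgebraD:
  assumes "is_bialgebra A"
  shows "is_vspace A" "aone A \<in> vcar A" "linmap A (tensor_power A 2) (comult A)"
    "linmap A scalars (counit A)" "comult A (aone A) = pure_tensor A [aone A, aone A]"
    "counit A (aone A) = 1"
  using assms by (auto simp: is_bialgebra_def is_algebra_def restrict_linear_maps_iff)

lemma multilinear_comult_tensor_bialg:
  fixes A :: "('k::field, 'a::ab_group_add) bialg"
  assumes "is_bialgebra A"
  shows "multilinear A d (tensor_power (tensor_power A d) 2)
    (\<lambda>xs. shuffle (vspace.truncate A) (map (comult A) xs))"
proof -
  let ?A = "vspace.truncate A"
  have tr: "vcar ?A = vcar A" "vscale ?A = vscale A" by (simp_all add: vspace.truncate_def)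
  have "is_vspace ?A" using bialgebraD(1)[OF assms] by (simp add: is_vspace_space_cong[OF tr])
  then have "multilinear (tensor_power A 2) d (tensor_power (tensor_power A d) 2) (shuffle ?A)"
    using multilinear_shuffle(1)[of ?A d] by (simp add: tensor_power_space_cong[OF tr])
  then show ?thesis by (rule multilinear_map[OF bialgebraD(3)[OF assms]])
qed

lemma linmap_comult_tensor_bialg:
  assumes "is_bialgebra A"
  shows "linmap (tensor_bialg d A) (tensor_power (tensor_bialg d A) 2) (comult (tensor_bialg d A))"
proof -
  have "linmap (tensor_power A d) (tensor_power (tensor_power A d) 2) (comult (tensor_bialg d A))"
    unfolding tensor_bialg_def
    by (simp add: linmap_tensor_lift is_vspace_tensor_power multilinear_comult_tensor_bialg[OF assms])
  then show ?thesis
    unfolding tensor_power_tensor_bialg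
    by (subst linmap_space_cong[of _ "tensor_power A d"]) (simp_all add: tensor_bialg_simps)
qed

lemma multilinear_prod_list:
  fixes e :: "'v::ab_group_add \<Rightarrow> 'k::field"
  assumes e: "linmap V scalars e"
  shows "multilinear V n (scalars :: ('k, 'k) vspace) (\<lambda>xs. prod_list (map e xs))"
proof (induction n)
  case (Suc n)
  then have "multilinear V n (scalars :: ('k, 'k) vspace) (\<lambda>xs. vscale scalars (e x) (prod_list (map e xs)))" for x
    by (intro multilinear_cmult is_vspace_scalars)
  then show ?case
    using e by (auto simp: multilinear_Suc_iff linmap_def scalars_def algebra_simps)
qed (simp add: multilinear_Nil scalars_def)

lemma linmap_counit_tensor_bialg:
  assumes "is_bialgebra A"
  shows "linmap (tensor_bialg d A) scalars (counit (tensor_bialg d A))"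
proof -
  have "linmap (tensor_power A d) scalars (counit (tensor_bialg d A))"
    unfolding tensor_bialg_def
    by (simp add: linmap_tensor_lift is_vspace_scalars multilinear_prod_list[OF bialgebraD(4)[OF assms]])
  then show ?thesis
    by (subst linmap_space_cong[of _ "tensor_power A d"]) (simp_all add: tensor_bialg_simps)
qed

lemma tensor_bialg_unit:
  fixes A :: "('k::field, 'a::ab_group_add) bialg" and d :: nat
  assumes A: "is_bialgebra A"
  defines "B \<equiv> tensor_bialg d A"
  shows "aone B \<in> vcar B" "comult B (aone B) = pure_tensor B [aone B, aone B]" "counit B (aone B) = 1"
proof -
  note D = bialgebraD[OF A]
  let ?A = "vspace.truncate A"
  have tr: "vcar ?A = vcar A" "vscale ?A = vscale A" by (simp_all add: vspace.truncate_def)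
  have vA: "is_vspace ?A" using D(1) by (simp add: is_vspace_space_cong[OF tr])
  have one: "replicate d (aone A) \<in> lists_on A d" by (rule lists_on_replicate[OF D(2)])
  show "aone B \<in> vcar B"
    unfolding B_def tensor_bialg_simps by (rule pure_tensor_closed[OF one])
  have "comult B (aone B) = shuffle ?A (map (comult A) (replicate d (aone A)))"
    unfolding B_def tensor_bialg_def
    by (simp add: tensor_lift(2)[OF is_vspace_tensor_power multilinear_comult_tensor_bialg[OF A] one])
  also have "\<dots> = shuffle ?A (replicate d (pure_tensor ?A [aone A, aone A]))"
    by (simp add: D(5) pure_tensor_space_cong[OF tr])
  also have "\<dots> = pure_tensor B [aone B, aone B]"
    using shuffle_replicate_unit[OF vA, of "aone A" d] D(2)
    by (simp add: tr B_def pure_tensor_tensor_bialg tensor_power_space_cong[OF tr]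
        pure_tensor_space_cong[OF tr] tensor_bialg_simps)
  finally show "comult B (aone B) = pure_tensor B [aone B, aone B]" .
  show "counit B (aone B) = 1"
    unfolding B_def tensor_bialg_def
    by (simp add: tensor_lift(2)[OF is_vspace_scalars multilinear_prod_list[OF D(4)] one] D(6))
qed

lemma sum_space_simps:
  "v \<in> vcar (sum_space d V0) \<longleftrightarrow> (\<forall>b\<in>{1..d}. v b \<in> vcar V0) \<and> (\<forall>b. b \<notin> {1..d} \<longrightarrow> v b = 0)"
  "vscale (sum_space d V0) c v = (\<lambda>b. vscale V0 c (v b))"
  by (simp_all add: sum_space_def)

lemma is_vspace_sum_space:
  assumes V0: "is_vspace V0"
  shows "is_vspace (sum_space d V0)"
proof -
  interpret V: vector_space "vscale (sum_space d V0)"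
    by unfold_locales
      (auto simp: sum_space_def fun_eq_iff scale_add_right[OF V0] scale_add_left[OF V0]
        scale_scale[OF V0] scale_one[OF V0])
  have "V.subspace (vcar (sum_space d V0))"
    unfolding V.subspace_def using V0
    by (auto simp: sum_space_simps vspace_zero vspace_add vspace_scale scale_zero_right)
  then show ?thesis by (simp add: is_vspace_def V.vector_space_axioms)
qed

lemma linmap_sum_spaceI:
  assumes "\<And>b. b \<in> {1..d} \<Longrightarrow> linmap V V0 (\<lambda>x. f x b)" and "\<And>x b. b \<notin> {1..d} \<Longrightarrow> f x b = 0"
    and V0: "is_vspace V0"
  shows "linmap V (sum_space d V0) f"
proof (rule linmapI)
  show "f (x + y) = f x + f y" if "x \<in> vcar V" "y \<in> vcar V" for x y
  proof
    fix b show "f (x + y) b = (f x + f y) b"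
      using that assms(1)[of b] assms(2)[of b] by (cases "b \<in> {1..d}") (auto simp: linmap_def)
  qed
  show "f (vscale V c x) = vscale (sum_space d V0) c (f x)" if "x \<in> vcar V" for c x
  proof
    fix b show "f (vscale V c x) b = vscale (sum_space d V0) c (f x) b"
      using that assms(1)[of b] assms(2)[of b]
      by (cases "b \<in> {1..d}") (auto simp: linmap_def sum_space_simps scale_zero_right[OF V0])
  qed
qed (use assms in \<open>auto simp: sum_space_simps linmap_def\<close>)

definition sum_act_pure ::
  "nat \<Rightarrow> ('k::field, 'a::ab_group_add) bialg \<Rightarrow> ('k, 'v::ab_group_add) vspace \<Rightarrow> ('a \<Rightarrow> 'v \<Rightarrow> 'v)
    \<Rightarrow> (nat \<Rightarrow> 'v) \<Rightarrow> 'a list \<Rightarrow> nat \<Rightarrow> 'v" where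
  "sum_act_pure d A0 V0 act v xs b = (if b \<in> {1..d}
     then vscale V0 (\<Prod>c\<in>{1..d} - {b}. counit A0 (xs ! (c - 1))) (act (xs ! (b - 1)) (v b)) else 0)"

lemma sum_act_eq:
  "sum_act d A0 V0 act a v = tensor_lift A0 d (sum_space d V0) (sum_act_pure d A0 V0 act v) a"
  by (simp add: sum_act_def sum_act_pure_def[abs_def])

lemma is_moduleD:
  assumes "is_module A M act" "is_vspace A"
  shows "is_vspace M" "a \<in> vcar A \<Longrightarrow> linmap M M (act a)"
    "v \<in> vcar M \<Longrightarrow> linmap A M (\<lambda>a. act a v)" "v \<in> vcar M \<Longrightarrow> act (aone A) v = v"
  using assms by (auto simp: is_module_def restrict_linear_maps_iff)

text \<open>
  In degree \<open>b\<close> the \<open>b\<close>-th tensor factor acts on the vector, and each other factor contributes a scalar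
  through the counit.  So an update of one factor changes either the vector or one scalar factor.
\<close>

lemma multilinear_sum_act_pure:
  assumes A: "is_bialgebra A0" and M: "is_module A0 V0 act" and v: "v \<in> vcar (sum_space d V0)"
  shows "multilinear A0 d (sum_space d V0) (sum_act_pure d A0 V0 act v)"
proof (rule multilinearI)
  note D = bialgebraD[OF A] and E = is_moduleD[OF M bialgebraD(1)[OF A]]
  fix xs assume xs: "xs \<in> lists_on A0 d"
  have "act (xs ! (b - 1)) (v b) \<in> vcar V0" if "b \<in> {1..d}" for b
    using v that lists_on_nth[OF xs, of "b - 1"] linmap_closed[OF E(2)] by (auto simp: sum_space_simps)
  then show "sum_act_pure d A0 V0 act v xs \<in> vcar (sum_space d V0)"
    by (auto simp: sum_space_simps sum_act_pure_def intro!: vspace_scale[OF E(1)])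
  fix i assume i: "i < d"
  show "linmap A0 (sum_space d V0) (\<lambda>x. sum_act_pure d A0 V0 act v (xs[i := x]))"
  proof (rule linmap_sum_spaceI)
    fix b assume b: "b \<in> {1..d}"
    have vb: "v b \<in> vcar V0" using v b by (simp add: sum_space_simps)
    have len: "length xs = d" using xs by (simp add: lists_on_def)
    show "linmap A0 V0 (\<lambda>x. sum_act_pure d A0 V0 act v (xs[i := x]) b)"
    proof (cases "i = b - 1")
      case True
      have "sum_act_pure d A0 V0 act v (xs[i := x]) b =
          vscale V0 (\<Prod>c\<in>{1..d} - {b}. counit A0 (xs ! (c - 1))) (act x (v b))" for x
      proof -
        have "(\<Prod>c\<in>{1..d} - {b}. counit A0 (xs[i := x] ! (c - 1))) =
            (\<Prod>c\<in>{1..d} - {b}. counit A0 (xs ! (c - 1)))"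
          using True b by (intro prod.cong HOL.refl) (auto simp: nth_list_update)
        then show ?thesis using True b len i by (simp add: sum_act_pure_def)
      qed
      then show ?thesis by (simp add: linmap_cmult E vb)
    next
      case False
      let ?r = "\<Prod>c\<in>{1..d} - {b} - {Suc i}. counit A0 (xs ! (c - 1))"
      let ?w = "act (xs ! (b - 1)) (v b)"
      have "sum_act_pure d A0 V0 act v (xs[i := x]) b = vscale V0 (counit A0 x * ?r) ?w" for x
      proof -
        have "(\<Prod>c\<in>{1..d} - {b}. counit A0 (xs[i := x] ! (c - 1))) =
            counit A0 (xs[i := x] ! (Suc i - 1)) *
            (\<Prod>c\<in>{1..d} - {b} - {Suc i}. counit A0 (xs[i := x] ! (c - 1)))"
          using False b i by (intro prod.remove) auto
        also have "(\<Prod>c\<in>{1..d} - {b} - {Suc i}. counit A0 (xs[i := x] ! (c - 1))) = ?r"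
          by (intro prod.cong HOL.refl) (auto simp: nth_list_update)
        finally show ?thesis using False b len i by (simp add: sum_act_pure_def)
      qed
      moreover have "?w \<in> vcar V0"
        using vb b lists_on_nth[OF xs, of "b - 1"] linmap_closed[OF E(2)] by auto
      ultimately show ?thesis
        using D(4) by (simp add: linmap_def scalars_def vspace_scale[OF E(1)] scale_scale[OF E(1)]
            scale_add_left[OF E(1), symmetric] algebra_simps)
    qed
  qed (use E in \<open>auto simp: sum_act_pure_def\<close>)
qed

lemma comult_action_tensor_bialg:
  assumes A: "is_bialgebra A0" and M: "is_module A0 V0 act"
  shows "comult_action (tensor_bialg d A0) (sum_space d V0) (sum_act d A0 V0 act)"
proof
  note D = bialgebraD[OF A] and E = is_moduleD[OF M bialgebraD(1)[OF A]]
  show V: "is_vspace (sum_space d V0)" by (rule is_vspace_sum_space[OF E(1)])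
  show "linmap (sum_space d V0) (sum_space d V0) (sum_act d A0 V0 act a)"
    if "a \<in> vcar (tensor_bialg d A0)" for a
    unfolding sum_act_eq
  proof (rule linmap_tensor_lift_parameter[OF V V multilinear_sum_act_pure[OF A M]])
    fix xs assume xs: "xs \<in> lists_on A0 d"
    have "linmap V0 V0 (act (xs ! (b - 1)))" if "b \<in> {1..d}" for b
      using that lists_on_nth[OF xs, of "b - 1"] by (intro E) auto
    then show "linmap (sum_space d V0) (sum_space d V0) (\<lambda>v. sum_act_pure d A0 V0 act v xs)"
      by (intro linmap_sum_spaceI E(1))
        (auto simp: sum_act_pure_def sum_space_simps linmap_def vspace_scale[OF E(1)]
          scale_scale[OF E(1)] scale_add_right[OF E(1)] mult.commute)
  qed (use that in \<open>auto simp: tensor_bialg_simps\<close>)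
  show "linmap (tensor_bialg d A0) (sum_space d V0) (\<lambda>a. sum_act d A0 V0 act a v)"
    if "v \<in> vcar (sum_space d V0)" for v
    unfolding sum_act_eq
    by (subst linmap_space_cong[of _ "tensor_power A0 d"], simp_all only: tensor_bialg_simps vscale_tensor_power)
      (rule linmap_tensor_lift[OF V multilinear_sum_act_pure[OF A M that]])
qed (rule is_vspace_tensor_bialg linmap_comult_tensor_bialg[OF A] linmap_counit_tensor_bialg[OF A])+

lemma sum_act_unit:
  assumes A: "is_bialgebra A0" and M: "is_module A0 V0 act" and v: "v \<in> vcar (sum_space d V0)"
  shows "sum_act d A0 V0 act (aone (tensor_bialg d A0)) v = v"
proof -
  note D = bialgebraD[OF A] and E = is_moduleD[OF M bialgebraD(1)[OF A]]
  have "sum_act d A0 V0 act (aone (tensor_bialg d A0)) v = sum_act_pure d A0 V0 act v (replicate d (aone A0))"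
    unfolding sum_act_eq tensor_bialg_simps
    by (rule tensor_lift(2)[OF is_vspace_sum_space[OF E(1)] multilinear_sum_act_pure[OF A M v]
          lists_on_replicate[OF D(2)]])
  also have "\<dots> = v"
  proof
    fix b
    have "counit A0 (replicate d (aone A0) ! (c - 1)) = 1" if "c \<in> {1..d}" for c
      using that by (auto simp: D(6))
    then have "(\<Prod>c\<in>{1..d} - {b}. counit A0 (replicate d (aone A0) ! (c - 1))) = 1"
      by (intro prod.neutral) auto
    then show "sum_act_pure d A0 V0 act v (replicate d (aone A0)) b = v b"
      using v by (auto simp: sum_act_pure_def sum_space_simps scale_one[OF E(1)] E(4))
  qed
  finally show ?thesis .
qed

section \<open>Endomorphisms commuting with the smash product\<close>

lemma linmap_perm_act_sum:
  assumes "g permutes {1..d}"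
  shows "linmap (sum_space d V0) (sum_space d V0) (perm_act_sum g)"
proof (rule linmapI)
  show "perm_act_sum g v \<in> vcar (sum_space d V0)" if "v \<in> vcar (sum_space d V0)" for v
    using that unfolding sum_space_simps perm_act_sum_def
    by (metis permutes_in_image permutes_inv[OF assms])
qed (simp_all add: sum_space_simps perm_act_sum_def fun_eq_iff)

lemma carrier_End_alg:
  "f \<in> carrier (End_alg A M act) \<longleftrightarrow>
     f \<in> linear_maps M M \<and> (\<forall>a\<in>vcar A. \<forall>x\<in>vcar M. f (act a x) = act a (f x))"
  by (simp add: End_alg_def)

text \<open>
  An element \<open>a\<close> of \<open>A\<close> at the permutation \<open>g\<close>, and 0 elsewhere, acts by \<open>g\<close> followed by \<open>a\<close>.
  With \<open>g = id\<close> this is the action of \<open>A\<close>; with \<open>a = 1\<close> it is the action of \<open>g\<close>, because the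
  unit of \<open>A\<close> is group-like and acts as the identity.  Sums of these elements exhaust the smash product.
\<close>

lemma End_smash_iff:
  assumes A: "is_bialgebra A0" and M: "is_module A0 V0 act"
  shows "f \<in> carrier (End_smash d A0 V0 act n) \<longleftrightarrow>
    f \<in> carrier (End_A d A0 V0 act n) \<and>
    (\<forall>g. g permutes {1..d} \<longrightarrow> (\<forall>t\<in>vcar (tensor_power (sum_space d V0) n).
      f (tensor_map (sum_space d V0) (sum_space d V0) n (perm_act_sum g) t) =
      tensor_map (sum_space d V0) (sum_space d V0) n (perm_act_sum g) (f t)))" (is "?L \<longleftrightarrow> ?R")
proof -
  let ?V = "sum_space d V0" and ?A = "tensor_bialg d A0" and ?S = "smash d A0"
  let ?W = "tensor_power ?V n"
  let ?G = "\<lambda>g. tensor_map ?V ?V n (perm_act_sum g)" and ?act = "A_act d A0 V0 act n"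
  interpret comult_action ?A ?V "sum_act d A0 V0 act" by (rule comult_action_tensor_bialg[OF A M])
  have G: "?G g t \<in> vcar ?W" if "g permutes {1..d}" "t \<in> vcar ?W" for g t
    by (rule linmap_closed[OF linmap_tensor_map[OF linmap_perm_act_sum[OF that(1)]] that(2)])
  have G_id: "?G id t = t" if "t \<in> vcar ?W" for t
  proof (rule linmap_tensor_eq[OF is_vspace_tensor_power linmap_tensor_map linmap_id _ that])
    show "linmap ?V ?V (perm_act_sum id)" by (rule linmap_perm_act_sum[OF permutes_id])
    show "?G id (pure_tensor ?V vs) = pure_tensor ?V vs" if "vs \<in> lists_on ?V n" for vs
      by (subst tensor_map_pure[OF linmap_perm_act_sum[OF permutes_id] that])
        (simp add: perm_act_sum_def[abs_def])
  qed
  have act_lin: "linmap ?W ?W (?act a)" if "a \<in> vcar ?A" for a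
    unfolding A_act_def by (rule linmap_tensor_act[OF that])
  have act_0: "?act 0 t = 0" if "t \<in> vcar ?W" for t
    unfolding A_act_def
    by (rule linmap_zero[OF vspace_A is_vspace_tensor_power linmap_tensor_act_left[OF that]])
  have act_1: "?act (aone ?A) t = t" if "t \<in> vcar ?W" for t
    unfolding A_act_def
    by (rule tensor_act_unit[OF tensor_bialg_unit[OF A] sum_act_unit[OF A M] that])
  define single where "single g a = (\<lambda>h. if h = g then a else 0)" for g :: "nat \<Rightarrow> nat" and a :: "('b, 'a) tensor"
  have single: "single g a \<in> vcar ?S" if "g permutes {1..d}" "a \<in> vcar ?A" for g a
    using that by (auto simp: single_def smash_def Let_def vspace_zero[OF vspace_A])
  have act_single: "smash_act d A0 V0 act n (single g a) t = ?act a (?G g t)"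
    if "g permutes {1..d}" "a \<in> vcar ?A" "t \<in> vcar ?W" for g a t
  proof -
    have "smash_act d A0 V0 act n (single g a) t =
        (\<Sum>h | h permutes {1..d}. if h = g then ?act a (?G g t) else 0)"
      unfolding smash_act_def
      by (intro sum.cong HOL.refl) (auto simp: single_def act_0 G that)
    then show ?thesis using that by (simp add: sum.delta' finite_permutations)
  qed
  show ?thesis
  proof
    assume L: ?L
    then have lin: "f \<in> linear_maps ?W ?W"
      and com: "\<And>u t. u \<in> vcar ?S \<Longrightarrow> t \<in> vcar ?W \<Longrightarrow>
        f (smash_act d A0 V0 act n u t) = smash_act d A0 V0 act n u (f t)"
      by (auto simp: End_smash_def carrier_End_alg)
    have f: "f t \<in> vcar ?W" if "t \<in> vcar ?W" for t
      by (rule linmap_closed[OF linear_mapsD[OF lin] that])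
    have "f (?act a t) = ?act a (f t)" if "a \<in> vcar ?A" "t \<in> vcar ?W" for a t
      using com[OF single[OF permutes_id that(1)] that(2)] that
      by (simp add: act_single permutes_id G_id f)
    moreover have "f (?G g t) = ?G g (f t)" if "g permutes {1..d}" "t \<in> vcar ?W" for g t
      using com[OF single[OF that(1) tensor_bialg_unit(1)[OF A]] that(2)] that
      by (simp add: act_single tensor_bialg_unit(1)[OF A] act_1 G f)
    ultimately show ?R using lin by (auto simp: End_A_def carrier_End_alg)
  next
    assume R: ?R
    then have lin: "f \<in> linear_maps ?W ?W"
      and com: "\<And>a t. a \<in> vcar ?A \<Longrightarrow> t \<in> vcar ?W \<Longrightarrow> f (?act a t) = ?act a (f t)"
      and comG: "\<And>g t. g permutes {1..d} \<Longrightarrow> t \<in> vcar ?W \<Longrightarrow> f (?G g t) = ?G g (f t)"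
      by (auto simp: End_A_def carrier_End_alg)
    have "f (smash_act d A0 V0 act n u t) = smash_act d A0 V0 act n u (f t)"
      if "u \<in> vcar ?S" "t \<in> vcar ?W" for u t
    proof -
      have u: "u g \<in> vcar ?A" if "g permutes {1..d}" for g
        using \<open>u \<in> vcar ?S\<close> that by (auto simp: smash_def Let_def)
      have "f (smash_act d A0 V0 act n u t) = (\<Sum>g | g permutes {1..d}. f (?act (u g) (?G g t)))"
        unfolding smash_act_def
        by (rule linmap_sum[OF is_vspace_tensor_power is_vspace_tensor_power linear_mapsD[OF lin]])
          (auto intro!: linmap_closed[OF act_lin] u G that)
      also have "\<dots> = smash_act d A0 V0 act n u (f t)"
        unfolding smash_act_def by (intro sum.cong HOL.refl) (auto simp: com comG u G that)
      finally show ?thesis .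
    qed
    then show ?L using lin by (auto simp: End_smash_def carrier_End_alg)
  qed
qed

section \<open>Algebras over the field\<close>

text \<open>
  Associative, not necessarily commutative algebras over a field whose elements fill a type.
\<close>

locale kalgebra = ring A for A :: "('k::field, 'a, 'z) module_scheme" (structure) +
  assumes smult_closed [simp, intro]: "x \<in> carrier A \<Longrightarrow> c \<odot> x \<in> carrier A"
    and smult_add_left: "x \<in> carrier A \<Longrightarrow> (a + c) \<odot> x = a \<odot> x \<oplus> c \<odot> x"
    and smult_add_right: "x \<in> carrier A \<Longrightarrow> y \<in> carrier A \<Longrightarrow> c \<odot> (x \<oplus> y) = c \<odot> x \<oplus> c \<odot> y"
    and smult_smult: "x \<in> carrier A \<Longrightarrow> a \<odot> (c \<odot> x) = (a * c) \<odot> x"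
    and smult_one [simp]: "x \<in> carrier A \<Longrightarrow> 1 \<odot> x = x"
    and smult_mult_left: "x \<in> carrier A \<Longrightarrow> y \<in> carrier A \<Longrightarrow> (c \<odot> x) \<otimes> y = c \<odot> (x \<otimes> y)"
    and smult_mult_right: "x \<in> carrier A \<Longrightarrow> y \<in> carrier A \<Longrightarrow> x \<otimes> (c \<odot> y) = c \<odot> (x \<otimes> y)"
begin

lemma smult_zero_left [simp]: "x \<in> carrier A \<Longrightarrow> 0 \<odot> x = \<zero>"
  using smult_add_left[of x 0 0] add.l_cancel_one' by fastforce

lemma smult_zero_right [simp]: "c \<odot> \<zero> = \<zero>"
  using smult_add_right[of \<zero> \<zero> c] add.l_cancel_one' by fastforce

lemma smult_finsum:
  "finite S \<Longrightarrow> f \<in> S \<rightarrow> carrier A \<Longrightarrow> c \<odot> (\<Oplus>i\<in>S. f i) = (\<Oplus>i\<in>S. c \<odot> f i)"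
proof (induction S rule: finite_induct)
  case (insert i S)
  then have "f \<in> S \<rightarrow> carrier A" "f i \<in> carrier A" "(\<lambda>i. c \<odot> f i) \<in> S \<rightarrow> carrier A" by auto
  then show ?case using insert by (simp add: smult_add_right)
qed simp

lemma coset_eqI:
  assumes I: "ideal I A" and x: "x \<in> carrier A" and y: "y \<in> carrier A" and xy: "x \<ominus> y \<in> I"
  shows "I +> x = I +> y"
proof -
  interpret I: ideal I A by fact
  have "x = (x \<ominus> y) \<oplus> y" using x y by (simp add: a_minus_def a_assoc l_neg)
  then have "x \<in> I +> y" using xy by (auto simp: a_r_coset_def')
  then show ?thesis by (intro I.a_repr_independence'[symmetric] y)
qed

end

lemma alg_homD:
  assumes "f \<in> alg_hom A B"
  shows "f \<in> ring_hom A B" "f \<in> extensional (carrier A)" "x \<in> carrier A \<Longrightarrow> f x \<in> carrier B"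
    "x \<in> carrier A \<Longrightarrow> y \<in> carrier A \<Longrightarrow> f (x \<otimes>\<^bsub>A\<^esub> y) = f x \<otimes>\<^bsub>B\<^esub> f y"
    "x \<in> carrier A \<Longrightarrow> y \<in> carrier A \<Longrightarrow> f (x \<oplus>\<^bsub>A\<^esub> y) = f x \<oplus>\<^bsub>B\<^esub> f y"
    "f \<one>\<^bsub>A\<^esub> = \<one>\<^bsub>B\<^esub>" "x \<in> carrier A \<Longrightarrow> f (c \<odot>\<^bsub>A\<^esub> x) = c \<odot>\<^bsub>B\<^esub> f x"
  using assms by (auto simp: alg_hom_def ring_hom_def)

lemma alg_homI:
  assumes "f \<in> extensional (carrier A)" "\<And>x. x \<in> carrier A \<Longrightarrow> f x \<in> carrier B"
    "\<And>x y. x \<in> carrier A \<Longrightarrow> y \<in> carrier A \<Longrightarrow> f (x \<otimes>\<^bsub>A\<^esub> y) = f x \<otimes>\<^bsub>B\<^esub> f y"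
    "\<And>x y. x \<in> carrier A \<Longrightarrow> y \<in> carrier A \<Longrightarrow> f (x \<oplus>\<^bsub>A\<^esub> y) = f x \<oplus>\<^bsub>B\<^esub> f y"
    "f \<one>\<^bsub>A\<^esub> = \<one>\<^bsub>B\<^esub>" "\<And>c x. x \<in> carrier A \<Longrightarrow> f (c \<odot>\<^bsub>A\<^esub> x) = c \<odot>\<^bsub>B\<^esub> f x"
  shows "f \<in> alg_hom A B"
  using assms by (auto simp: alg_hom_def ring_hom_def)

lemma alg_hom_comp:
  assumes f: "f \<in> alg_hom A B" and g: "g \<in> alg_hom B C" and A: "kalgebra A"
  shows "(\<lambda>x\<in>carrier A. g (f x)) \<in> alg_hom A C"
proof -
  interpret kalgebra A by fact
  show ?thesis
    by (intro alg_homI) (simp_all add: alg_homD[OF f] alg_homD[OF g])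
qed

subsection \<open>Endomorphism algebras\<close>

lemma kalgebra_End_alg:
  assumes M: "is_vspace M" and act: "\<And>a. a \<in> vcar A \<Longrightarrow> linmap M M (act a)"
  shows "kalgebra (End_alg A M act)" (is "kalgebra ?E")
proof -
  have eqI: "f = g" if "f \<in> extensional (vcar M)" "g \<in> extensional (vcar M)"
    "\<And>x. x \<in> vcar M \<Longrightarrow> f x = g x" for f g
    using that by (rule extensionalityI)
  have ext: "f \<in> extensional (vcar M)" and cl: "x \<in> vcar M \<Longrightarrow> f x \<in> vcar M"
    and fadd: "x \<in> vcar M \<Longrightarrow> y \<in> vcar M \<Longrightarrow> f (x + y) = f x + f y"
    and fsc: "x \<in> vcar M \<Longrightarrow> f (vscale M c x) = vscale M c (f x)"
    if "f \<in> carrier ?E" for f x y c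
    using that by (auto simp: carrier_End_alg linear_maps_iff linmap_def)
  have acl: "x \<in> vcar M \<Longrightarrow> act a x \<in> vcar M" if "a \<in> vcar A" for a x
    using act[OF that] by (rule linmap_closed)
  have com: "f (act a x) = act a (f x)" if "f \<in> carrier ?E" "a \<in> vcar A" "x \<in> vcar M" for f a x
    using that by (auto simp: carrier_End_alg)
  have smult_cl: "(\<lambda>x\<in>vcar M. vscale M c (f x)) \<in> carrier ?E" if f: "f \<in> carrier ?E" for c f
    unfolding carrier_End_alg linear_maps_iff using f
    by (auto simp: linmap_def M cl fadd fsc vspace_add vspace_scale scale_add_right scale_scale
        mult.commute acl com linmap_scale[OF act])
  have add_cl: "(\<lambda>x\<in>vcar M. f x + g x) \<in> carrier ?E" if "f \<in> carrier ?E" "g \<in> carrier ?E" for f g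
    unfolding carrier_End_alg linear_maps_iff using that
    by (auto simp: linmap_def M cl fadd fsc vspace_add vspace_scale scale_add_right
        algebra_simps acl com linmap_add[OF act])
  have zero_cl: "(\<lambda>x\<in>vcar M. 0) \<in> carrier ?E"
    unfolding carrier_End_alg linear_maps_iff
    by (auto simp: linmap_def M vspace_add vspace_scale vspace_zero scale_zero_right acl
        linmap_zero[OF M M act])
  have one_cl: "(\<lambda>x\<in>vcar M. x) \<in> carrier ?E"
    unfolding carrier_End_alg linear_maps_iff
    by (auto simp: linmap_def M vspace_add vspace_scale acl)
  have mult_cl: "compose (vcar M) f g \<in> carrier ?E" if "f \<in> carrier ?E" "g \<in> carrier ?E" for f g
    unfolding carrier_End_alg linear_maps_iff using that
    by (auto simp: linmap_def M cl fadd fsc vspace_add vspace_scale compose_def acl com)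
  have ops: "f \<otimes>\<^bsub>?E\<^esub> g = compose (vcar M) f g" "f \<oplus>\<^bsub>?E\<^esub> g = (\<lambda>x\<in>vcar M. f x + g x)"
    "\<one>\<^bsub>?E\<^esub> = (\<lambda>x\<in>vcar M. x)" "\<zero>\<^bsub>?E\<^esub> = (\<lambda>x\<in>vcar M. 0)"
    "c \<odot>\<^bsub>?E\<^esub> f = (\<lambda>x\<in>vcar M. vscale M c (f x))" for f g c
    by (simp_all add: End_alg_def)
  have "abelian_group ?E"
  proof (rule abelian_groupI, unfold ops)
    fix f assume f: "f \<in> carrier ?E"
    \<comment> \<open>The negative of \<open>f\<close> is \<open>(- 1) f\<close>, so that closure under scalars suffices.\<close>
    show "\<exists>g\<in>carrier ?E. (\<lambda>x\<in>vcar M. g x + f x) = (\<lambda>x\<in>vcar M. 0)"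
      using smult_cl[OF f, of "- 1"] by (rule bexI[rotated]) (auto simp: scale_minus_one[OF M])
    show "(\<lambda>x\<in>vcar M. (\<lambda>x\<in>vcar M. 0) x + f x) = f"
      using f by (intro eqI) (auto simp: ext)
  qed (auto simp: add_cl zero_cl algebra_simps)
  moreover have "monoid ?E"
  proof (rule monoidI, unfold ops)
    fix f assume f: "f \<in> carrier ?E"
    show "compose (vcar M) (\<lambda>x\<in>vcar M. x) f = f" "compose (vcar M) f (\<lambda>x\<in>vcar M. x) = f"
      using f by (auto intro!: eqI simp: compose_def ext cl)
  next
    fix f g h assume "f \<in> carrier ?E" "g \<in> carrier ?E" "h \<in> carrier ?E"
    then show "compose (vcar M) (compose (vcar M) f g) h = compose (vcar M) f (compose (vcar M) g h)"
      by (auto simp: compose_def cl intro!: restrict_ext)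
  qed (simp_all only: mult_cl one_cl)
  ultimately have "ring ?E"
    by (rule ringI) (auto simp: ops compose_def cl fadd intro!: restrict_ext)
  then show ?thesis
    unfolding kalgebra_def kalgebra_axioms_def ops
    by (auto simp: smult_cl M scale_add_left scale_add_right scale_scale scale_one compose_def cl
        fsc ext intro!: restrict_ext eqI)
qed

subsection \<open>Monoid algebras\<close>

lemma monoid_alg_simps:
  "carrier (monoid_alg G) = {f. finite {g. f g \<noteq> 0} \<and> {g. f g \<noteq> 0} \<subseteq> carrier G}"
  "f \<oplus>\<^bsub>monoid_alg G\<^esub> h = (\<lambda>x. f x + h x)" "\<zero>\<^bsub>monoid_alg G\<^esub> = (\<lambda>x. 0)"
  "c \<odot>\<^bsub>monoid_alg G\<^esub> f = (\<lambda>x. c * f x)" "\<one>\<^bsub>monoid_alg G\<^esub> = basis_elt \<one>\<^bsub>G\<^esub>"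
  by (simp_all add: monoid_alg_def basis_elt_def)

lemma monoid_alg_mult:
  fixes f h :: "'g \<Rightarrow> 'k::field"
  assumes "finite S" "finite T" "{g. f g \<noteq> 0} \<subseteq> S" "{g. h g \<noteq> 0} \<subseteq> T"
  shows "(f \<otimes>\<^bsub>monoid_alg G\<^esub> h) x = (\<Sum>a\<in>S. \<Sum>b\<in>T. if a \<otimes>\<^bsub>G\<^esub> b = x then f a * h b else 0)"
proof -
  have "(f \<otimes>\<^bsub>monoid_alg G\<^esub> h) x =
      (\<Sum>a | f a \<noteq> 0. \<Sum>b | h b \<noteq> 0. if a \<otimes>\<^bsub>G\<^esub> b = x then f a * h b else 0)"
    by (simp add: monoid_alg_def)
  also have "\<dots> = (\<Sum>a\<in>S. \<Sum>b | h b \<noteq> 0. if a \<otimes>\<^bsub>G\<^esub> b = x then f a * h b else 0)"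
    using assms by (intro sum.mono_neutral_left) (auto intro!: sum.neutral split: if_splits)
  also have "\<dots> = (\<Sum>a\<in>S. \<Sum>b\<in>T. if a \<otimes>\<^bsub>G\<^esub> b = x then f a * h b else 0)"
    using assms by (intro sum.cong HOL.refl sum.mono_neutral_left) auto
  finally show ?thesis .
qed

lemma basis_elt_carrier [simp]: "basis_elt g \<in> carrier (monoid_alg G) \<longleftrightarrow> g \<in> carrier G"
  by (auto simp: monoid_alg_simps basis_elt_def)

lemma basis_elt_mult:
  "basis_elt g \<otimes>\<^bsub>monoid_alg G\<^esub> basis_elt h = (basis_elt (g \<otimes>\<^bsub>G\<^esub> h) :: 'g \<Rightarrow> 'k::field)"
proof
  fix x
  show "(basis_elt g \<otimes>\<^bsub>monoid_alg G\<^esub> basis_elt h) x = (basis_elt (g \<otimes>\<^bsub>G\<^esub> h) :: 'g \<Rightarrow> 'k) x"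
    by (subst monoid_alg_mult[of "{g}" "{h}"]) (auto simp: basis_elt_def)
qed

text \<open>
  Convolution is bilinear, so by this rule identities between products need to be checked on basis
  elements only.
\<close>

lemma monoid_alg_induct [consumes 1, case_names zero basis add smult]:
  fixes f :: "'g \<Rightarrow> 'k::field"
  assumes f: "f \<in> carrier (monoid_alg G)"
    and zero: "P (\<lambda>x. 0)" and basis: "\<And>g. g \<in> carrier G \<Longrightarrow> P (basis_elt g)"
    and add: "\<And>f h. f \<in> carrier (monoid_alg G) \<Longrightarrow> h \<in> carrier (monoid_alg G) \<Longrightarrow>
      P f \<Longrightarrow> P h \<Longrightarrow> P (\<lambda>x. f x + h x)"
    and smult: "\<And>c f. f \<in> carrier (monoid_alg G) \<Longrightarrow> P f \<Longrightarrow> P (\<lambda>x. c * f x)"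
  shows "P f"
proof -
  have ind: "(\<lambda>x. \<Sum>g\<in>S. c g * basis_elt g x) \<in> carrier (monoid_alg G) \<and>
      P (\<lambda>x. \<Sum>g\<in>S. c g * basis_elt g x)"
    if "finite S" "S \<subseteq> carrier G" for S and c :: "'g \<Rightarrow> 'k"
    using that
  proof (induction S rule: finite_induct)
    case empty
    then show ?case by (simp add: zero monoid_alg_simps)
  next
    case (insert g S)
    have cb: "(\<lambda>x. c g * basis_elt g x) \<in> carrier (monoid_alg G)"
      using insert by (auto simp: monoid_alg_simps basis_elt_def)
    have sub: "{x. c g * basis_elt g x + (\<Sum>g\<in>S. c g * basis_elt g x) \<noteq> 0} \<subseteq> insert g S"
      by (auto simp: basis_elt_def if_distrib[of "\<lambda>t. c _ * t"] insert cong: if_cong)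
    then have "(\<lambda>x. c g * basis_elt g x + (\<Sum>g\<in>S. c g * basis_elt g x)) \<in> carrier (monoid_alg G)"
      using insert by (auto simp: monoid_alg_simps intro: finite_subset)
    moreover have "P (\<lambda>x. c g * basis_elt g x + (\<Sum>g\<in>S. c g * basis_elt g x))"
      using insert by (intro add cb smult basis) auto
    ultimately show ?case using insert by simp
  qed
  have "f = (\<lambda>x. \<Sum>g | f g \<noteq> 0. f g * basis_elt g x)"
  proof
    fix x show "f x = (\<Sum>g | f g \<noteq> 0. f g * basis_elt g x)"
      using f by (cases "f x = 0")
        (auto simp: monoid_alg_simps basis_elt_def if_distrib[of "\<lambda>t. f _ * t"] cong: if_cong)
  qed
  then show ?thesis using ind[of "{g. f g \<noteq> 0}" f] f by (simp add: monoid_alg_simps)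
qed

lemma kalgebra_monoid_alg:
  fixes G :: "('g, 'z) monoid_scheme"
  assumes "monoid G"
  shows "kalgebra (monoid_alg G :: ('k::field, 'g \<Rightarrow> 'k) module)" (is "kalgebra ?A")
proof -
  interpret G: monoid G by fact
  let ?mult = "\<lambda>f h. f \<otimes>\<^bsub>?A\<^esub> h"
  have fin: "finite {g. f g \<noteq> 0}" if "f \<in> carrier ?A" for f using that by (simp add: monoid_alg_simps)
  have add_cl: "(\<lambda>x. f x + h x) \<in> carrier ?A" if "f \<in> carrier ?A" "h \<in> carrier ?A" for f h :: "'g \<Rightarrow> 'k"
  proof -
    have "{g. f g + h g \<noteq> 0} \<subseteq> {g. f g \<noteq> 0} \<union> {g. h g \<noteq> 0}" by auto
    then show ?thesis using that by (auto simp: monoid_alg_simps intro: finite_subset)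
  qed
  have sm_cl: "(\<lambda>x. c * f x) \<in> carrier ?A" if "f \<in> carrier ?A" for f :: "'g \<Rightarrow> 'k" and c
    using that by (auto simp: monoid_alg_simps)
  have add_left: "?mult (\<lambda>x. f x + h x) k = (\<lambda>x. ?mult f k x + ?mult h k x)"
    and add_right: "?mult k (\<lambda>x. f x + h x) = (\<lambda>x. ?mult k f x + ?mult k h x)"
    if "f \<in> carrier ?A" "h \<in> carrier ?A" "k \<in> carrier ?A" for f h k
  proof -
    let ?S = "{g. f g \<noteq> 0} \<union> {g. h g \<noteq> 0}" and ?T = "{g. k g \<noteq> 0}"
    have F: "finite ?S" "finite ?T" using that fin by auto
    note left = monoid_alg_mult[OF F] and right = monoid_alg_mult[OF F(2,1)]
    show "?mult (\<lambda>x. f x + h x) k = (\<lambda>x. ?mult f k x + ?mult h k x)"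
    proof
      fix x
      have "?mult f k x = (\<Sum>a\<in>?S. \<Sum>b\<in>?T. if a \<otimes>\<^bsub>G\<^esub> b = x then f a * k b else 0)"
        "?mult h k x = (\<Sum>a\<in>?S. \<Sum>b\<in>?T. if a \<otimes>\<^bsub>G\<^esub> b = x then h a * k b else 0)"
        "?mult (\<lambda>x. f x + h x) k x =
          (\<Sum>a\<in>?S. \<Sum>b\<in>?T. if a \<otimes>\<^bsub>G\<^esub> b = x then (f a + h a) * k b else 0)"
        by (rule left; auto)+
      then show "?mult (\<lambda>x. f x + h x) k x = ?mult f k x + ?mult h k x"
        by (simp only: sum.distrib[symmetric]) (auto intro!: sum.cong simp: algebra_simps)
    qed
    show "?mult k (\<lambda>x. f x + h x) = (\<lambda>x. ?mult k f x + ?mult k h x)"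
    proof
      fix x
      have "?mult k f x = (\<Sum>a\<in>?T. \<Sum>b\<in>?S. if a \<otimes>\<^bsub>G\<^esub> b = x then k a * f b else 0)"
        "?mult k h x = (\<Sum>a\<in>?T. \<Sum>b\<in>?S. if a \<otimes>\<^bsub>G\<^esub> b = x then k a * h b else 0)"
        "?mult k (\<lambda>x. f x + h x) x =
          (\<Sum>a\<in>?T. \<Sum>b\<in>?S. if a \<otimes>\<^bsub>G\<^esub> b = x then k a * (f b + h b) else 0)"
        by (rule right; auto)+
      then show "?mult k (\<lambda>x. f x + h x) x = ?mult k f x + ?mult k h x"
        by (simp only: sum.distrib[symmetric]) (auto intro!: sum.cong simp: algebra_simps)
    qed
  qed
  have sm_left: "?mult (\<lambda>x. c * f x) k = (\<lambda>x. c * ?mult f k x)"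
    and sm_right: "?mult k (\<lambda>x. c * f x) = (\<lambda>x. c * ?mult k f x)"
    if "f \<in> carrier ?A" "k \<in> carrier ?A" for f k c
  proof -
    let ?S = "{g. f g \<noteq> 0}" and ?T = "{g. k g \<noteq> 0}"
    have F: "finite ?S" "finite ?T" using that fin by auto
    note left = monoid_alg_mult[OF F] and right = monoid_alg_mult[OF F(2,1)]
    show "?mult (\<lambda>x. c * f x) k = (\<lambda>x. c * ?mult f k x)"
    proof
      fix x
      have "?mult f k x = (\<Sum>a\<in>?S. \<Sum>b\<in>?T. if a \<otimes>\<^bsub>G\<^esub> b = x then f a * k b else 0)"
        "?mult (\<lambda>x. c * f x) k x = (\<Sum>a\<in>?S. \<Sum>b\<in>?T. if a \<otimes>\<^bsub>G\<^esub> b = x then c * f a * k b else 0)"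
        by (rule left; auto)+
      then show "?mult (\<lambda>x. c * f x) k x = c * ?mult f k x"
        by (simp only: sum_distrib_left) (auto intro!: sum.cong simp: algebra_simps)
    qed
    show "?mult k (\<lambda>x. c * f x) = (\<lambda>x. c * ?mult k f x)"
    proof
      fix x
      have "?mult k f x = (\<Sum>a\<in>?T. \<Sum>b\<in>?S. if a \<otimes>\<^bsub>G\<^esub> b = x then k a * f b else 0)"
        "?mult k (\<lambda>x. c * f x) x = (\<Sum>a\<in>?T. \<Sum>b\<in>?S. if a \<otimes>\<^bsub>G\<^esub> b = x then k a * (c * f b) else 0)"
        by (rule right; auto)+
      then show "?mult k (\<lambda>x. c * f x) x = c * ?mult k f x"
        by (simp only: sum_distrib_left) (auto intro!: sum.cong simp: algebra_simps)
    qed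
  qed
  have z_left: "?mult (\<lambda>x. 0) k = (\<lambda>x. 0)" and z_right: "?mult k (\<lambda>x. 0) = (\<lambda>x. 0)" for k
    by (auto simp: monoid_alg_def)
  have zero_cl: "(\<lambda>x. 0) \<in> carrier ?A" by (simp add: monoid_alg_simps)
  have mult_cl: "?mult f h \<in> carrier ?A" if f: "f \<in> carrier ?A" and h: "h \<in> carrier ?A" for f h
    using f
  proof (induction f rule: monoid_alg_induct)
    case (basis g)
    from h show ?case
    proof (induction h rule: monoid_alg_induct)
      case (add f h)
      then show ?case using basis by (subst add_right) (auto intro: add_cl)
    next
      case (smult c f)
      then show ?case using basis by (subst sm_right) (auto intro: sm_cl)
    qed (use basis in \<open>auto simp: basis_elt_mult z_right zero_cl\<close>)
  next
    case (add f h')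
    then show ?case using h by (subst add_left) (auto intro: add_cl)
  next
    case (smult c f)
    then show ?case using h by (subst sm_left) (auto intro: sm_cl)
  qed (simp add: z_left zero_cl)
  have assoc: "?mult (?mult f h) k = ?mult f (?mult h k)"
    if f: "f \<in> carrier ?A" and h: "h \<in> carrier ?A" and k: "k \<in> carrier ?A" for f h k
    using f
  proof (induction f rule: monoid_alg_induct)
    case (basis a)
    from h show ?case
    proof (induction h rule: monoid_alg_induct)
      case (basis b)
      from k show ?case
      proof (induction k rule: monoid_alg_induct)
        case (basis c)
        then show ?case using \<open>a \<in> carrier G\<close> \<open>b \<in> carrier G\<close> by (simp add: basis_elt_mult G.m_assoc)
      qed (use \<open>a \<in> carrier G\<close> basis in \<open>simp_all add: z_right add_right sm_right mult_cl basis_elt_mult\<close>)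
    qed (use basis k in \<open>simp_all add: z_left z_right add_left add_right sm_left sm_right mult_cl\<close>)
  qed (use h k in \<open>simp_all add: z_left add_left sm_left mult_cl\<close>)
  have one_left: "?mult (basis_elt \<one>\<^bsub>G\<^esub>) f = f" and one_right: "?mult f (basis_elt \<one>\<^bsub>G\<^esub>) = f"
    if "f \<in> carrier ?A" for f
  proof -
    show "?mult (basis_elt \<one>\<^bsub>G\<^esub>) f = f" using that
      by (induction f rule: monoid_alg_induct) (simp_all add: basis_elt_mult z_right add_right sm_right)
    show "?mult f (basis_elt \<one>\<^bsub>G\<^esub>) = f" using that
      by (induction f rule: monoid_alg_induct) (simp_all add: basis_elt_mult z_left add_left sm_left)
  qed
  have "abelian_group ?A"
  proof (rule abelian_groupI)
    fix f :: "'g \<Rightarrow> 'k" assume f: "f \<in> carrier ?A"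
    show "\<exists>y\<in>carrier ?A. y \<oplus>\<^bsub>?A\<^esub> f = \<zero>\<^bsub>?A\<^esub>"
      by (rule bexI[OF _ sm_cl[OF f, of "- 1"]]) (simp add: monoid_alg_simps(2,3))
  qed (simp_all add: add_cl zero_cl monoid_alg_simps(2,3) algebra_simps)
  moreover have "monoid ?A"
    by (rule monoidI) (simp_all add: mult_cl assoc one_left one_right monoid_alg_simps(5))
  ultimately have "ring ?A"
    by (rule ringI) (simp_all add: monoid_alg_simps(2) add_left add_right)
  then show ?thesis
    unfolding kalgebra_def kalgebra_axioms_def monoid_alg_simps(2-5)
    by (simp add: sm_cl sm_left sm_right algebra_simps)
qed

lemma monoid_alg_lift:
  fixes G :: "('g, 'y) monoid_scheme" and B :: "('k::field, 'b, 'z) module_scheme"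
  assumes "monoid G" and "kalgebra B" and hom: "\<gamma> \<in> hom G B" and one: "\<gamma> \<one>\<^bsub>G\<^esub> = \<one>\<^bsub>B\<^esub>"
  obtains \<phi> where "\<phi> \<in> alg_hom (monoid_alg G) B" "\<And>g. g \<in> carrier G \<Longrightarrow> \<phi> (basis_elt g) = \<gamma> g"
proof -
  interpret G: monoid G by fact
  interpret B: kalgebra B by fact
  interpret A: kalgebra "monoid_alg G :: ('k, 'g \<Rightarrow> 'k) module" by (rule kalgebra_monoid_alg) fact
  let ?A = "monoid_alg G :: ('k, 'g \<Rightarrow> 'k) module"
  have \<gamma>: "\<gamma> g \<in> carrier B" if "g \<in> carrier G" for g using hom that by (auto simp: hom_def)
  define ext where "ext f = (\<Oplus>\<^bsub>B\<^esub>g\<in>{g. f g \<noteq> 0}. f g \<odot>\<^bsub>B\<^esub> \<gamma> g)" for f :: "'g \<Rightarrow> 'k"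
  have ext: "ext f = (\<Oplus>\<^bsub>B\<^esub>g\<in>S. f g \<odot>\<^bsub>B\<^esub> \<gamma> g)"
    if "finite S" "S \<subseteq> carrier G" "{g. f g \<noteq> 0} \<subseteq> S" for f S
    unfolding ext_def using that \<gamma> by (intro B.add.finprod_mono_neutral_cong_left) auto
  have supp: "finite {g. f g \<noteq> 0}" "{g. f g \<noteq> 0} \<subseteq> carrier G" if "f \<in> carrier ?A" for f
    using that by (auto simp: monoid_alg_simps)
  have cl: "ext f \<in> carrier B" if "f \<in> carrier ?A" for f
    unfolding ext_def using supp(2)[OF that] \<gamma> by (intro B.finsum_closed) auto
  have ext_add: "ext (\<lambda>x. f x + h x) = ext f \<oplus>\<^bsub>B\<^esub> ext h"
    if f: "f \<in> carrier ?A" and h: "h \<in> carrier ?A" for f h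
  proof -
    define S where "S = {g. f g \<noteq> 0} \<union> {g. h g \<noteq> 0}"
    have S: "finite S" "S \<subseteq> carrier G" using supp[OF f] supp[OF h] by (auto simp: S_def)
    then have "ext (\<lambda>x. f x + h x) = (\<Oplus>\<^bsub>B\<^esub>g\<in>S. f g \<odot>\<^bsub>B\<^esub> \<gamma> g \<oplus>\<^bsub>B\<^esub> h g \<odot>\<^bsub>B\<^esub> \<gamma> g)"
      using \<gamma> by (subst ext[of S]) (auto simp: S_def intro!: B.finsum_cong' B.smult_add_left)
    also have "\<dots> = (\<Oplus>\<^bsub>B\<^esub>g\<in>S. f g \<odot>\<^bsub>B\<^esub> \<gamma> g) \<oplus>\<^bsub>B\<^esub> (\<Oplus>\<^bsub>B\<^esub>g\<in>S. h g \<odot>\<^bsub>B\<^esub> \<gamma> g)"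
      using S \<gamma> by (intro B.finsum_addf) auto
    also have "\<dots> = ext f \<oplus>\<^bsub>B\<^esub> ext h"
      using S by (subst (1 2) ext[of S]) (auto simp: S_def)
    finally show ?thesis .
  qed
  have ext_smult: "ext (\<lambda>x. c * f x) = c \<odot>\<^bsub>B\<^esub> ext f" if f: "f \<in> carrier ?A" for c f
  proof -
    define S where "S = {g. f g \<noteq> 0}"
    have S: "finite S" "S \<subseteq> carrier G" using supp[OF f] by (auto simp: S_def)
    then have "ext (\<lambda>x. c * f x) = (\<Oplus>\<^bsub>B\<^esub>g\<in>S. c \<odot>\<^bsub>B\<^esub> (f g \<odot>\<^bsub>B\<^esub> \<gamma> g))"
      using \<gamma> by (subst ext[of S]) (auto simp: S_def B.smult_smult intro!: B.finsum_cong')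
    also have "\<dots> = c \<odot>\<^bsub>B\<^esub> ext f"
      using S \<gamma> by (subst B.smult_finsum[symmetric]) (auto simp: ext_def S_def)
    finally show ?thesis .
  qed
  have ext_zero: "ext (\<lambda>x. 0) = \<zero>\<^bsub>B\<^esub>" by (simp add: ext_def)
  have ext_basis: "ext (basis_elt g) = \<gamma> g" if "g \<in> carrier G" for g
  proof -
    have "ext (basis_elt g) = (\<Oplus>\<^bsub>B\<^esub>h\<in>{g}. (basis_elt g h :: 'k) \<odot>\<^bsub>B\<^esub> \<gamma> h)"
      by (rule ext) (use that in \<open>auto simp: basis_elt_def split: if_splits\<close>)
    then show ?thesis using \<gamma>[OF that] by (simp add: basis_elt_def)
  qed
  have ext_mult: "ext (f \<otimes>\<^bsub>?A\<^esub> h) = ext f \<otimes>\<^bsub>B\<^esub> ext h"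
    if f: "f \<in> carrier ?A" and h: "h \<in> carrier ?A" for f h
    using f
  proof (induction f rule: monoid_alg_induct)
    case zero
    show ?case using h A.l_null[of h] by (simp add: monoid_alg_simps(3) ext_zero cl)
  next
    case (basis a)
    then have aG: "a \<in> carrier G" and a: "basis_elt a \<in> carrier ?A" by auto
    from h show ?case
    proof (induction h rule: monoid_alg_induct)
      case zero
      show ?case using aG A.r_null[OF a] by (simp add: monoid_alg_simps(3) ext_zero cl)
    next
      case (basis b)
      then show ?case using \<open>a \<in> carrier G\<close> hom by (simp add: basis_elt_mult ext_basis hom_def)
    next
      case (add f h)
      then show ?case
        using A.r_distr[OF add(1,2) a] by (simp add: monoid_alg_simps(2) ext_add cl aG B.r_distr)
    next
      case (smult c f)
      then show ?case
        using A.smult_mult_right[OF a smult(1)]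
        by (simp add: monoid_alg_simps(4) ext_smult cl aG B.smult_mult_right)
    qed
  next
    case (add f h')
    then show ?case
      using A.l_distr[OF add(1,2) h] by (simp add: monoid_alg_simps(2) ext_add cl h B.l_distr)
  next
    case (smult c f)
    then show ?case
      using A.smult_mult_left[OF smult(1) h]
      by (simp add: monoid_alg_simps(4) ext_smult cl h B.smult_mult_left)
  qed
  show thesis
  proof (rule that)
    show "restrict ext (carrier ?A) \<in> alg_hom ?A B"
    proof (rule alg_homI)
      show "restrict ext (carrier ?A) (f \<oplus>\<^bsub>?A\<^esub> h) =
          restrict ext (carrier ?A) f \<oplus>\<^bsub>B\<^esub> restrict ext (carrier ?A) h"
        if "f \<in> carrier ?A" "h \<in> carrier ?A" for f h
        using that A.a_closed[OF that] by (simp add: monoid_alg_simps(2) ext_add)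
      show "restrict ext (carrier ?A) (c \<odot>\<^bsub>?A\<^esub> f) = c \<odot>\<^bsub>B\<^esub> restrict ext (carrier ?A) f"
        if "f \<in> carrier ?A" for c f
        using that A.smult_closed[OF that, of c] by (simp add: monoid_alg_simps(4) ext_smult)
      show "restrict ext (carrier ?A) \<one>\<^bsub>?A\<^esub> = \<one>\<^bsub>B\<^esub>"
        by (simp add: monoid_alg_simps(5) ext_basis one)
    qed (auto simp: cl ext_mult)
    show "restrict ext (carrier ?A) (basis_elt g) = \<gamma> g" if "g \<in> carrier G" for g
      using that by (simp add: ext_basis)
  qed
qed

lemma alg_hom_zero:
  assumes "kalgebra A" "kalgebra B" "f \<in> alg_hom A B"
  shows "f \<zero>\<^bsub>A\<^esub> = \<zero>\<^bsub>B\<^esub>"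
proof -
  interpret A: kalgebra A by fact
  interpret B: kalgebra B by fact
  have "f (0 \<odot>\<^bsub>A\<^esub> \<zero>\<^bsub>A\<^esub>) = 0 \<odot>\<^bsub>B\<^esub> f \<zero>\<^bsub>A\<^esub>" by (rule alg_homD[OF assms(3)]) simp
  then show ?thesis using alg_homD(3)[OF assms(3) A.zero_closed] by simp
qed

lemma monoid_alg_hom_eqI:
  fixes f :: "('g \<Rightarrow> 'k::field) \<Rightarrow> 'b" and B :: "('k, 'b, 'z) module_scheme"
  assumes G: "monoid G" and B: "kalgebra B"
    and f: "f \<in> alg_hom (monoid_alg G) B" and h: "h \<in> alg_hom (monoid_alg G) B"
    and eq: "\<And>g. g \<in> carrier G \<Longrightarrow> f (basis_elt g) = h (basis_elt g)"
  shows "f = h"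
proof (rule extensionalityI[OF alg_homD(2)[OF f] alg_homD(2)[OF h]])
  note A = kalgebra_monoid_alg[OF G]
  fix x :: "'g \<Rightarrow> 'k" assume "x \<in> carrier (monoid_alg G)"
  then show "f x = h x"
  proof (induction x rule: monoid_alg_induct)
    case zero
    show ?case using alg_hom_zero[OF A B f] alg_hom_zero[OF A B h] by (simp add: monoid_alg_simps)
  next
    case (add u v)
    then show ?case
      using alg_homD(5)[OF f add(1,2)] alg_homD(5)[OF h add(1,2)] by (simp add: monoid_alg_simps(2))
  next
    case (smult c u)
    then show ?case
      using alg_homD(7)[OF f smult(1), of c] alg_homD(7)[OF h smult(1), of c]
      by (simp add: monoid_alg_simps(4))
  qed (rule eq)
qed

subsection \<open>Quotients\<close>

lemma quot_alg_simps:
  "carrier (quot_alg A I) = a_rcosets\<^bsub>A\<^esub> I" "\<one>\<^bsub>quot_alg A I\<^esub> = I +>\<^bsub>A\<^esub> \<one>\<^bsub>A\<^esub>"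
  by (simp_all add: quot_alg_def FactRing_def)

lemma quot_alg_carrier: "P \<in> carrier (quot_alg A I) \<longleftrightarrow> (\<exists>x\<in>carrier A. P = I +>\<^bsub>A\<^esub> x)"
  by (auto simp: quot_alg_simps A_RCOSETS_def')

text \<open>
  An ideal is stable under scalars because \<open>c x = (c 1) x\<close>; so the scalar multiplication of cosets does
  not depend on representatives.
\<close>

lemma quot_alg_proj:
  assumes "kalgebra A" "ideal I A"
  shows "(\<lambda>x\<in>carrier A. I +>\<^bsub>A\<^esub> x) \<in> alg_hom A (quot_alg A I)"
proof -
  interpret A: kalgebra A by fact
  interpret I: ideal I A by fact
  show ?thesis
  proof (rule alg_homI)
    fix x y assume x: "x \<in> carrier A" and y: "y \<in> carrier A"
    then show "(\<lambda>x\<in>carrier A. I +>\<^bsub>A\<^esub> x) (x \<otimes>\<^bsub>A\<^esub> y) =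
        (\<lambda>x\<in>carrier A. I +>\<^bsub>A\<^esub> x) x \<otimes>\<^bsub>quot_alg A I\<^esub> (\<lambda>x\<in>carrier A. I +>\<^bsub>A\<^esub> x) y"
      by (simp add: quot_alg_def FactRing_def I.rcoset_mult_add)
    show "(\<lambda>x\<in>carrier A. I +>\<^bsub>A\<^esub> x) (x \<oplus>\<^bsub>A\<^esub> y) =
        (\<lambda>x\<in>carrier A. I +>\<^bsub>A\<^esub> x) x \<oplus>\<^bsub>quot_alg A I\<^esub> (\<lambda>x\<in>carrier A. I +>\<^bsub>A\<^esub> x) y"
      using x y by (simp add: quot_alg_def FactRing_def I.a_rcos_sum)
  next
    fix c x assume x: "x \<in> carrier A"
    have "I +>\<^bsub>A\<^esub> (c \<odot>\<^bsub>A\<^esub> y) = I +>\<^bsub>A\<^esub> (c \<odot>\<^bsub>A\<^esub> x)" if y: "y \<in> I +>\<^bsub>A\<^esub> x" for y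
    proof -
      obtain i where i: "i \<in> I" "y = i \<oplus>\<^bsub>A\<^esub> x" using y by (auto simp: a_r_coset_def')
      then have iA: "i \<in> carrier A" by (simp add: I.a_Hcarr)
      have "c \<odot>\<^bsub>A\<^esub> i = (c \<odot>\<^bsub>A\<^esub> \<one>\<^bsub>A\<^esub>) \<otimes>\<^bsub>A\<^esub> i" using iA by (simp add: A.smult_mult_left)
      also have "\<dots> \<in> I" using i by (intro I.I_l_closed) auto
      finally have "c \<odot>\<^bsub>A\<^esub> i \<in> I" .
      then have "c \<odot>\<^bsub>A\<^esub> y \<in> I +>\<^bsub>A\<^esub> (c \<odot>\<^bsub>A\<^esub> x)"
        using iA i x by (auto simp: A.smult_add_right a_r_coset_def')
      then show ?thesis using x by (intro I.a_repr_independence'[symmetric]) auto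
    qed
    moreover have "x \<in> I +>\<^bsub>A\<^esub> x" by (rule I.a_rcos_self[OF x])
    ultimately have "(\<Union>y\<in>I +>\<^bsub>A\<^esub> x. I +>\<^bsub>A\<^esub> (c \<odot>\<^bsub>A\<^esub> y)) = I +>\<^bsub>A\<^esub> (c \<odot>\<^bsub>A\<^esub> x)" by blast
    then show "(\<lambda>x\<in>carrier A. I +>\<^bsub>A\<^esub> x) (c \<odot>\<^bsub>A\<^esub> x) =
        c \<odot>\<^bsub>quot_alg A I\<^esub> (\<lambda>x\<in>carrier A. I +>\<^bsub>A\<^esub> x) x"
      using x by (simp add: quot_alg_def)
  qed (auto simp: quot_alg_carrier quot_alg_simps(2))
qed

lemma quot_alg_closed:
  assumes A: "kalgebra A" and I: "ideal I A"
    and P: "P \<in> carrier (quot_alg A I)" and Q: "Q \<in> carrier (quot_alg A I)"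
  shows "P \<otimes>\<^bsub>quot_alg A I\<^esub> Q \<in> carrier (quot_alg A I)" "P \<oplus>\<^bsub>quot_alg A I\<^esub> Q \<in> carrier (quot_alg A I)"
    "c \<odot>\<^bsub>quot_alg A I\<^esub> P \<in> carrier (quot_alg A I)" "\<one>\<^bsub>quot_alg A I\<^esub> \<in> carrier (quot_alg A I)"
proof -
  interpret A: kalgebra A by fact
  define \<pi> where "\<pi> = (\<lambda>x\<in>carrier A. I +>\<^bsub>A\<^esub> x)"
  have h: "\<pi> \<in> alg_hom A (quot_alg A I)" unfolding \<pi>_def by (rule quot_alg_proj[OF A I])
  obtain x y where xy: "x \<in> carrier A" "P = \<pi> x" "y \<in> carrier A" "Q = \<pi> y"
    using P Q by (auto simp: quot_alg_carrier \<pi>_def)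
  show "P \<otimes>\<^bsub>quot_alg A I\<^esub> Q \<in> carrier (quot_alg A I)"
    using alg_homD(3)[OF h A.m_closed[OF xy(1,3)]] alg_homD(4)[OF h xy(1,3)] xy by simp
  show "P \<oplus>\<^bsub>quot_alg A I\<^esub> Q \<in> carrier (quot_alg A I)"
    using alg_homD(3)[OF h A.a_closed[OF xy(1,3)]] alg_homD(5)[OF h xy(1,3)] xy by simp
  show "c \<odot>\<^bsub>quot_alg A I\<^esub> P \<in> carrier (quot_alg A I)"
    using alg_homD(3)[OF h A.smult_closed[OF xy(1)]] alg_homD(7)[OF h xy(1)] xy by metis
  show "\<one>\<^bsub>quot_alg A I\<^esub> \<in> carrier (quot_alg A I)"
    using alg_homD(3)[OF h A.one_closed] alg_homD(6)[OF h] by simp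
qed

lemma quot_alg_lift:
  assumes A: "kalgebra A" and B: "kalgebra B" and I: "ideal I A"
    and \<phi>: "\<phi> \<in> alg_hom A B" and ker: "\<And>x. x \<in> I \<Longrightarrow> \<phi> x = \<zero>\<^bsub>B\<^esub>"
  obtains \<Psi> where "\<Psi> \<in> alg_hom (quot_alg A I) B" "\<And>x. x \<in> carrier A \<Longrightarrow> \<Psi> (I +>\<^bsub>A\<^esub> x) = \<phi> x"
proof -
  interpret A: kalgebra A by fact
  interpret B: kalgebra B by fact
  interpret I: ideal I A by fact
  define \<Psi> where "\<Psi> = (\<lambda>P\<in>carrier (quot_alg A I). \<phi> (SOME x. x \<in> P))"
  have \<Psi>: "\<Psi> (I +>\<^bsub>A\<^esub> x) = \<phi> x" if x: "x \<in> carrier A" for x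
  proof -
    have "(SOME y. y \<in> I +>\<^bsub>A\<^esub> x) \<in> I +>\<^bsub>A\<^esub> x" by (rule someI, rule I.a_rcos_self[OF x])
    then obtain i where i: "i \<in> I" "(SOME y. y \<in> I +>\<^bsub>A\<^esub> x) = i \<oplus>\<^bsub>A\<^esub> x"
      by (auto simp: a_r_coset_def')
    moreover have "\<phi> (i \<oplus>\<^bsub>A\<^esub> x) = \<phi> x"
      using i x I.a_Hcarr ker by (simp add: alg_homD[OF \<phi>])
    ultimately show ?thesis using x by (auto simp: \<Psi>_def quot_alg_carrier)
  qed
  note P = alg_homD[OF quot_alg_proj[OF A I]]
  have "\<Psi> \<in> alg_hom (quot_alg A I) B"
  proof (rule alg_homI)
    fix P Q assume "P \<in> carrier (quot_alg A I)" "Q \<in> carrier (quot_alg A I)"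
    then obtain x y where xy: "x \<in> carrier A" "y \<in> carrier A" "P = I +>\<^bsub>A\<^esub> x" "Q = I +>\<^bsub>A\<^esub> y"
      by (auto simp: quot_alg_carrier)
    have "P \<otimes>\<^bsub>quot_alg A I\<^esub> Q = I +>\<^bsub>A\<^esub> (x \<otimes>\<^bsub>A\<^esub> y)"
      "P \<oplus>\<^bsub>quot_alg A I\<^esub> Q = I +>\<^bsub>A\<^esub> (x \<oplus>\<^bsub>A\<^esub> y)"
      using P(4,5)[OF xy(1,2)] xy by simp_all
    then show "\<Psi> (P \<otimes>\<^bsub>quot_alg A I\<^esub> Q) = \<Psi> P \<otimes>\<^bsub>B\<^esub> \<Psi> Q"
      and "\<Psi> (P \<oplus>\<^bsub>quot_alg A I\<^esub> Q) = \<Psi> P \<oplus>\<^bsub>B\<^esub> \<Psi> Q"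
      using xy by (simp_all add: \<Psi> alg_homD[OF \<phi>])
  next
    fix P c assume "P \<in> carrier (quot_alg A I)"
    then obtain x where x: "x \<in> carrier A" "P = I +>\<^bsub>A\<^esub> x" by (auto simp: quot_alg_carrier)
    have "c \<odot>\<^bsub>quot_alg A I\<^esub> P = I +>\<^bsub>A\<^esub> (c \<odot>\<^bsub>A\<^esub> x)" using P(7)[OF x(1), of c] x by simp
    then show "\<Psi> (c \<odot>\<^bsub>quot_alg A I\<^esub> P) = c \<odot>\<^bsub>B\<^esub> \<Psi> P"
      using x by (simp add: \<Psi> alg_homD[OF \<phi>])
    show "\<Psi> P \<in> carrier B" using x by (simp add: \<Psi> alg_homD[OF \<phi>])
  next
    show "\<Psi> \<one>\<^bsub>quot_alg A I\<^esub> = \<one>\<^bsub>B\<^esub>" by (simp add: quot_alg_simps \<Psi> alg_homD[OF \<phi>])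
  qed (simp add: \<Psi>_def)
  then show thesis using \<Psi> by (rule that)
qed

section \<open>Presented algebras\<close>

lemma monoid_free_monoid: "monoid (free_monoid X)"
  by (rule monoidI) (auto simp: free_monoid_def)

lemma free_monoid_simps:
  "carrier (free_monoid X) = lists X" "u \<otimes>\<^bsub>free_monoid X\<^esub> v = u @ v" "\<one>\<^bsub>free_monoid X\<^esub> = []"
  by (simp_all add: free_monoid_def)

abbreviation free_alg :: "'g set \<Rightarrow> ('k::field, 'g list \<Rightarrow> 'k) module" where
  "free_alg X \<equiv> monoid_alg (free_monoid X)"

lemma kalgebra_free_alg: "kalgebra (free_alg X)"
  by (rule kalgebra_monoid_alg[OF monoid_free_monoid])

lemma ideal_pres_ideal:
  assumes "R \<subseteq> lists X \<times> lists X"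
  shows "ideal (pres_ideal X R :: ('g list \<Rightarrow> 'k::field) set) (free_alg X)"
    and "(u, v) \<in> R \<Longrightarrow> (\<lambda>w. basis_elt u w - basis_elt v w :: 'k) \<in> pres_ideal X R"
    and "ideal J (free_alg X) \<Longrightarrow> (\<And>u v. (u, v) \<in> R \<Longrightarrow> (\<lambda>w. basis_elt u w - basis_elt v w :: 'k) \<in> J) \<Longrightarrow>
      pres_ideal X R \<subseteq> J"
proof -
  interpret A: kalgebra "free_alg X :: ('k, 'g list \<Rightarrow> 'k) module" by (rule kalgebra_free_alg)
  have S: "{(\<lambda>w. basis_elt u w - basis_elt v w :: 'k) |u v. (u, v) \<in> R} \<subseteq> carrier (free_alg X)"
    using assms by (auto simp: monoid_alg_simps free_monoid_simps basis_elt_def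
        intro: finite_subset[of _ "{_, _}"] split: if_splits)
  show "ideal (pres_ideal X R :: ('g list \<Rightarrow> 'k) set) (free_alg X)"
    unfolding pres_ideal_def by (rule A.genideal_ideal[OF S])
  show "(\<lambda>w. basis_elt u w - basis_elt v w :: 'k) \<in> pres_ideal X R" if "(u, v) \<in> R"
    unfolding pres_ideal_def using A.genideal_self[OF S] that by blast
  show "pres_ideal X R \<subseteq> J" if "ideal J (free_alg X)"
    "\<And>u v. (u, v) \<in> R \<Longrightarrow> (\<lambda>w. basis_elt u w - basis_elt v w :: 'k) \<in> J"
    unfolding pres_ideal_def by (rule A.genideal_minimal) (use that in auto)
qed

definition word_prod :: "('b, 'z) monoid_scheme \<Rightarrow> ('g \<Rightarrow> 'b) \<Rightarrow> 'g list \<Rightarrow> 'b" where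
  "word_prod B \<gamma> u = foldr (\<lambda>x y. \<gamma> x \<otimes>\<^bsub>B\<^esub> y) u \<one>\<^bsub>B\<^esub>"

lemma word_prod_simps [simp]:
  "word_prod B \<gamma> [] = \<one>\<^bsub>B\<^esub>" "word_prod B \<gamma> (x # u) = \<gamma> x \<otimes>\<^bsub>B\<^esub> word_prod B \<gamma> u"
  by (simp_all add: word_prod_def)

lemma (in monoid) word_prod_closed:
  "(\<And>x. x \<in> X \<Longrightarrow> \<gamma> x \<in> carrier G) \<Longrightarrow> u \<in> lists X \<Longrightarrow> word_prod G \<gamma> u \<in> carrier G"
  by (induction u) auto

lemma (in monoid) word_prod_append:
  assumes "\<And>x. x \<in> X \<Longrightarrow> \<gamma> x \<in> carrier G" "u \<in> lists X" "v \<in> lists X"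
  shows "word_prod G \<gamma> (u @ v) = word_prod G \<gamma> u \<otimes> word_prod G \<gamma> v"
  using assms(2)
  by (induction u) (auto simp: word_prod_closed[OF assms(1)] assms m_assoc)

lemma basis_elt_diff:
  assumes u: "u \<in> carrier G" and v: "v \<in> carrier G" and G: "monoid G"
  shows "(\<lambda>w. basis_elt u w - basis_elt v w) =
    basis_elt u \<ominus>\<^bsub>monoid_alg G\<^esub> (basis_elt v :: 'g \<Rightarrow> 'k::field)"
proof -
  interpret A: kalgebra "monoid_alg G :: ('k, 'g \<Rightarrow> 'k) module" by (rule kalgebra_monoid_alg[OF G])
  have "\<ominus>\<^bsub>monoid_alg G\<^esub> (basis_elt v :: 'g \<Rightarrow> 'k) = (- 1) \<odot>\<^bsub>monoid_alg G\<^esub> basis_elt v"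
    using v by (intro A.minus_equality A.smult_closed) (simp_all add: monoid_alg_simps(2-4))
  then show ?thesis by (simp add: a_minus_def monoid_alg_simps(2,4))
qed

theorem pres_alg_lift:
  fixes B :: "('k::field, 'b, 'z) module_scheme" and X :: "'g set"
  assumes B: "kalgebra B" and R: "R \<subseteq> lists X \<times> lists X"
    and \<gamma>: "\<And>x. x \<in> X \<Longrightarrow> \<gamma> x \<in> carrier B"
    and rel: "\<And>u v. (u, v) \<in> R \<Longrightarrow> word_prod B \<gamma> u = word_prod B \<gamma> v"
  obtains \<Psi> where "\<Psi> \<in> alg_hom (pres_alg X R) B" "\<And>x. x \<in> X \<Longrightarrow> \<Psi> (pres_alg_gen X R x) = \<gamma> x"
proof -
  interpret B: kalgebra B by fact
  interpret A: kalgebra "free_alg X :: ('k, 'g list \<Rightarrow> 'k) module" by (rule kalgebra_free_alg)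
  have "word_prod B \<gamma> \<in> hom (free_monoid X) B"
    using B.word_prod_closed[of X \<gamma>] B.word_prod_append[of X \<gamma>] \<gamma>
    by (auto simp: hom_def free_monoid_simps)
  then obtain \<phi> where \<phi>: "\<phi> \<in> alg_hom (free_alg X) B"
    and \<phi>_basis: "\<And>u. u \<in> lists X \<Longrightarrow> \<phi> (basis_elt u) = word_prod B \<gamma> u"
    by (rule monoid_alg_lift[OF monoid_free_monoid B]) (auto simp: free_monoid_simps)
  interpret h: ring_hom_ring "free_alg X" B \<phi>
    by (rule ring_hom_ringI2[OF A.ring_axioms B.ring_axioms alg_homD(1)[OF \<phi>]])
  have sub: "pres_ideal X R \<subseteq> a_kernel (free_alg X) B \<phi>"
  proof (rule ideal_pres_ideal(3)[OF R h.kernel_is_ideal])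
    fix u v assume uv: "(u, v) \<in> R"
    then have u: "u \<in> lists X" and v: "v \<in> lists X" using R by auto
    then have b: "basis_elt u \<in> carrier (free_alg X :: ('k, 'g list \<Rightarrow> 'k) module)"
      "basis_elt v \<in> carrier (free_alg X :: ('k, 'g list \<Rightarrow> 'k) module)"
      by (simp_all add: free_monoid_simps)
    have "\<phi> (basis_elt u \<ominus>\<^bsub>free_alg X\<^esub> basis_elt v) = word_prod B \<gamma> u \<ominus>\<^bsub>B\<^esub> word_prod B \<gamma> v"
      using b by (simp add: a_minus_def \<phi>_basis u v del: basis_elt_carrier)
    also have "\<dots> = \<zero>\<^bsub>B\<^esub>"
      using B.word_prod_closed[OF \<gamma> v] by (simp add: rel[OF uv] a_minus_def B.r_neg)
    finally show "(\<lambda>w. basis_elt u w - basis_elt v w) \<in> a_kernel (free_alg X) B \<phi>"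
      using b A.minus_closed[OF b] u v
      by (simp only: basis_elt_diff[OF _ _ monoid_free_monoid] free_monoid_simps a_kernel_def') simp
  qed
  have ker: "\<phi> x = \<zero>\<^bsub>B\<^esub>" if "x \<in> pres_ideal X R" for x
    using subsetD[OF sub that] unfolding a_kernel_def' mem_Collect_eq by (rule conjunct2)
  obtain \<Psi> where \<Psi>: "\<Psi> \<in> alg_hom (quot_alg (free_alg X) (pres_ideal X R)) B"
    "\<And>x. x \<in> carrier (free_alg X) \<Longrightarrow> \<Psi> (pres_ideal X R +>\<^bsub>free_alg X\<^esub> x) = \<phi> x"
    by (rule quot_alg_lift[OF kalgebra_free_alg B ideal_pres_ideal(1)[OF R] \<phi> ker]) (assumption, rule that)
  show thesis
  proof (rule that)
    show "\<Psi> \<in> alg_hom (pres_alg X R) B" using \<Psi>(1) by (simp add: pres_alg_def)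
    show "\<Psi> (pres_alg_gen X R x) = \<gamma> x" if "x \<in> X" for x
      using that by (simp add: pres_alg_gen_def \<Psi>(2) \<phi>_basis free_monoid_simps \<gamma>)
  qed
qed

text \<open>
  Composed with the projection from the free algebra, the two morphisms agree on letters, hence on words,
  hence on linear combinations of words.
\<close>

theorem pres_alg_hom_eqI:
  fixes B :: "('k::field, 'b, 'z) module_scheme" and X :: "'g set"
  assumes B: "kalgebra B" and R: "R \<subseteq> lists X \<times> lists X"
    and f: "f \<in> alg_hom (pres_alg X R) B" and h: "h \<in> alg_hom (pres_alg X R) B"
    and eq: "\<And>x. x \<in> X \<Longrightarrow> f (pres_alg_gen X R x) = h (pres_alg_gen X R x)"
  shows "f = h"
proof -
  let ?A = "free_alg X :: ('k, 'g list \<Rightarrow> 'k) module" and ?I = "pres_ideal X R :: ('g list \<Rightarrow> 'k) set"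
  define \<pi> where "\<pi> = (\<lambda>x\<in>carrier ?A. ?I +>\<^bsub>?A\<^esub> x)"
  have \<pi>: "\<pi> \<in> alg_hom ?A (pres_alg X R)"
    unfolding \<pi>_def pres_alg_def by (rule quot_alg_proj[OF kalgebra_free_alg ideal_pres_ideal(1)[OF R]])
  have comp: "(\<lambda>x\<in>carrier ?A. k (\<pi> x)) \<in> alg_hom ?A B" if "k \<in> alg_hom (pres_alg X R) B" for k
    by (rule alg_hom_comp[OF \<pi> that kalgebra_free_alg])
  have gen: "\<pi> (basis_elt [x]) = pres_alg_gen X R x" if "x \<in> X" for x
    using that by (simp add: \<pi>_def pres_alg_gen_def free_monoid_simps)
  have res: "(\<lambda>x\<in>carrier ?A. f (\<pi> x)) = (\<lambda>x\<in>carrier ?A. h (\<pi> x))"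
  proof (rule monoid_alg_hom_eqI[OF monoid_free_monoid B comp[OF f] comp[OF h]])
    fix u assume "u \<in> carrier (free_monoid X)"
    then have u: "u \<in> lists X" by (simp add: free_monoid_simps)
    have 1: "k (\<pi> (basis_elt [])) = \<one>\<^bsub>B\<^esub>" if "k \<in> alg_hom (pres_alg X R) B" for k
      using alg_homD(6)[OF \<pi>] alg_homD(6)[OF that] by (simp add: monoid_alg_simps free_monoid_simps)
    have 2: "k (\<pi> (basis_elt (x # u))) = k (pres_alg_gen X R x) \<otimes>\<^bsub>B\<^esub> k (\<pi> (basis_elt u))"
      if "k \<in> alg_hom (pres_alg X R) B" "x \<in> X" "u \<in> lists X" for k x u
    proof -
      have b: "(basis_elt [x] :: 'g list \<Rightarrow> 'k) \<in> carrier ?A" "(basis_elt u :: 'g list \<Rightarrow> 'k) \<in> carrier ?A"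
        using that by (auto simp: free_monoid_simps)
      have "(basis_elt (x # u) :: 'g list \<Rightarrow> 'k) = basis_elt [x] \<otimes>\<^bsub>?A\<^esub> basis_elt u"
        by (simp add: basis_elt_mult free_monoid_simps)
      then show ?thesis
        using alg_homD(4)[OF \<pi> b] alg_homD(4)[OF that(1) alg_homD(3)[OF \<pi> b(1)] alg_homD(3)[OF \<pi> b(2)]]
        by (simp add: gen[OF that(2)])
    qed
    have "f (\<pi> (basis_elt u)) = h (\<pi> (basis_elt u))"
      using u by (induction u) (auto simp: 1[OF f] 1[OF h] 2[OF f] 2[OF h] eq)
    then show "(\<lambda>x\<in>carrier ?A. f (\<pi> x)) (basis_elt u) = (\<lambda>x\<in>carrier ?A. h (\<pi> x)) (basis_elt u)"
      using u by (simp add: free_monoid_simps)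
  qed
  have fh: "f (\<pi> x) = h (\<pi> x)" if "x \<in> carrier ?A" for x
    using fun_cong[OF res, of x] that by simp
  show ?thesis
  proof (rule extensionalityI[OF alg_homD(2)[OF f] alg_homD(2)[OF h]])
    fix P assume "P \<in> carrier (pres_alg X R :: ('k, ('g list \<Rightarrow> 'k) set) module)"
    then obtain x where "x \<in> carrier ?A" "P = \<pi> x"
      by (auto simp: pres_alg_def quot_alg_carrier \<pi>_def)
    then show "f P = h P" using fh by simp
  qed
qed

lemma pres_alg_gen_closed:
  "x \<in> X \<Longrightarrow> pres_alg_gen X R x \<in> carrier (pres_alg X R :: ('k::field, ('g list \<Rightarrow> 'k) set) module)"
  unfolding pres_alg_gen_def pres_alg_def quot_alg_carrier
  by (rule bexI[of _ "basis_elt [x]"]) (simp_all add: free_monoid_simps)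

lemma pres_alg_rel_2:
  assumes R: "R \<subseteq> lists X \<times> lists X" and xy: "x \<in> X" "y \<in> X" and r: "([x, y], []) \<in> R"
  shows "pres_alg_gen X R x \<otimes>\<^bsub>pres_alg X R\<^esub> pres_alg_gen X R y =
    (\<one>\<^bsub>pres_alg X R\<^esub> :: ('g list \<Rightarrow> 'k::field) set)"
proof -
  let ?A = "free_alg X :: ('k, 'g list \<Rightarrow> 'k) module" and ?I = "pres_ideal X R :: ('g list \<Rightarrow> 'k) set"
  interpret A: kalgebra ?A by (rule kalgebra_free_alg)
  note I = ideal_pres_ideal(1)[OF R, where ?'k = 'k]
  define \<pi> where "\<pi> = (\<lambda>x\<in>carrier ?A. ?I +>\<^bsub>?A\<^esub> x)"
  have \<pi>: "\<pi> \<in> alg_hom ?A (pres_alg X R)"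
    unfolding \<pi>_def pres_alg_def by (rule quot_alg_proj[OF kalgebra_free_alg I])
  have b: "(basis_elt [z] :: 'g list \<Rightarrow> 'k) \<in> carrier ?A" if "z \<in> X" for z
    using that by (simp add: free_monoid_simps)
  have b2: "(basis_elt [x, y] :: 'g list \<Rightarrow> 'k) \<in> carrier ?A" "(basis_elt [] :: 'g list \<Rightarrow> 'k) \<in> carrier ?A"
    using xy by (auto simp: free_monoid_simps)
  have "basis_elt [x, y] \<ominus>\<^bsub>?A\<^esub> (basis_elt [] :: 'g list \<Rightarrow> 'k) \<in> ?I"
    using ideal_pres_ideal(2)[OF R r, where ?'k = 'k] xy
    by (subst (asm) basis_elt_diff[OF _ _ monoid_free_monoid]) (auto simp: free_monoid_simps)
  then have "?I +>\<^bsub>?A\<^esub> basis_elt [x, y] = ?I +>\<^bsub>?A\<^esub> basis_elt []"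
    by (rule A.coset_eqI[OF I b2])
  then have "\<pi> (basis_elt [x, y]) = \<pi> (basis_elt [])" using b2 by (simp add: \<pi>_def)
  moreover have "\<pi> (basis_elt []) = \<one>\<^bsub>pres_alg X R\<^esub>"
    using alg_homD(6)[OF \<pi>] by (simp add: monoid_alg_simps free_monoid_simps)
  moreover have "\<pi> (basis_elt [x, y]) = pres_alg_gen X R x \<otimes>\<^bsub>pres_alg X R\<^esub> pres_alg_gen X R y"
    using alg_homD(4)[OF \<pi> b[OF xy(1)] b[OF xy(2)]] b[OF xy(1)] b[OF xy(2)]
    by (simp add: basis_elt_mult free_monoid_simps \<pi>_def pres_alg_gen_def)
  ultimately show ?thesis by simp
qed

section \<open>Presented groups\<close>

locale presentation =
  fixes X :: "'g set" and R :: "('g word \<times> 'g word) set"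
  assumes rels: "R \<subseteq> lists (X \<times> UNIV) \<times> lists (X \<times> UNIV)"
begin

abbreviation "G \<equiv> pres_group X R"
abbreviation "cls \<equiv> pres_class X R"
abbreviation "words \<equiv> lists (X \<times> (UNIV :: bool set))"

lemma cls_eqI: "pres_equiv X R u v \<Longrightarrow> cls u = cls v"
  unfolding pres_class_def by (blast intro: pres_equiv.sym pres_equiv.trans)

lemma cls_in_carrier: "u \<in> words \<Longrightarrow> cls u \<in> carrier G"
  by (simp add: pres_group_def)

lemma carrier_cls: "P \<in> carrier G \<Longrightarrow> \<exists>u\<in>words. P = cls u"
  by (auto simp: pres_group_def)

lemma one_cls: "\<one>\<^bsub>G\<^esub> = cls []"
  by (simp add: pres_group_def)

lemma cls_mult:
  assumes u: "u \<in> words" and v: "v \<in> words"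
  shows "cls u \<otimes>\<^bsub>G\<^esub> cls v = cls (u @ v)"
proof -
  have "pres_equiv X R (u' @ v') w \<Longrightarrow> pres_equiv X R (u @ v) w"
    if "pres_equiv X R u u'" "pres_equiv X R v v'" for u' v' w
    using pres_equiv.cong[OF that] by (rule pres_equiv.trans)
  moreover have "pres_equiv X R u u" "pres_equiv X R v v" using u v by (auto intro: pres_equiv.refl)
  ultimately show ?thesis unfolding pres_group_def pres_class_def by auto
qed

text \<open>
  Cancels from the middle outwards.  Both cancellation rules of a letter and the inverses of its powers
  come from this.
\<close>

lemma cls_replicate_cancel:
  assumes "x \<in> X"
  shows "cls (replicate a (x, b) @ replicate a (x, \<not> b)) = cls []"
proof (rule cls_eqI, induction a)
  case 0
  then show ?case by (auto intro: pres_equiv.refl)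
next
  case (Suc a)
  have "pres_equiv X R [(x, b)] [(x, b)]" "pres_equiv X R [(x, \<not> b)] [(x, \<not> b)]"
    using assms by (auto intro: pres_equiv.refl)
  from pres_equiv.cong[OF this(1) pres_equiv.cong[OF Suc this(2)]]
  have "pres_equiv X R ((x, b) # replicate a (x, b) @ replicate a (x, \<not> b) @ [(x, \<not> b)]) [(x, b), (x, \<not> b)]"
    by simp
  from pres_equiv.trans[OF this pres_equiv.cancel[OF assms]]
  show ?case by (simp add: replicate_append_same)
qed

lemma group_G: "group G"
proof (rule groupI)
  fix P Q S assume "P \<in> carrier G" "Q \<in> carrier G" "S \<in> carrier G"
  then obtain u v w where w: "u \<in> words" "v \<in> words" "w \<in> words" "P = cls u" "Q = cls v" "S = cls w"
    using carrier_cls[of P] carrier_cls[of Q] carrier_cls[of S] by blast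
  then show "P \<otimes>\<^bsub>G\<^esub> Q \<in> carrier G" by (simp add: cls_mult cls_in_carrier)
  show "P \<otimes>\<^bsub>G\<^esub> Q \<otimes>\<^bsub>G\<^esub> S = P \<otimes>\<^bsub>G\<^esub> (Q \<otimes>\<^bsub>G\<^esub> S)" using w by (simp add: cls_mult)
next
  show "\<one>\<^bsub>G\<^esub> \<in> carrier G" by (simp add: one_cls cls_in_carrier)
next
  fix P assume "P \<in> carrier G"
  then obtain u where u: "u \<in> words" "P = cls u" using carrier_cls by blast
  show "\<one>\<^bsub>G\<^esub> \<otimes>\<^bsub>G\<^esub> P = P" using u by (simp add: one_cls cls_mult)
  have "\<exists>v\<in>words. cls (v @ u) = cls []"
    using u(1)
  proof (induction u)
    case (Cons l u)
    obtain x b where l: "l = (x, b)" "x \<in> X" using Cons(1) by (cases l) auto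
    obtain v where v: "v \<in> words" "cls (v @ u) = cls []" using Cons by blast
    have "cls ((v @ [(x, \<not> b)]) @ l # u) = cls v \<otimes>\<^bsub>G\<^esub> (cls [(x, \<not> b), l] \<otimes>\<^bsub>G\<^esub> cls u)"
      using v Cons l by (simp add: cls_mult)
    also have "cls [(x, \<not> b), l] = cls []"
      using cls_replicate_cancel[OF l(2), of 1 "\<not> b"] l by simp
    also have "cls v \<otimes>\<^bsub>G\<^esub> (cls [] \<otimes>\<^bsub>G\<^esub> cls u) = cls []"
      using v Cons by (simp add: cls_mult)
    finally show ?case using v l by (intro bexI[of _ "v @ [(x, \<not> b)]"]) auto
  qed (auto intro: bexI[of _ "[]"])
  then obtain v where "v \<in> words" "cls (v @ u) = cls []" by blast
  then show "\<exists>Q\<in>carrier G. Q \<otimes>\<^bsub>G\<^esub> P = \<one>\<^bsub>G\<^esub>"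
    using u by (intro bexI[of _ "cls v"] cls_in_carrier) (simp_all add: cls_mult one_cls)
qed

lemma cls_pow: "x \<in> X \<Longrightarrow> cls [(x, b)] [^]\<^bsub>G\<^esub> (a :: nat) = cls (replicate a (x, b))"
proof (induction a)
  case 0
  then show ?case by (simp add: one_cls nat_pow_def)
next
  case (Suc a)
  interpret group G by (rule group_G)
  have "replicate a (x, b) \<in> words" using Suc by auto
  then show ?case using Suc by (simp add: cls_mult replicate_append_same)
qed

lemma cls_inv_pow:
  assumes "x \<in> X"
  shows "inv\<^bsub>G\<^esub> (cls [(x, True)] [^]\<^bsub>G\<^esub> (a :: nat)) = cls (replicate a (x, False))"
proof -
  interpret group G by (rule group_G)
  have w: "replicate a (x, b) \<in> words" for b using assms by auto
  show ?thesis
    unfolding cls_pow[OF assms]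
    by (rule inv_equality)
      (use cls_replicate_cancel[OF assms, of a False] in \<open>simp_all add: cls_mult w one_cls cls_in_carrier del: in_lists_conv_set\<close>)
qed

context
  fixes B :: "('k::field, 'b, 'z) module_scheme" and \<Phi> :: "('g word set \<Rightarrow> 'k) \<Rightarrow> 'b"
  assumes \<Phi>: "\<Phi> \<in> alg_hom (monoid_alg G) B"
begin

lemma hom_cls_closed: "u \<in> words \<Longrightarrow> \<Phi> (basis_elt (cls u)) \<in> carrier B"
  by (intro alg_homD(3)[OF \<Phi>]) (simp add: cls_in_carrier)

lemma hom_cls_Nil: "\<Phi> (basis_elt (cls [])) = \<one>\<^bsub>B\<^esub>"
  using alg_homD(6)[OF \<Phi>] by (simp add: monoid_alg_simps(5) one_cls)

lemma hom_cls_append: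
  assumes "u \<in> words" "v \<in> words"
  shows "\<Phi> (basis_elt (cls (u @ v))) = \<Phi> (basis_elt (cls u)) \<otimes>\<^bsub>B\<^esub> \<Phi> (basis_elt (cls v))"
  using alg_homD(4)[OF \<Phi>, of "basis_elt (cls u)" "basis_elt (cls v)"] assms
  by (simp add: basis_elt_mult cls_mult cls_in_carrier)

lemma hom_cls_cancel:
  assumes "x \<in> X"
  shows "\<Phi> (basis_elt (cls [(x, b)])) \<otimes>\<^bsub>B\<^esub> \<Phi> (basis_elt (cls [(x, \<not> b)])) = \<one>\<^bsub>B\<^esub>"
  using hom_cls_append[of "[(x, b)]" "[(x, \<not> b)]"] cls_replicate_cancel[OF assms, of 1 b] assms
  by (simp add: hom_cls_Nil)

lemma hom_cls_rel: "(u, v) \<in> R \<Longrightarrow> \<Phi> (basis_elt (cls u)) = \<Phi> (basis_elt (cls v))"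
  using cls_eqI[OF pres_equiv.rel] by metis

end

end

lemma presentation_framed: "presentation (framed_gens n) (framed_rels d n)"
proof
  have "transpose i (Suc i) j \<in> {1..n}" if "i \<in> {1..<n}" "j \<in> {1..n}" for i j
    using that by (auto simp: transpose_def)
  then show "framed_rels d n \<subseteq> lists (framed_gens n \<times> UNIV) \<times> lists (framed_gens n \<times> UNIV)"
    unfolding framed_rels_def braid_rels_def framed_gens_def by auto
qed

section \<open>Diagonal operators on the tensor powers of a direct sum\<close>

lemma tensor_lift_cong:
  "(\<And>vs. vs \<in> lists_on V n \<Longrightarrow> F vs = G vs) \<Longrightarrow> tensor_lift V n W F = tensor_lift V n W G"
  unfolding tensor_lift_def by (rule arg_cong[of _ _ The]) (auto simp: fun_eq_iff)

lemma multilinear_on_factor: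
  assumes f: "linmap V V f"
  shows "multilinear V n (tensor_power V n) (\<lambda>vs. pure_tensor V (vs[j := f (vs ! j)]))"
proof (rule multilinearI)
  fix vs assume vs: "vs \<in> lists_on V n"
  have upd: "vs[j := f (vs ! j)] \<in> lists_on V n"
  proof (cases "j < n")
    case True
    then show ?thesis using vs lists_on_nth[OF vs] by (intro lists_on_update linmap_closed[OF f])
  next
    case False
    then show ?thesis using vs by (simp add: lists_on_def list_update_beyond)
  qed
  then show "pure_tensor V (vs[j := f (vs ! j)]) \<in> vcar (tensor_power V n)"
    by (rule pure_tensor_closed)
  fix i assume i: "i < n"
  have len: "length vs = n" using vs by (simp add: lists_on_def)
  show "linmap V (tensor_power V n) (\<lambda>x. pure_tensor V (vs[i := x, j := f (vs[i := x] ! j)]))"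
  proof (cases "i = j")
    case True
    then show ?thesis
      using linmap_comp[OF f multilinear_linmap[OF multilinear_pure_tensor vs i]] i len by simp
  next
    case False
    then have "vs[i := x, j := f (vs[i := x] ! j)] = vs[j := f (vs ! j), i := x]" for x
      by (simp add: list_update_swap)
    then show ?thesis using multilinear_linmap[OF multilinear_pure_tensor upd i] by simp
  qed
qed

text \<open>
  Substitution of two consecutive tensor factors.  Writing it with list updates makes it visible how
  it depends on each single entry.
\<close>

definition plug ::
  "('k::field, 'v::ab_group_add, 'z) vspace_scheme \<Rightarrow> nat \<Rightarrow> nat \<Rightarrow> 'v list
    \<Rightarrow> ('v, 'k) tensor \<Rightarrow> ('v, 'k) tensor" where
  "plug V n j vs = tensor_lift V 2 (tensor_power V n) (\<lambda>ws. pure_tensor V (vs[j := ws ! 0, Suc j := ws ! 1]))"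

lemma multilinear_plug:
  assumes vs: "vs \<in> lists_on V n" and j: "Suc j < n"
  shows "multilinear V 2 (tensor_power V n) (\<lambda>ws. pure_tensor V (vs[j := ws ! 0, Suc j := ws ! 1]))"
proof (rule multilinear_2I)
  fix x assume "x \<in> vcar V"
  then show "linmap V (tensor_power V n) (\<lambda>y. pure_tensor V (vs[j := x, Suc j := y]))"
    using vs j by (intro multilinear_linmap[OF multilinear_pure_tensor] lists_on_update)
next
  fix y assume "y \<in> vcar V"
  then have "linmap V (tensor_power V n) (\<lambda>x. pure_tensor V (vs[Suc j := y, j := x]))"
    using vs j by (intro multilinear_linmap[OF multilinear_pure_tensor] lists_on_update) auto
  then show "linmap V (tensor_power V n) (\<lambda>x. pure_tensor V (vs[j := x, Suc j := y]))"
    by (simp add: list_update_swap)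
qed

lemma linmap_plug:
  "vs \<in> lists_on V n \<Longrightarrow> Suc j < n \<Longrightarrow> linmap (tensor_power V 2) (tensor_power V n) (plug V n j vs)"
  unfolding plug_def by (intro linmap_tensor_lift is_vspace_tensor_power multilinear_plug)

lemma plug_pure:
  assumes "vs \<in> lists_on V n" "Suc j < n" "x \<in> vcar V" "y \<in> vcar V"
  shows "plug V n j vs (pure_tensor V [x, y]) = pure_tensor V (vs[j := x, Suc j := y])"
  unfolding plug_def
  using tensor_lift(2)[OF is_vspace_tensor_power multilinear_plug[OF assms(1,2)], of "[x, y]"] assms
  by (simp add: lists_on_2)

lemma on_factors_eq:
  assumes "i \<in> {1..<n}"
  shows "on_factors V n g i = tensor_lift V n (tensor_power V n)
    (\<lambda>vs. plug V n (i - 1) vs (g (pure_tensor V [vs ! (i - 1), vs ! i])))"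
  unfolding on_factors_def
proof (rule tensor_lift_cong)
  fix vs assume "vs \<in> lists_on V n"
  then have len: "length vs = n" by (simp add: lists_on_def)
  have "take (i - 1) vs @ ws @ drop (i + 1) vs = vs[i - 1 := ws ! 0, Suc (i - 1) := ws ! 1]"
    if "ws \<in> lists_on V 2" for ws
  proof -
    obtain x y where ws: "ws = [x, y]" using \<open>ws \<in> lists_on V 2\<close> by (auto simp: lists_on_2)
    show ?thesis
      using assms len unfolding ws
      by (intro nth_equalityI) (auto simp: nth_append nth_list_update nth_Cons' min_def)
  qed
  then show "tensor_lift V 2 (tensor_power V n) (\<lambda>ws. pure_tensor V (take (i - 1) vs @ ws @ drop (i + 1) vs))
      (g (pure_tensor V [vs ! (i - 1), vs ! i])) =
    plug V n (i - 1) vs (g (pure_tensor V [vs ! (i - 1), vs ! i]))"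
    unfolding plug_def by (intro fun_cong[OF tensor_lift_cong]) (simp only: )
qed

text \<open>
  An entry of the list enters either through one of the two arguments of \<open>g\<close>, or as one of the factors
  left in place; an update of the two entries that are overwritten anyway does not affect \<open>plug\<close>.
\<close>

lemma multilinear_on_factors:
  assumes V: "is_vspace V" and i: "i \<in> {1..<n}"
    and g: "linmap (tensor_power V 2) (tensor_power V 2) g"
  shows "multilinear V n (tensor_power V n)
    (\<lambda>vs. plug V n (i - 1) vs (g (pure_tensor V [vs ! (i - 1), vs ! i])))"
proof -
  define j where "j = i - 1"
  have j: "Suc j = i" "Suc j < n" using i by (auto simp: j_def)
  have pair: "g (pure_tensor V [x, y]) \<in> vcar (tensor_power V 2)" if "x \<in> vcar V" "y \<in> vcar V" for x y
    using that by (intro linmap_closed[OF g] pure_tensor_closed) (auto simp: lists_on_2)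
  have "multilinear V n (tensor_power V n)
    (\<lambda>vs. plug V n j vs (g (pure_tensor V [vs ! j, vs ! Suc j])))"
  proof (rule multilinearI)
    fix vs assume vs: "vs \<in> lists_on V n"
    then have e: "vs ! j \<in> vcar V" "vs ! Suc j \<in> vcar V" and len: "length vs = n"
      using j by (auto intro: lists_on_nth simp: lists_on_def)
    show "plug V n j vs (g (pure_tensor V [vs ! j, vs ! Suc j])) \<in> vcar (tensor_power V n)"
      by (intro linmap_closed[OF linmap_plug] vs j pair e)
    fix k assume k: "k < n"
    consider "k = j" | "k = Suc j" | "k \<noteq> j" "k \<noteq> Suc j" by blast
    then show "linmap V (tensor_power V n)
      (\<lambda>x. plug V n j (vs[k := x]) (g (pure_tensor V [vs[k := x] ! j, vs[k := x] ! Suc j])))"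
    proof cases
      case 1
      then have "plug V n j (vs[k := x]) = plug V n j vs" for x by (simp add: plug_def)
      then show ?thesis
        using 1 j len linmap_comp[OF linmap_comp[OF linmap_pure_tensor_2(2)[OF e(2)] g] linmap_plug[OF vs j(2)]]
        by simp
    next
      case 2
      then have "plug V n j (vs[k := x]) = plug V n j vs" for x
        by (simp add: plug_def list_update_swap[of j "Suc j"])
      then show ?thesis
        using 2 j len linmap_comp[OF linmap_comp[OF linmap_pure_tensor_2(1)[OF e(1)] g] linmap_plug[OF vs j(2)]]
        by simp
    next
      case 3
      have "linmap V (tensor_power V n) (\<lambda>x. plug V n j (vs[k := x]) (g (pure_tensor V [vs ! j, vs ! Suc j])))"
        unfolding plug_def
      proof (rule linmap_tensor_lift_parameter[OF is_vspace_tensor_power V _ _ pair[OF e]])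
        show "multilinear V 2 (tensor_power V n)
          (\<lambda>ws. pure_tensor V (vs[k := x, j := ws ! 0, Suc j := ws ! 1]))" if "x \<in> vcar V" for x
          using that vs j by (intro multilinear_plug lists_on_update)
        fix ws assume "ws \<in> lists_on V 2"
        then have "linmap V (tensor_power V n) (\<lambda>x. pure_tensor V (vs[j := ws ! 0, Suc j := ws ! 1, k := x]))"
          using vs k by (intro multilinear_linmap[OF multilinear_pure_tensor] lists_on_update)
            (auto simp: lists_on_2)
        moreover have "vs[j := ws ! 0, Suc j := ws ! 1, k := x] = vs[k := x, j := ws ! 0, Suc j := ws ! 1]" for x
          using 3 by (simp add: list_update_swap[of k])
        ultimately show "linmap V (tensor_power V n) (\<lambda>x. pure_tensor V (vs[k := x, j := ws ! 0, Suc j := ws ! 1]))"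
          by simp
      qed
      then show ?thesis using 3 by simp
    qed
  qed
  then show ?thesis using j by (simp add: j_def)
qed

lemma linmap_on_factors:
  assumes "is_vspace V" "i \<in> {1..<n}" "linmap (tensor_power V 2) (tensor_power V 2) g"
  shows "linmap (tensor_power V n) (tensor_power V n) (on_factors V n g i)"
    and "vs \<in> lists_on V n \<Longrightarrow> on_factors V n g i (pure_tensor V vs) =
      plug V n (i - 1) vs (g (pure_tensor V [vs ! (i - 1), vs ! i]))"
  unfolding on_factors_eq[OF assms(2)]
  by (rule linmap_tensor_lift[OF is_vspace_tensor_power multilinear_on_factors[OF assms]],
      rule tensor_lift(2)[OF is_vspace_tensor_power multilinear_on_factors[OF assms]])

definition swap_at :: "nat \<Rightarrow> 'a list \<Rightarrow> 'a list" where
  "swap_at i b = b[i - 1 := b ! i, i := b ! (i - 1)]"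

lemma length_swap_at [simp]: "length (swap_at i b) = length b"
  by (simp add: swap_at_def)

lemma swap_at_nth:
  "i \<in> {1..<length b} \<Longrightarrow> j < length b \<Longrightarrow>
    swap_at i b ! j = (if j = i then b ! (i - 1) else if j = i - 1 then b ! i else b ! j)"
  by (auto simp: swap_at_def nth_list_update)

lemma swap_at_swap_at: "i \<in> {1..<length b} \<Longrightarrow> swap_at i (swap_at i b) = b"
  by (rule nth_equalityI) (auto simp: swap_at_nth)

lemma sum_fun_apply: "sum f I c = (\<Sum>i\<in>I. f i c)"
  by (induction I rule: infinite_finite_induct) auto

locale direct_sum_power =
  fixes V0 :: "('k::field, 'v::ab_group_add) vspace" and d n :: nat
  assumes V0: "is_vspace V0"
begin

abbreviation V :: "('k, nat \<Rightarrow> 'v) vspace" where "V \<equiv> sum_space d V0"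
abbreviation W :: "('k, (nat \<Rightarrow> 'v, 'k) tensor) vspace" where "W \<equiv> tensor_power V n"

lemmas vspace_V = is_vspace_sum_space[OF V0, of d]
lemmas vspace_W = is_vspace_tensor_power[of V n]

definition degs :: "nat list set" where
  "degs = {b. length b = n \<and> set b \<subseteq> {1..d}}"

definition component :: "nat \<Rightarrow> (nat \<Rightarrow> 'v) \<Rightarrow> (nat \<Rightarrow> 'v)" where
  "component b v = sum_inj b (v b)"

lemma linmap_sum_inj: "b \<in> {1..d} \<Longrightarrow> linmap V0 V (sum_inj b)"
  by (auto simp: linmap_def sum_space_simps sum_inj_def fun_eq_iff vspace_zero[OF V0] scale_zero_right[OF V0])

lemma linmap_coordinate: "b \<in> {1..d} \<Longrightarrow> linmap V V0 (\<lambda>v. v b)"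
  by (auto simp: linmap_def sum_space_simps)

lemma linmap_component: "b \<in> {1..d} \<Longrightarrow> linmap V V (component b)"
  unfolding component_def[abs_def] by (rule linmap_comp[OF linmap_coordinate linmap_sum_inj])

lemma sum_components: "v \<in> vcar V \<Longrightarrow> (\<Sum>b\<in>{1..d}. component b v) = v"
proof
  fix c assume v: "v \<in> vcar V"
  have "(\<Sum>b\<in>{1..d}. component b v) c = (\<Sum>b\<in>{1..d}. if c = b then v c else 0)"
    by (simp add: sum_fun_apply component_def sum_inj_def cong: if_cong)
  then show "(\<Sum>b\<in>{1..d}. component b v) c = v c"
    using v by (auto simp: sum_space_simps)
qed

lemma finite_degs: "finite degs"
  unfolding degs_def using finite_lists_length_eq[of "{1..d}" n] by (simp add: conj_commute)

lemma components_closed: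
  assumes "vs \<in> lists_on V n" "b \<in> degs"
  shows "map2 component b vs \<in> lists_on V n"
proof -
  have "component c v \<in> vcar V" if "c \<in> {1..d}" "v \<in> vcar V" for c v
    using that by (rule linmap_closed[OF linmap_component])
  moreover have "c \<in> set b \<and> v \<in> set vs" if "(c, v) \<in> set (zip b vs)" for c v
    using that by (meson set_zip_leftD set_zip_rightD)
  ultimately have "w \<in> vcar V" if "w \<in> set (map2 component b vs)" for w
    using that assms by (auto simp: lists_on_def degs_def subset_iff)
  then show ?thesis using assms by (auto simp: lists_on_def degs_def)
qed

text \<open>
  A multilinear map is the sum of its values on the homogeneous components of its arguments.
  Applied to the pure tensor map, it decomposes tensors into homogeneous ones.
\<close>

lemma multilinear_expand:
  assumes "is_vspace U" "multilinear V m U F" "vs \<in> lists_on V m"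
  shows "F vs = (\<Sum>b | length b = m \<and> set b \<subseteq> {1..d}. F (map2 component b vs))"
  using assms(2,3)
proof (induction m arbitrary: F vs)
  case 0
  have "{b. length b = 0 \<and> set b \<subseteq> {1..d}} = {[]}" by auto
  then show ?case using 0 by simp
next
  case (Suc m)
  obtain v us where vs: "vs = v # us" "v \<in> vcar V" "us \<in> lists_on V m"
    using Suc(3) by (auto simp: lists_on_Suc)
  let ?D = "{b. length b = m \<and> set b \<subseteq> {1..d}}"
  have D: "{b. length b = Suc m \<and> set b \<subseteq> {1..d}} = (\<lambda>(c, b). c # b) ` ({1..d} \<times> ?D)"
    by (auto simp: length_Suc_conv image_iff)
  have lin: "linmap V U (\<lambda>v. F (v # us))" using Suc(2) vs by (auto simp: multilinear_Suc_iff)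
  have cl: "component c v \<in> vcar V" if "c \<in> {1..d}" for c
    using that vs by (intro linmap_closed[OF linmap_component])
  have "F vs = F ((\<Sum>c\<in>{1..d}. component c v) # us)" unfolding sum_components[OF vs(2)] vs(1) ..
  also have "\<dots> = (\<Sum>c\<in>{1..d}. F (component c v # us))"
    by (rule linmap_sum[OF vspace_V assms(1) lin cl])
  also have "\<dots> = (\<Sum>c\<in>{1..d}. \<Sum>b\<in>?D. F (component c v # map2 component b us))"
  proof (rule sum.cong[OF HOL.refl])
    fix c assume "c \<in> {1..d}"
    then have "multilinear V m U (\<lambda>us. F (component c v # us))"
      using Suc(2) cl by (auto simp: multilinear_Suc_iff)
    from Suc.IH[OF this vs(3)]
    show "F (component c v # us) = (\<Sum>b\<in>?D. F (component c v # map2 component b us))" .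
  qed
  also have "\<dots> = (\<Sum>(c, b)\<in>{1..d} \<times> ?D. F (map2 component (c # b) vs))"
    by (simp add: sum.cartesian_product vs)
  also have "\<dots> = (\<Sum>b | length b = Suc m \<and> set b \<subseteq> {1..d}. F (map2 component b vs))"
    unfolding D by (subst sum.reindex) (auto simp: inj_on_def intro!: sum.cong)
  finally show ?case .
qed

definition homog :: "nat list \<Rightarrow> (nat \<Rightarrow> 'v) list \<Rightarrow> bool" where
  "homog b vs \<longleftrightarrow> b \<in> degs \<and> vs \<in> lists_on V n \<and> (\<forall>i<n. \<exists>x\<in>vcar V0. vs ! i = sum_inj (b ! i) x)"

lemma homog_lists: "homog b vs \<Longrightarrow> vs \<in> lists_on V n"
  and homog_degs: "homog b vs \<Longrightarrow> b \<in> degs"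
  by (auto simp: homog_def)

lemma homog_nth: "homog b vs \<Longrightarrow> i < n \<Longrightarrow> \<exists>x\<in>vcar V0. vs ! i = sum_inj (b ! i) x"
  by (simp add: homog_def)

lemma degs_nth: "b \<in> degs \<Longrightarrow> i < n \<Longrightarrow> b ! i \<in> {1..d}"
  using nth_mem[of i b] by (auto simp: degs_def simp del: nth_mem)

lemma homog_components:
  assumes "vs \<in> lists_on V n" "b \<in> degs"
  shows "homog b (map2 component b vs)"
  unfolding homog_def
proof (intro conjI allI impI)
  fix i assume i: "i < n"
  have "map2 component b vs ! i = sum_inj (b ! i) ((vs ! i) (b ! i))"
    using assms i by (simp add: component_def degs_def lists_on_def)
  moreover have "(vs ! i) (b ! i) \<in> vcar V0"
    by (rule linmap_closed[OF linmap_coordinate[OF degs_nth] lists_on_nth]) (use assms i in auto)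
  ultimately show "\<exists>x\<in>vcar V0. map2 component b vs ! i = sum_inj (b ! i) x" by blast
qed (rule assms(2) components_closed[OF assms])+

lemma linmap_homog_eq:
  assumes U: "is_vspace U" and f: "linmap W U f" and g: "linmap W U g"
    and eq: "\<And>b vs. homog b vs \<Longrightarrow> f (pure_tensor V vs) = g (pure_tensor V vs)"
    and t: "t \<in> vcar W"
  shows "f t = g t"
proof (rule linmap_tensor_eq[OF U f g _ t])
  fix vs assume vs: "vs \<in> lists_on V n"
  have "h (pure_tensor V vs) = (\<Sum>b\<in>degs. h (pure_tensor V (map2 component b vs)))"
    if "linmap W U h" for h
    using multilinear_expand[OF U multilinear_compose[OF multilinear_pure_tensor that] vs]
    by (simp add: degs_def)
  note expand = this
  have "f (pure_tensor V vs) = (\<Sum>b\<in>degs. f (pure_tensor V (map2 component b vs)))"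
    by (rule expand[OF f])
  also have "\<dots> = (\<Sum>b\<in>degs. g (pure_tensor V (map2 component b vs)))"
    by (intro sum.cong HOL.refl) (rule eq[OF homog_components[OF vs]])
  also have "\<dots> = g (pure_tensor V vs)" by (rule expand[OF g, symmetric])
  finally show "f (pure_tensor V vs) = g (pure_tensor V vs)" .
qed

text \<open>
  Replacing the \<open>i\<close>-th factor by its component in \<open>V\<close> with index \<open>b ! i\<close>, for all \<open>i\<close>, projects to the
  part of degree \<open>b\<close>.  The diagonal operator is the combination of these projections with
  coefficients \<open>\<phi> b\<close>.
\<close>

definition diag :: "(nat list \<Rightarrow> 'k) \<Rightarrow> (nat \<Rightarrow> 'v, 'k) tensor \<Rightarrow> (nat \<Rightarrow> 'v, 'k) tensor" where
  "diag \<phi> = tensor_lift V n W (\<lambda>vs. \<Sum>b\<in>degs. tensor_scale (\<phi> b) (pure_tensor V (map2 component b vs)))"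

lemma multilinear_diag:
  "multilinear V n W (\<lambda>vs. \<Sum>b\<in>degs. tensor_scale (\<phi> b) (pure_tensor V (map2 component b vs)))"
proof (rule multilinear_sum[OF vspace_W])
  fix b assume b: "b \<in> degs"
  have "multilinear V n W (\<lambda>vs. pure_tensor V (map2 component b vs))"
  proof (rule multilinearI)
    fix vs assume vs: "vs \<in> lists_on V n"
    show "pure_tensor V (map2 component b vs) \<in> vcar W"
      by (rule pure_tensor_closed[OF components_closed[OF vs b]])
    fix i assume i: "i < n"
    have "map2 component b (vs[i := x]) = (map2 component b vs)[i := component (b ! i) x]" for x
      using b vs i by (intro nth_equalityI) (auto simp: degs_def lists_on_def nth_list_update)
    then show "linmap V W (\<lambda>x. pure_tensor V (map2 component b (vs[i := x])))"
      using linmap_comp[OF linmap_component[OF degs_nth[OF b i]]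
          multilinear_linmap[OF multilinear_pure_tensor components_closed[OF vs b] i]] by simp
  qed
  from multilinear_cmult[OF vspace_W this, of "\<phi> b"]
  show "multilinear V n W (\<lambda>vs. tensor_scale (\<phi> b) (pure_tensor V (map2 component b vs)))" by simp
qed

lemma linmap_diag: "linmap W W (diag \<phi>)"
  unfolding diag_def by (rule linmap_tensor_lift[OF vspace_W multilinear_diag])

lemma diag_extensional: "diag \<phi> \<in> extensional (vcar W)"
  unfolding diag_def by (rule tensor_lift_extensional[OF vspace_W multilinear_diag])

text \<open>
  In any degree \<open>c\<close> other than \<open>b\<close>, some entry has component zero.
\<close>

lemma diag_homog:
  assumes "homog b vs"
  shows "diag \<phi> (pure_tensor V vs) = tensor_scale (\<phi> b) (pure_tensor V vs)"
proof -
  note vs = homog_lists[OF assms] and b = homog_degs[OF assms]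
  have len: "length vs = n" "length b = n" using vs b by (auto simp: lists_on_def degs_def)
  have comp: "map2 component c vs ! i = (if c ! i = b ! i then vs ! i else 0)"
    if "c \<in> degs" "i < n" for c i
  proof -
    have "length c = n" using that by (simp add: degs_def)
    moreover obtain x where "vs ! i = sum_inj (b ! i) x"
      using homog_nth[OF assms \<open>i < n\<close>] by blast
    ultimately show ?thesis using that len by (auto simp: component_def sum_inj_def fun_eq_iff)
  qed
  have zero: "pure_tensor V (map2 component c vs) = 0" if c: "c \<in> degs" and cb: "c \<noteq> b" for c
  proof -
    have "length c = n" using c by (simp add: degs_def)
    then obtain i where i: "i < n" "c ! i \<noteq> b ! i"
      using cb len nth_equalityI[of c b] by auto
    then show ?thesis
      by (intro multilinear_zero[OF vspace_V vspace_W multilinear_pure_tensor components_closed[OF vs c] i(1)])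
        (use comp[OF c i(1)] in simp)
  qed
  have same: "map2 component b vs = vs"
    using comp[OF b] len by (intro nth_equalityI) auto
  have "diag \<phi> (pure_tensor V vs) = (\<Sum>c\<in>degs. tensor_scale (\<phi> c) (pure_tensor V (map2 component c vs)))"
    unfolding diag_def by (rule tensor_lift(2)[OF vspace_W multilinear_diag vs])
  also have "\<dots> = (\<Sum>c\<in>{b}. tensor_scale (\<phi> c) (pure_tensor V (map2 component c vs)))"
    using b zero by (intro sum.mono_neutral_right finite_degs)
      (auto simp: tensor_scale_def fun_eq_iff)
  finally show ?thesis by (simp add: same)
qed

lemma diag_cong:
  assumes "\<And>b. b \<in> degs \<Longrightarrow> \<phi> b = \<psi> b"
  shows "diag \<phi> = diag \<psi>"
  unfolding diag_def by (intro tensor_lift_cong sum.cong HOL.refl) (simp add: assms)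

lemma diag_closed: "t \<in> vcar W \<Longrightarrow> diag \<phi> t \<in> vcar W"
  by (rule linmap_closed[OF linmap_diag])

lemma diag_scale: "t \<in> vcar W \<Longrightarrow> diag \<phi> (tensor_scale c t) = tensor_scale c (diag \<phi> t)"
  using linmap_scale[OF linmap_diag, of t \<phi> c] by simp

lemma pure_homog_closed: "homog b vs \<Longrightarrow> pure_tensor V vs \<in> vcar W"
  by (rule pure_tensor_closed[OF homog_lists])

lemma linmap_tensor_scale: "linmap W W f \<Longrightarrow> linmap W W (\<lambda>t. tensor_scale c (f t))"
  using linmap_cmult[OF vspace_W] by simp

lemma diag_diag: "t \<in> vcar W \<Longrightarrow> diag \<phi> (diag \<psi> t) = diag (\<lambda>b. \<phi> b * \<psi> b) t"
  by (rule linmap_homog_eq[OF vspace_W linmap_comp[OF linmap_diag linmap_diag] linmap_diag])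
    (simp_all add: diag_homog diag_scale pure_homog_closed, simp add: tensor_scale_def mult_ac)

lemma diag_add: "t \<in> vcar W \<Longrightarrow> diag (\<lambda>b. \<phi> b + \<psi> b) t = diag \<phi> t + diag \<psi> t"
  by (rule linmap_homog_eq[OF vspace_W linmap_diag linmap_plus[OF vspace_W linmap_diag linmap_diag]])
    (simp_all add: diag_homog, simp add: tensor_scale_def fun_eq_iff algebra_simps)

lemma diag_smult: "t \<in> vcar W \<Longrightarrow> diag (\<lambda>b. c * \<phi> b) t = tensor_scale c (diag \<phi> t)"
  by (rule linmap_homog_eq[OF vspace_W linmap_diag linmap_tensor_scale[OF linmap_diag]])
    (simp_all add: diag_homog, simp add: tensor_scale_def fun_eq_iff algebra_simps)

lemma diag_one: "t \<in> vcar W \<Longrightarrow> diag (\<lambda>b. 1) t = t"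
  by (rule linmap_homog_eq[OF vspace_W linmap_diag linmap_id])
    (simp_all add: diag_homog, simp add: tensor_scale_def)

text \<open>
  The span of the homogeneous pure tensors of degree \<open>b\<close>, described as a simultaneous eigenspace of the
  diagonal operators: in this form membership passes through linear maps at once.
\<close>

definition part :: "nat list \<Rightarrow> (nat \<Rightarrow> 'v, 'k) tensor set" where
  "part b = {t \<in> vcar W. \<forall>\<phi>. diag \<phi> t = tensor_scale (\<phi> b) t}"

lemma homog_part: "homog b vs \<Longrightarrow> pure_tensor V vs \<in> part b"
  by (simp add: part_def diag_homog pure_homog_closed)

lemma linmap_tau: "linmap V V (tau d V0 \<zeta>)"
  by (rule linmapI)
    (auto simp: sum_space_simps tau_def fun_eq_iff vspace_scale[OF V0] scale_add_right[OF V0]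
      scale_scale[OF V0] scale_zero_right[OF V0] mult.commute)

lemma on_factor_tau:
  assumes i: "i \<in> {1..n}"
  shows "on_factor V n (tau d V0 \<zeta>) i = diag (\<lambda>b. \<zeta> ^ (b ! (i - 1) - 1))"
proof -
  define j where "j = i - 1"
  have j: "j < n" using i by (auto simp: j_def)
  define F where "F vs = pure_tensor V (vs[j := tau d V0 \<zeta> (vs ! j)])" for vs
  have ml: "multilinear V n W F" unfolding F_def by (rule multilinear_on_factor[OF linmap_tau])
  have eq: "on_factor V n (tau d V0 \<zeta>) i = tensor_lift V n W F"
    by (simp add: on_factor_def F_def[abs_def] j_def)
  show ?thesis
    unfolding eq
  proof (rule extensionalityI[OF tensor_lift_extensional[OF vspace_W ml] diag_extensional])
    fix t assume "t \<in> vcar W"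
    then show "tensor_lift V n W F t = diag (\<lambda>b. \<zeta> ^ (b ! (i - 1) - 1)) t"
    proof (rule linmap_homog_eq[OF vspace_W linmap_tensor_lift[OF vspace_W ml] linmap_diag, rotated])
      fix b vs assume h: "homog b vs"
      note vs = homog_lists[OF h] and b = homog_degs[OF h]
      obtain x where x: "vs ! j = sum_inj (b ! j) x" using homog_nth[OF h] j by blast
      have "tau d V0 \<zeta> (vs ! j) = vscale V (\<zeta> ^ (b ! j - 1)) (vs ! j)"
        using degs_nth[OF b j]
        by (auto simp: x tau_def sum_inj_def fun_eq_iff sum_space_simps scale_zero_right[OF V0])
      then have "F vs = tensor_scale (\<zeta> ^ (b ! j - 1)) (pure_tensor V (vs[j := vs ! j]))"
        using linmap_scale[OF multilinear_linmap[OF multilinear_pure_tensor vs j] lists_on_nth[OF vs j]]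
        by (simp add: F_def)
      then show "tensor_lift V n W F (pure_tensor V vs) = diag (\<lambda>b. \<zeta> ^ (b ! (i - 1) - 1)) (pure_tensor V vs)"
        by (simp add: tensor_lift(2)[OF vspace_W ml vs] diag_homog[OF h] j_def)
    qed
  qed
qed

abbreviation perm :: "(nat \<Rightarrow> nat) \<Rightarrow> (nat \<Rightarrow> 'v, 'k) tensor \<Rightarrow> (nat \<Rightarrow> 'v, 'k) tensor" where
  "perm g \<equiv> tensor_map V V n (perm_act_sum g)"

lemma linmap_perm: "g permutes {1..d} \<Longrightarrow> linmap W W (perm g)"
  by (rule linmap_tensor_map[OF linmap_perm_act_sum])

lemma perm_pure:
  "g permutes {1..d} \<Longrightarrow> vs \<in> lists_on V n \<Longrightarrow> perm g (pure_tensor V vs) = pure_tensor V (map (perm_act_sum g) vs)"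
  by (rule tensor_map_pure[OF linmap_perm_act_sum])

lemma perm_act_sum_inj:
  assumes "g permutes {1..d}"
  shows "perm_act_sum g (sum_inj b x) = sum_inj (g b) x"
  using permutes_inverses[OF assms] by (auto simp: perm_act_sum_def sum_inj_def fun_eq_iff)

lemma map_degs: "g permutes {1..d} \<Longrightarrow> b \<in> degs \<Longrightarrow> map g b \<in> degs"
  using permutes_in_image[of g "{1..d}"] by (auto simp: degs_def)

lemma homog_perm:
  assumes "g permutes {1..d}" "homog b vs"
  shows "homog (map g b) (map (perm_act_sum g) vs)"
  unfolding homog_def
proof (intro conjI allI impI)
  fix i assume i: "i < n"
  then obtain x where "x \<in> vcar V0" "vs ! i = sum_inj (b ! i) x" using homog_nth[OF assms(2)] by blast
  moreover have "length vs = n" "length b = n" using assms(2) by (auto simp: homog_def lists_on_def degs_def)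
  ultimately show "\<exists>x\<in>vcar V0. map (perm_act_sum g) vs ! i = sum_inj (map g b ! i) x"
    using i by (intro bexI[of _ x]) (simp_all add: perm_act_sum_inj[OF assms(1)])
qed (rule map_degs[OF assms(1) homog_degs[OF assms(2)]]
    lists_on_map[OF linmap_perm_act_sum[OF assms(1)] homog_lists[OF assms(2)]])+

lemma perm_perm_inv:
  assumes g: "g permutes {1..d}" and t: "t \<in> vcar W"
  shows "perm g (perm (Hilbert_Choice.inv g) t) = t"
proof (rule linmap_homog_eq[OF vspace_W linmap_comp[OF linmap_perm linmap_perm] linmap_id _ t])
  fix b vs assume h: "homog b vs"
  note gi = permutes_inv[OF g]
  have "perm_act_sum g \<circ> perm_act_sum (Hilbert_Choice.inv g) = (id :: (nat \<Rightarrow> 'v) \<Rightarrow> _)"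
    using permutes_inverses[OF g] by (auto simp: perm_act_sum_def fun_eq_iff permutes_inv_inv[OF g])
  then show "perm g (perm (Hilbert_Choice.inv g) (pure_tensor V vs)) = pure_tensor V vs"
    by (simp add: perm_pure[OF gi homog_lists[OF h]] perm_pure[OF g homog_lists[OF homog_perm[OF gi h]]])
qed (use g permutes_inv in auto)

text \<open>
  The permutation \<open>g\<close> carries the part of degree \<open>b\<close> to the part of degree \<open>map g b\<close>.
\<close>

lemma perm_diag:
  assumes g: "g permutes {1..d}" and t: "t \<in> vcar W"
  shows "perm g (diag \<phi> t) = diag (\<lambda>b. \<phi> (map (Hilbert_Choice.inv g) b)) (perm g t)"
proof (rule linmap_homog_eq[OF vspace_W linmap_comp[OF linmap_diag linmap_perm[OF g]]
      linmap_comp[OF linmap_perm[OF g] linmap_diag] _ t])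
  fix b vs assume h: "homog b vs"
  have "map (Hilbert_Choice.inv g) (map g b) = b"
    using permutes_inverses[OF g] by (simp add: map_idI)
  then show "perm g (diag \<phi> (pure_tensor V vs)) =
      diag (\<lambda>b. \<phi> (map (Hilbert_Choice.inv g) b)) (perm g (pure_tensor V vs))"
    using linmap_scale[OF linmap_perm[OF g] pure_homog_closed[OF h]]
    by (simp add: diag_homog[OF h] perm_pure[OF g homog_lists[OF h]] diag_homog[OF homog_perm[OF g h]])
qed

end

section \<open>The operators exchanging neighbouring factors\<close>

locale flip_operator = direct_sum_power V0 d n
  for V0 :: "('k::field, 'v::ab_group_add) vspace" and d n +
  fixes R :: "('v, 'k) tensor \<Rightarrow> ('v, 'k) tensor"
  assumes R: "linmap (tensor_power V0 2) (tensor_power V0 2) R"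
begin

definition sigma_term :: "nat \<Rightarrow> nat \<Rightarrow> (nat \<Rightarrow> 'v) \<Rightarrow> (nat \<Rightarrow> 'v) \<Rightarrow> (nat \<Rightarrow> 'v, 'k) tensor" where
  "sigma_term b c v w = (if b \<noteq> c then pure_tensor V [sum_inj c (w c), sum_inj b (v b)]
     else tensor_map V0 V 2 (sum_inj b) (R (pure_tensor V0 [v b, w b])))"

lemma linmap_sigma_term:
  assumes "b \<in> {1..d}" "c \<in> {1..d}"
  shows "v \<in> vcar V \<Longrightarrow> linmap V (tensor_power V 2) (sigma_term b c v)"
    and "w \<in> vcar V \<Longrightarrow> linmap V (tensor_power V 2) (\<lambda>v. sigma_term b c v w)"
proof -
  have co: "linmap V V (\<lambda>v. sum_inj b (v b))" if "b \<in> {1..d}" for b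
    using linmap_component[OF that] by (simp add: component_def[abs_def])
  have cl: "sum_inj b (v b) \<in> vcar V" "v b \<in> vcar V0" if "b \<in> {1..d}" "v \<in> vcar V" for b v
    using linmap_closed[OF co that(2)] linmap_closed[OF linmap_coordinate that(2)] that by auto
  note tm = linmap_comp[OF R linmap_tensor_map[OF linmap_sum_inj[OF assms(1)]]]
  show "linmap V (tensor_power V 2) (sigma_term b c v)" if "v \<in> vcar V"
  proof (cases "b = c")
    case True
    then show ?thesis
      unfolding sigma_term_def[abs_def]
      using linmap_comp[OF linmap_comp[OF linmap_coordinate linmap_pure_tensor_2(1)] tm] cl assms that by simp
  next
    case False
    then show ?thesis
      unfolding sigma_term_def[abs_def]
      using linmap_comp[OF co linmap_pure_tensor_2(2)] cl assms that by simp
  qed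
  show "linmap V (tensor_power V 2) (\<lambda>v. sigma_term b c v w)" if "w \<in> vcar V"
  proof (cases "b = c")
    case True
    then show ?thesis
      unfolding sigma_term_def[abs_def]
      using linmap_comp[OF linmap_comp[OF linmap_coordinate linmap_pure_tensor_2(2)] tm] cl assms that by simp
  next
    case False
    then show ?thesis
      unfolding sigma_term_def[abs_def]
      using linmap_comp[OF co linmap_pure_tensor_2(1)] cl assms that by simp
  qed
qed

lemma sigma_eq:
  "sigma d V0 R = tensor_lift V 2 (tensor_power V 2)
    (\<lambda>vs. \<Sum>b\<in>{1..d}. \<Sum>c\<in>{1..d}. sigma_term b c (vs ! 0) (vs ! 1))"
  unfolding sigma_def sigma_term_def Let_def by (rule HOL.refl)

lemma multilinear_sigma:
  "multilinear V 2 (tensor_power V 2)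
    (\<lambda>vs. \<Sum>b\<in>{1..d}. \<Sum>c\<in>{1..d}. sigma_term b c (vs ! 0) (vs ! 1))"
  by (intro multilinear_sum is_vspace_tensor_power multilinear_2I linmap_sigma_term)

lemma linmap_sigma: "linmap (tensor_power V 2) (tensor_power V 2) (sigma d V0 R)"
  unfolding sigma_eq by (rule linmap_tensor_lift[OF is_vspace_tensor_power multilinear_sigma])

text \<open>
  Of the double sum that defines the operator only the term indexed by the two degrees survives.
\<close>

lemma sigma_homog:
  assumes b: "b \<in> {1..d}" and c: "c \<in> {1..d}" and x: "x \<in> vcar V0" and y: "y \<in> vcar V0"
  shows "sigma d V0 R (pure_tensor V [sum_inj b x, sum_inj c y]) =
    (if b \<noteq> c then pure_tensor V [sum_inj c y, sum_inj b x]
     else tensor_map V0 V 2 (sum_inj b) (R (pure_tensor V0 [x, y])))"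
proof -
  have cl: "sum_inj b x \<in> vcar V" "sum_inj c y \<in> vcar V"
    using linmap_closed[OF linmap_sum_inj] assms by auto
  have zl: "sigma_term b' c' (sum_inj b x) (sum_inj c y) = 0"
    if "b' \<in> {1..d}" "c' \<in> {1..d}" "b' \<noteq> b" for b' c'
  proof -
    have "sigma_term b' c' (sum_inj b x) (sum_inj c y) = sigma_term b' c' 0 (sum_inj c y)"
      using that by (simp add: sigma_term_def sum_inj_def)
    then show ?thesis
      using linmap_zero[OF vspace_V is_vspace_tensor_power linmap_sigma_term(2)[OF that(1,2) cl(2)]] by simp
  qed
  have zr: "sigma_term b' c' (sum_inj b x) (sum_inj c y) = 0"
    if "b' \<in> {1..d}" "c' \<in> {1..d}" "c' \<noteq> c" for b' c'
  proof -
    have "sigma_term b' c' (sum_inj b x) (sum_inj c y) = sigma_term b' c' (sum_inj b x) 0"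
      using that by (simp add: sigma_term_def sum_inj_def)
    then show ?thesis
      using linmap_zero[OF vspace_V is_vspace_tensor_power linmap_sigma_term(1)[OF that(1,2) cl(1)]] by simp
  qed
  have "sigma d V0 R (pure_tensor V [sum_inj b x, sum_inj c y]) =
      (\<Sum>b'\<in>{1..d}. \<Sum>c'\<in>{1..d}. sigma_term b' c' (sum_inj b x) (sum_inj c y))"
    unfolding sigma_eq
    using tensor_lift(2)[OF is_vspace_tensor_power multilinear_sigma, of "[sum_inj b x, sum_inj c y]"] cl
    by (simp add: lists_on_2)
  also have "\<dots> = (\<Sum>b'\<in>{b}. \<Sum>c'\<in>{1..d}. sigma_term b' c' (sum_inj b x) (sum_inj c y))"
    using b zl by (intro sum.mono_neutral_right) (auto intro!: sum.neutral)
  also have "\<dots> = (\<Sum>b'\<in>{b}. \<Sum>c'\<in>{c}. sigma_term b' c' (sum_inj b x) (sum_inj c y))"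
    using b c zr by (intro sum.cong HOL.refl sum.mono_neutral_right) auto
  finally show ?thesis by (simp add: sigma_term_def sum_inj_def)
qed

definition s_op :: "nat \<Rightarrow> (nat \<Rightarrow> 'v, 'k) tensor \<Rightarrow> (nat \<Rightarrow> 'v, 'k) tensor" where
  "s_op i = on_factors V n (sigma d V0 R) i"

lemma linmap_s_op: "i \<in> {1..<n} \<Longrightarrow> linmap W W (s_op i)"
  unfolding s_op_def by (rule linmap_on_factors(1)[OF vspace_V _ linmap_sigma])

lemma homog_update:
  assumes h: "homog b vs" and j: "Suc j < n" and c: "c \<in> {1..d}" "c' \<in> {1..d}"
    and x: "x \<in> vcar V0" "y \<in> vcar V0"
  shows "homog (b[j := c, Suc j := c']) (vs[j := sum_inj c x, Suc j := sum_inj c' y])"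
proof -
  have len: "length b = n" "length vs = n" using h by (auto simp: homog_def degs_def lists_on_def)
  have "set (b[j := c, Suc j := c']) \<subseteq> {1..d}"
    using homog_degs[OF h] c set_update_subset_insert[of b j c]
      set_update_subset_insert[of "b[j := c]" "Suc j" c'] unfolding degs_def by blast
  moreover have "vs[j := sum_inj c x, Suc j := sum_inj c' y] \<in> lists_on V n"
    using c x homog_lists[OF h] by (intro lists_on_update linmap_closed[OF linmap_sum_inj])
  ultimately show ?thesis
    using h j x len by (auto simp: homog_def degs_def nth_list_update)
qed

lemma s_op_homog:
  assumes i: "i \<in> {1..<n}" and h: "homog b vs"
  obtains x y where "x \<in> vcar V0" "y \<in> vcar V0"
    "vs ! (i - 1) = sum_inj (b ! (i - 1)) x" "vs ! i = sum_inj (b ! i) y"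
    "s_op i (pure_tensor V vs) =
     (if b ! (i - 1) \<noteq> b ! i then pure_tensor V (vs[i - 1 := sum_inj (b ! i) y, i := sum_inj (b ! (i - 1)) x])
      else plug V n (i - 1) vs (tensor_map V0 V 2 (sum_inj (b ! i)) (R (pure_tensor V0 [x, y]))))"
proof -
  define j where "j = i - 1"
  have j: "Suc j = i" "Suc j < n" "j < n" using i by (auto simp: j_def)
  note vs = homog_lists[OF h]
  obtain x where x: "x \<in> vcar V0" "vs ! j = sum_inj (b ! j) x" using homog_nth[OF h] j by blast
  obtain y where y: "y \<in> vcar V0" "vs ! i = sum_inj (b ! i) y" using homog_nth[OF h, of i] i by auto
  have bj: "b ! j \<in> {1..d}" "b ! i \<in> {1..d}" using degs_nth[OF homog_degs[OF h]] j by auto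
  have "s_op i (pure_tensor V vs) = plug V n j vs (sigma d V0 R (pure_tensor V [vs ! j, vs ! i]))"
    unfolding s_op_def j_def by (rule linmap_on_factors(2)[OF vspace_V i linmap_sigma vs])
  also have "\<dots> = plug V n j vs (sigma d V0 R (pure_tensor V [sum_inj (b ! j) x, sum_inj (b ! i) y]))"
    by (simp only: x y)
  also have "\<dots> = (if b ! j \<noteq> b ! i then pure_tensor V (vs[j := sum_inj (b ! i) y, i := sum_inj (b ! j) x])
      else plug V n j vs (tensor_map V0 V 2 (sum_inj (b ! i)) (R (pure_tensor V0 [x, y]))))"
    using plug_pure[OF vs j(2) linmap_closed[OF linmap_sum_inj[OF bj(2)] y(1)] linmap_closed[OF linmap_sum_inj[OF bj(1)] x(1)]]
    by (simp add: sigma_homog[OF bj x(1) y(1)] j(1))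
  finally show thesis using that[OF x(1) y(1)] x y unfolding j_def by blast
qed

lemma linmap_plug_sum_inj:
  assumes "vs \<in> lists_on V n" "Suc j < n" "b \<in> {1..d}"
  shows "linmap (tensor_power V0 2) W (\<lambda>r. plug V n j vs (tensor_map V0 V 2 (sum_inj b) r))"
  by (rule linmap_comp[OF linmap_tensor_map[OF linmap_sum_inj[OF assms(3)]] linmap_plug[OF assms(1,2)]])

lemma plug_sum_inj_pure:
  assumes "vs \<in> lists_on V n" "Suc j < n" "b \<in> {1..d}" "x \<in> vcar V0" "y \<in> vcar V0"
  shows "plug V n j vs (tensor_map V0 V 2 (sum_inj b) (pure_tensor V0 [x, y])) =
    pure_tensor V (vs[j := sum_inj b x, Suc j := sum_inj b y])"
  using assms linmap_closed[OF linmap_sum_inj[OF assms(3)]]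
  by (simp add: tensor_map_pure[OF linmap_sum_inj] lists_on_2 plug_pure)

lemma R_pure_closed:
  "x \<in> vcar V0 \<Longrightarrow> y \<in> vcar V0 \<Longrightarrow> R (pure_tensor V0 [x, y]) \<in> vcar (tensor_power V0 2)"
  by (intro linmap_closed[OF R] pure_tensor_closed) (auto simp: lists_on_2)

text \<open>
  For different degrees at the two positions the operator is the flip.  For equal degrees the exchange of
  the entries does nothing, and \<open>R\<close> stays inside \<open>V\<^sub>b \<otimes> V\<^sub>b\<close>; since \<open>R\<close> of a pure tensor is no longer pure, the
  eigenvalue equations are checked on all tensors \<open>r\<close> of \<open>V0 \<otimes> V0\<close> by linearity.
\<close>

lemma s_op_part:
  assumes i: "i \<in> {1..<n}" and h: "homog b vs"
  shows "s_op i (pure_tensor V vs) \<in> part (swap_at i b)"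
proof -
  define j where "j = i - 1"
  have j: "Suc j = i" "Suc j < n" "j < n" using i by (auto simp: j_def)
  note vs = homog_lists[OF h]
  have bj: "b ! j \<in> {1..d}" "b ! i \<in> {1..d}" using degs_nth[OF homog_degs[OF h]] j by auto
  obtain x y where xy: "x \<in> vcar V0" "y \<in> vcar V0"
    and s: "s_op i (pure_tensor V vs) =
     (if b ! j \<noteq> b ! i then pure_tensor V (vs[j := sum_inj (b ! i) y, i := sum_inj (b ! j) x])
      else plug V n j vs (tensor_map V0 V 2 (sum_inj (b ! i)) (R (pure_tensor V0 [x, y]))))"
    using s_op_homog[OF i h] unfolding j_def by metis
  show ?thesis
  proof (cases "b ! j = b ! i")
    case False
    then show ?thesis
      using homog_part[OF homog_update[OF h j(2) bj(2,1) xy(2,1)]] j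
      by (simp add: s swap_at_def j_def)
  next
    case True
    have sw: "swap_at i b = b"
      using True i homog_degs[OF h] by (intro nth_equalityI) (auto simp: swap_at_nth degs_def j_def)
    let ?P = "\<lambda>r. plug V n j vs (tensor_map V0 V 2 (sum_inj (b ! i)) r)"
    note P = linmap_plug_sum_inj[OF vs j(2) bj(2)]
    have "diag \<phi> (?P r) = tensor_scale (\<phi> b) (?P r)" if "r \<in> vcar (tensor_power V0 2)" for r \<phi>
    proof (rule linmap_tensor_eq[OF vspace_W linmap_comp[OF P linmap_diag] _ _ that])
      show "linmap (tensor_power V0 2) W (\<lambda>r. tensor_scale (\<phi> b) (?P r))"
        using linmap_cmult[OF vspace_W P] by simp
      fix us assume "us \<in> lists_on V0 2"
      then obtain x' y' where us: "us = [x', y']" "x' \<in> vcar V0" "y' \<in> vcar V0" by (auto simp: lists_on_2)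
      have "b[j := b ! i, Suc j := b ! i] = b" using True j(1) by (metis list_update_id)
      then have "homog b (vs[j := sum_inj (b ! i) x', Suc j := sum_inj (b ! i) y'])"
        using homog_update[OF h j(2) bj(2) bj(2) us(2,3)] by simp
      then show "diag \<phi> (?P (pure_tensor V0 us)) = tensor_scale (\<phi> b) (?P (pure_tensor V0 us))"
        unfolding us(1) plug_sum_inj_pure[OF vs j(2) bj(2) us(2,3)] by (rule diag_homog)
    qed
    moreover have "?P (R (pure_tensor V0 [x, y])) \<in> vcar W"
      by (rule linmap_closed[OF P R_pure_closed[OF xy]])
    ultimately show ?thesis
      using True R_pure_closed[OF xy] by (simp add: s sw part_def)
  qed
qed

lemma s_op_diag:
  assumes i: "i \<in> {1..<n}" and t: "t \<in> vcar W"
  shows "s_op i (diag \<phi> t) = diag (\<lambda>b. \<phi> (swap_at i b)) (s_op i t)"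
proof (rule linmap_homog_eq[OF vspace_W linmap_comp[OF linmap_diag linmap_s_op[OF i]]
      linmap_comp[OF linmap_s_op[OF i] linmap_diag] _ t])
  fix b vs assume h: "homog b vs"
  have "swap_at i (swap_at i b) = b"
    using homog_degs[OF h] i by (intro swap_at_swap_at) (auto simp: degs_def)
  then show "s_op i (diag \<phi> (pure_tensor V vs)) =
      diag (\<lambda>b. \<phi> (swap_at i b)) (s_op i (pure_tensor V vs))"
    using s_op_part[OF i h] linmap_scale[OF linmap_s_op[OF i] pure_homog_closed[OF h]]
    by (simp add: diag_homog[OF h] part_def)
qed

text \<open>
  Renaming the summands by \<open>g\<close> preserves the distinction between equal and different degrees, and the
  same \<open>R\<close> acts in every summand.
\<close>

lemma s_op_perm:
  assumes g: "g permutes {1..d}" and i: "i \<in> {1..<n}" and t: "t \<in> vcar W"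
  shows "s_op i (perm g t) = perm g (s_op i t)"
proof (rule linmap_homog_eq[OF vspace_W linmap_comp[OF linmap_perm[OF g] linmap_s_op[OF i]]
      linmap_comp[OF linmap_s_op[OF i] linmap_perm[OF g]] _ t])
  fix b vs assume h: "homog b vs"
  define j where "j = i - 1"
  have j: "Suc j = i" "Suc j < n" "j < n" using i by (auto simp: j_def)
  note vs = homog_lists[OF h] and h' = homog_perm[OF g h]
  let ?g = "perm_act_sum g :: (nat \<Rightarrow> 'v) \<Rightarrow> _"
  note vs' = homog_lists[OF h']
  have len: "length b = n" "length vs = n" using h by (auto simp: homog_def degs_def lists_on_def)
  have bj: "b ! j \<in> {1..d}" "b ! i \<in> {1..d}" using degs_nth[OF homog_degs[OF h]] j by auto
  have gb: "g (b ! i) \<in> {1..d}" using bj permutes_in_image[OF g] by blast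
  have inj_g: "g p = g q \<longleftrightarrow> p = q" for p q using permutes_inj[OF g] by (simp add: inj_eq)
  obtain x y where xy: "x \<in> vcar V0" "y \<in> vcar V0"
    and vx: "vs ! j = sum_inj (b ! j) x" and vy: "vs ! i = sum_inj (b ! i) y"
    and s: "s_op i (pure_tensor V vs) =
     (if b ! j \<noteq> b ! i then pure_tensor V (vs[j := sum_inj (b ! i) y, i := sum_inj (b ! j) x])
      else plug V n j vs (tensor_map V0 V 2 (sum_inj (b ! i)) (R (pure_tensor V0 [x, y]))))"
    using s_op_homog[OF i h] unfolding j_def by metis
  obtain x' y' where vx': "map ?g vs ! j = sum_inj (map g b ! j) x'" and vy': "map ?g vs ! i = sum_inj (map g b ! i) y'"
    and s': "s_op i (pure_tensor V (map ?g vs)) =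
     (if map g b ! j \<noteq> map g b ! i then
        pure_tensor V ((map ?g vs)[j := sum_inj (map g b ! i) y', i := sum_inj (map g b ! j) x'])
      else plug V n j (map ?g vs) (tensor_map V0 V 2 (sum_inj (map g b ! i)) (R (pure_tensor V0 [x', y']))))"
    using s_op_homog[OF i h'] unfolding j_def by metis
  have "sum_inj (g (b ! j)) x' = sum_inj (g (b ! j)) x" "sum_inj (g (b ! i)) y' = sum_inj (g (b ! i)) y"
    using vx vy vx' vy' len j by (auto simp: perm_act_sum_inj[OF g])
  then have xy': "x' = x" "y' = y" by (auto simp: sum_inj_def dest: fun_cong split: if_splits)
  have nth: "map g b ! j = g (b ! j)" "map g b ! i = g (b ! i)" using len j by auto
  show "s_op i (perm g (pure_tensor V vs)) = perm g (s_op i (pure_tensor V vs))"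
  proof (cases "b ! j = b ! i")
    case False
    have "vs[j := sum_inj (b ! i) y, i := sum_inj (b ! j) x] \<in> lists_on V n"
      using homog_lists[OF homog_update[OF h j(2) bj(2,1) xy(2,1)]] j by simp
    then show ?thesis
      using False by (simp add: s s' xy' nth inj_g perm_pure[OF g] vs perm_act_sum_inj[OF g] map_update)
  next
    case True
    have "plug V n j (map ?g vs) (tensor_map V0 V 2 (sum_inj (g (b ! i))) r) =
        perm g (plug V n j vs (tensor_map V0 V 2 (sum_inj (b ! i)) r))"
      if "r \<in> vcar (tensor_power V0 2)" for r
    proof (rule linmap_tensor_eq[OF vspace_W linmap_plug_sum_inj[OF vs' j(2) gb]
          linmap_comp[OF linmap_plug_sum_inj[OF vs j(2) bj(2)] linmap_perm[OF g]] _ that])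
      fix us assume "us \<in> lists_on V0 2"
      then obtain x y where us: "us = [x, y]" "x \<in> vcar V0" "y \<in> vcar V0" by (auto simp: lists_on_2)
      show "plug V n j (map ?g vs) (tensor_map V0 V 2 (sum_inj (g (b ! i))) (pure_tensor V0 us)) =
        perm g (plug V n j vs (tensor_map V0 V 2 (sum_inj (b ! i)) (pure_tensor V0 us)))"
        unfolding us(1) plug_sum_inj_pure[OF vs j(2) bj(2) us(2,3)] plug_sum_inj_pure[OF vs' j(2) gb us(2,3)]
        using homog_lists[OF homog_update[OF h j(2) bj(2) bj(2) us(2,3)]]
        by (simp add: perm_pure[OF g] map_update perm_act_sum_inj[OF g])
    qed
    then show ?thesis
      using True R_pure_closed[OF xy] by (simp add: s s' xy' nth perm_pure[OF g vs])
  qed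
qed

end

section \<open>Equality patterns and permutations\<close>

text \<open>
  The complements of \<open>A\<close> and \<open>B\<close> have the same number of elements.
\<close>

lemma extend_to_permutation:
  assumes S: "finite S" and A: "A \<subseteq> S" and B: "B \<subseteq> S" and f: "bij_betw f A B"
  obtains g where "g permutes S" "\<And>x. x \<in> A \<Longrightarrow> g x = f x"
proof -
  have "card A = card B" using f by (rule bij_betw_same_card)
  then have "card (S - A) = card (S - B)"
    using S A B by (simp add: card_Diff_subset finite_subset)
  then obtain h where h: "bij_betw h (S - A) (S - B)"
    using S finite_same_card_bij by blast
  define g where "g x = (if x \<in> A then f x else if x \<in> S then h x else x)" for x
  have "bij_betw g A B" using f by (subst bij_betw_cong[of A g f]) (auto simp: g_def)
  moreover have "bij_betw g (S - A) (S - B)" using h by (subst bij_betw_cong[of _ g h]) (auto simp: g_def)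
  ultimately have "bij_betw g (A \<union> (S - A)) (B \<union> (S - B))" by (rule bij_betw_combine) auto
  moreover have "A \<union> (S - A) = S" "B \<union> (S - B) = S" using A B by auto
  ultimately have "g permutes S" using A by (intro bij_imp_permutes) (auto simp: g_def)
  then show thesis by (rule that) (simp add: g_def)
qed

definition same_pattern :: "'a list \<Rightarrow> 'a list \<Rightarrow> bool" where
  "same_pattern b c \<longleftrightarrow> length b = length c \<and>
     (\<forall>i<length b. \<forall>j<length b. b ! i = b ! j \<longleftrightarrow> c ! i = c ! j)"

text \<open>
  Sending the \<open>i\<close>-th letter of \<open>c\<close> to the \<open>i\<close>-th letter of \<open>b\<close> is well defined and injective exactly
  because equal letters stand at the same places; it extends to a permutation of the alphabet.
\<close>

lemma same_pattern_permutation: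
  assumes "same_pattern c b" "set c \<subseteq> S" "set b \<subseteq> S" "finite S"
  obtains g where "g permutes S" "map g c = b"
proof -
  have len: "length c = length b" using assms(1) by (simp add: same_pattern_def)
  define f where "f x = b ! (SOME i. i < length c \<and> c ! i = x)" for x
  have f: "f (c ! i) = b ! i" if "i < length c" for i
  proof -
    have "(SOME k. k < length c \<and> c ! k = c ! i) < length c \<and> c ! (SOME k. k < length c \<and> c ! k = c ! i) = c ! i"
      by (rule someI[of _ i]) (use that in simp)
    then show ?thesis using assms(1) that by (auto simp: f_def same_pattern_def)
  qed
  have "inj_on f (set c)"
  proof (rule inj_onI)
    fix x y assume "x \<in> set c" "y \<in> set c" "f x = f y"
    then obtain i j where "i < length c" "x = c ! i" "j < length c" "y = c ! j"
      by (auto simp: in_set_conv_nth)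
    then show "x = y" using \<open>f x = f y\<close> f assms(1) by (auto simp: same_pattern_def)
  qed
  moreover have "map f c = b" using f len by (intro nth_equalityI) auto
  moreover from this have "f ` set c = set b" by (metis set_map)
  ultimately have bij: "bij_betw f (set c) (set b)" and mf: "map f c = b" by (auto simp: bij_betw_def)
  obtain g where g: "g permutes S" "\<And>x. x \<in> set c \<Longrightarrow> g x = f x"
    by (rule extend_to_permutation[OF assms(4,2,3) bij]) (rule that)
  have "map g c = b" using g(2) mf by (metis map_cong)
  with g(1) show thesis by (rule that)
qed

section \<open>The morphism from the tied braid algebra\<close>

locale framed_braid_action = flip_operator V0 d n R
  for V0 :: "('k::field, 'v::ab_group_add) vspace" and d n and R +
  fixes A0 :: "('k, 'a::ab_group_add) bialg"
    and act :: "'a \<Rightarrow> 'v \<Rightarrow> 'v" and \<zeta> :: 'k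
    and \<Phi> :: "(framed_gen word set \<Rightarrow> 'k) \<Rightarrow> ((nat \<Rightarrow> 'v, 'k) tensor \<Rightarrow> (nat \<Rightarrow> 'v, 'k) tensor)"
  assumes d_pos: "d \<ge> 1" and d_unit: "of_nat d \<noteq> (0 :: 'k)" and root: "primitive_root d \<zeta>"
    and bialg: "is_bialgebra A0" and module: "is_module A0 V0 act"
    and \<Phi>: "\<Phi> \<in> alg_hom (monoid_alg (framed_braid_group d n)) (End_A d A0 V0 act n)"
    and \<Phi>_t: "\<forall>i\<in>{1..n}. \<Phi> (basis_elt (framed_t d n i)) = on_factor V n (tau d V0 \<zeta>) i"
    and \<Phi>_s: "\<forall>i\<in>{1..<n}. \<Phi> (basis_elt (framed_s d n i)) = on_factors V n (sigma d V0 R) i"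
begin

abbreviation "EA \<equiv> End_A d A0 V0 act n"
abbreviation "ES \<equiv> End_smash d A0 V0 act n"

lemma linmap_A_act: "a \<in> vcar (tensor_bialg d A0) \<Longrightarrow> linmap W W (A_act d A0 V0 act n a)"
  unfolding A_act_def by (rule comult_action.linmap_tensor_act[OF comult_action_tensor_bialg[OF bialg module]])

lemma kalgebra_ES: "kalgebra ES"
  unfolding End_smash_def
proof (rule kalgebra_End_alg[OF vspace_W])
  fix u assume "u \<in> vcar (smash d A0)"
  then have u: "u g \<in> vcar (tensor_bialg d A0)" if "g permutes {1..d}" for g
    using that by (auto simp: smash_def Let_def)
  have "linmap W W (\<lambda>t. \<Sum>g\<in>{g. g permutes {1..d}}. A_act d A0 V0 act n (u g) (perm g t))"
  proof (rule linmap_setsum[OF vspace_W])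
    fix g assume "g \<in> {g. g permutes {1..d}}"
    then have g: "g permutes {1..d}" by simp
    show "linmap W W (\<lambda>t. A_act d A0 V0 act n (u g) (perm g t))"
      by (rule linmap_comp[OF linmap_perm[OF g] linmap_A_act[OF u[OF g]]])
  qed
  then show "linmap W W (smash_act d A0 V0 act n u)"
    by (simp add: smash_act_def[abs_def])
qed

lemma EA_simps:
  "t \<in> vcar W \<Longrightarrow> (f \<otimes>\<^bsub>EA\<^esub> g) t = f (g t)" "t \<in> vcar W \<Longrightarrow> (f \<oplus>\<^bsub>EA\<^esub> g) t = f t + g t"
  "t \<in> vcar W \<Longrightarrow> (c \<odot>\<^bsub>EA\<^esub> f) t = tensor_scale c (f t)" "t \<in> vcar W \<Longrightarrow> \<one>\<^bsub>EA\<^esub> t = t"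
  by (simp_all add: End_A_def End_alg_def compose_def)

lemma ES_simps:
  "t \<in> vcar W \<Longrightarrow> (f \<otimes>\<^bsub>ES\<^esub> g) t = f (g t)" "t \<in> vcar W \<Longrightarrow> (f \<oplus>\<^bsub>ES\<^esub> g) t = f t + g t"
  "t \<in> vcar W \<Longrightarrow> (c \<odot>\<^bsub>ES\<^esub> f) t = tensor_scale c (f t)" "t \<in> vcar W \<Longrightarrow> \<one>\<^bsub>ES\<^esub> t = t"
  by (simp_all add: End_smash_def End_alg_def compose_def)

lemma EA_linmap: "f \<in> carrier EA \<Longrightarrow> linmap W W f"
  and EA_ext: "f \<in> carrier EA \<Longrightarrow> f \<in> extensional (vcar W)"
  by (auto simp: End_A_def carrier_End_alg linear_maps_iff)

lemma EA_closed: "f \<in> carrier EA \<Longrightarrow> t \<in> vcar W \<Longrightarrow> f t \<in> vcar W"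
  by (rule linmap_closed[of W W f, OF EA_linmap])

lemma ES_iff:
  "f \<in> carrier ES \<longleftrightarrow> f \<in> carrier EA \<and> (\<forall>g. g permutes {1..d} \<longrightarrow> (\<forall>t\<in>vcar W. f (perm g t) = perm g (f t)))"
  by (rule End_smash_iff[OF bialg module])

lemma EA_eqI:
  "f \<in> carrier EA \<Longrightarrow> h \<in> extensional (vcar W) \<Longrightarrow> (\<And>t. t \<in> vcar W \<Longrightarrow> f t = h t) \<Longrightarrow> f = h"
  by (rule extensionalityI[OF EA_ext])

sublocale P: presentation "framed_gens n" "framed_rels d n"
  by (rule presentation_framed)

lemma framed_defs:
  "framed_braid_group d n = P.G" "framed_s d n i = P.cls [(FS i, True)]" "framed_t d n i = P.cls [(FT i, True)]"
  by (simp_all add: framed_braid_group_def framed_s_def framed_t_def)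

lemma \<Phi>': "\<Phi> \<in> alg_hom (monoid_alg P.G) EA"
  using \<Phi> by (simp add: framed_defs)

definition rho :: "framed_gen word \<Rightarrow> (nat \<Rightarrow> 'v, 'k) tensor \<Rightarrow> (nat \<Rightarrow> 'v, 'k) tensor" where
  "rho u = \<Phi> (basis_elt (P.cls u))"

lemma rho_in: "u \<in> P.words \<Longrightarrow> rho u \<in> carrier EA"
  unfolding rho_def by (rule P.hom_cls_closed[OF \<Phi>'])

lemma rho_Nil: "t \<in> vcar W \<Longrightarrow> rho [] t = t"
  unfolding rho_def P.hom_cls_Nil[OF \<Phi>'] by (rule EA_simps)

lemma rho_append:
  "u \<in> P.words \<Longrightarrow> v \<in> P.words \<Longrightarrow> t \<in> vcar W \<Longrightarrow> rho (u @ v) t = rho u (rho v t)"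
  unfolding rho_def by (simp only: P.hom_cls_append[OF \<Phi>'] EA_simps)

lemma rho_Cons:
  "l \<in> framed_gens n \<times> UNIV \<Longrightarrow> v \<in> P.words \<Longrightarrow> t \<in> vcar W \<Longrightarrow> rho (l # v) t = rho [l] (rho v t)"
  using rho_append[of "[l]" v t] by simp

lemma rho_cancel: "x \<in> framed_gens n \<Longrightarrow> t \<in> vcar W \<Longrightarrow> rho [(x, b)] (rho [(x, \<not> b)] t) = t"
  using fun_cong[OF P.hom_cls_cancel[OF \<Phi>', of x b], of t] by (simp add: EA_simps rho_def)

lemma rho_rel: "(u, v) \<in> framed_rels d n \<Longrightarrow> rho u = rho v"
  unfolding rho_def by (rule P.hom_cls_rel[OF \<Phi>'])

lemma gens: "i \<in> {1..<n} \<Longrightarrow> FS i \<in> framed_gens n" "i \<in> {1..n} \<Longrightarrow> FT i \<in> framed_gens n"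
  by (auto simp: framed_gens_def)

definition s_inv :: "nat \<Rightarrow> (nat \<Rightarrow> 'v, 'k) tensor \<Rightarrow> (nat \<Rightarrow> 'v, 'k) tensor" where
  "s_inv i = rho [(FS i, False)]"

lemma rho_s: "i \<in> {1..<n} \<Longrightarrow> rho [(FS i, True)] = s_op i"
  using \<Phi>_s by (simp add: rho_def s_op_def flip: framed_defs)

lemma s_in: "i \<in> {1..<n} \<Longrightarrow> s_op i \<in> carrier EA" "i \<in> {1..<n} \<Longrightarrow> s_inv i \<in> carrier EA"
  using rho_in[of "[(FS i, True)]"] rho_in[of "[(FS i, False)]"] gens(1)[of i]
  by (simp_all add: rho_s s_inv_def)

lemma s_closed:
  "i \<in> {1..<n} \<Longrightarrow> t \<in> vcar W \<Longrightarrow> s_op i t \<in> vcar W" "i \<in> {1..<n} \<Longrightarrow> t \<in> vcar W \<Longrightarrow> s_inv i t \<in> vcar W"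
  by (erule (1) EA_closed[OF s_in(1)] EA_closed[OF s_in(2)])+

lemma s_s_inv:
  assumes "i \<in> {1..<n}" "t \<in> vcar W"
  shows "s_op i (s_inv i t) = t" "s_inv i (s_op i t) = t"
  using rho_cancel[OF gens(1)[OF assms(1)] assms(2), of True]
    rho_cancel[OF gens(1)[OF assms(1)] assms(2), of False]
  by (simp_all add: rho_s[OF assms(1)] s_inv_def)

text \<open>
  Follows from the rule for \<open>s_op\<close> because the exchange of two entries is an involution.
\<close>

lemma s_inv_diag:
  assumes i: "i \<in> {1..<n}" and t: "t \<in> vcar W"
  shows "s_inv i (diag \<phi> t) = diag (\<lambda>b. \<phi> (swap_at i b)) (s_inv i t)"
proof -
  have "diag (\<lambda>b. \<phi> (swap_at i (swap_at i b))) = diag \<phi>"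
    using i by (intro diag_cong) (simp add: swap_at_swap_at degs_def)
  then have "s_op i (diag (\<lambda>b. \<phi> (swap_at i b)) (s_inv i t)) = diag \<phi> t"
    using s_op_diag[OF i s_closed(2)[OF i t], of "\<lambda>b. \<phi> (swap_at i b)"] by (simp add: s_s_inv[OF i t])
  then show ?thesis
    using s_s_inv(2)[OF i diag_closed[OF s_closed(2)[OF i t]]] by metis
qed

lemma s_in_ES: "i \<in> {1..<n} \<Longrightarrow> s_op i \<in> carrier ES"
  unfolding ES_iff using s_in(1) s_op_perm by blast

lemma s_inv_in_ES:
  assumes i: "i \<in> {1..<n}"
  shows "s_inv i \<in> carrier ES"
  unfolding ES_iff
proof (intro conjI allI impI ballI s_in(2)[OF i])
  fix g t assume g: "g permutes {1..d}" and t: "t \<in> vcar W"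
  have "perm g t = perm g (s_op i (s_inv i t))" using s_s_inv(1)[OF i t] by simp
  also have "\<dots> = s_op i (perm g (s_inv i t))" by (rule s_op_perm[OF g i s_closed(2)[OF i t], symmetric])
  finally show "s_inv i (perm g t) = perm g (s_inv i t)"
    using s_s_inv(2)[OF i linmap_closed[OF linmap_perm[OF g] s_closed(2)[OF i t]]] by simp
qed

subsection \<open>The elements \<open>E\<^sub>i\<close>\<close>

definition tw :: "nat \<Rightarrow> nat list \<Rightarrow> 'k" where
  "tw i b = \<zeta> ^ (b ! (i - 1) - 1)"

lemma root_nonzero: "\<zeta> \<noteq> 0"
  using root d_pos by (auto simp: primitive_root_def power_0_left)

lemma rho_t: "i \<in> {1..n} \<Longrightarrow> rho [(FT i, True)] = diag (tw i)"
  using \<Phi>_t on_factor_tau by (simp add: rho_def tw_def[abs_def] flip: framed_defs)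

lemma rho_t_inv:
  assumes i: "i \<in> {1..n}" and t: "t \<in> vcar W"
  shows "rho [(FT i, False)] t = diag (\<lambda>b. inverse (tw i b)) t"
proof -
  have "diag (tw i) (diag (\<lambda>b. inverse (tw i b)) t) = t"
    using root_nonzero by (simp add: diag_diag t tw_def diag_one)
  then show ?thesis
    using rho_cancel[OF gens(2)[OF i] diag_closed[OF t], of False "\<lambda>b. inverse (tw i b)"]
    by (simp add: rho_t[OF i])
qed

lemma rho_t_pow:
  assumes i: "i \<in> {1..n}" and t: "t \<in> vcar W"
  shows "rho (replicate a (FT i, True)) t = diag (\<lambda>b. tw i b ^ a) t"
    and "rho (replicate a (FT i, False)) t = diag (\<lambda>b. inverse (tw i b) ^ a) t"
proof -
  have w: "(FT i, b) \<in> framed_gens n \<times> UNIV" "replicate a (FT i, b) \<in> P.words" for b a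
    using gens(2)[OF i] by auto
  show "rho (replicate a (FT i, True)) t = diag (\<lambda>b. tw i b ^ a) t"
    by (induction a) (simp_all add: rho_Nil t diag_one rho_Cons[OF w] rho_t[OF i] diag_diag del: in_lists_conv_set)
  show "rho (replicate a (FT i, False)) t = diag (\<lambda>b. inverse (tw i b) ^ a) t"
    by (induction a)
      (simp_all add: rho_Nil t diag_one rho_Cons[OF w] rho_t_inv[OF i] diag_closed diag_diag del: in_lists_conv_set)
qed

lemma diag_zero: "t \<in> vcar W \<Longrightarrow> diag (\<lambda>b. 0) t = 0"
  using diag_smult[of t 0 "\<lambda>b. 0"] scale_zero_left[OF vspace_W] by simp

lemma diag_sum:
  "t \<in> vcar W \<Longrightarrow> diag (\<lambda>b. \<Sum>a\<in>S. \<phi> a b) t = (\<Sum>a\<in>S. diag (\<phi> a) t)"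
proof (induction S rule: infinite_finite_induct)
  case (insert a S)
  then show ?case by (simp add: diag_add)
qed (simp_all add: diag_zero)

definition eps :: "nat \<Rightarrow> nat list \<Rightarrow> 'k" where
  "eps i b = (if b ! (i - 1) = b ! i then 1 else 0)"

lemma root_power_inj:
  assumes "p < d" "q < d" "\<zeta> ^ p = \<zeta> ^ q"
  shows "p = q"
proof -
  have *: "p = q" if "p \<le> q" "q < d" "\<zeta> ^ p = \<zeta> ^ q" for p q
  proof (rule ccontr)
    assume "p \<noteq> q"
    have "\<zeta> ^ (p + (q - p)) = \<zeta> ^ p * \<zeta> ^ (q - p)" by (rule power_add)
    then have "\<zeta> ^ p * 1 = \<zeta> ^ p * \<zeta> ^ (q - p)" using that(1,3) by simp
    then have "\<zeta> ^ (q - p) = 1" using root_nonzero by simp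
    moreover have "q - p \<in> {1..<d}" using that \<open>p \<noteq> q\<close> by auto
    ultimately show False using root by (auto simp: primitive_root_def)
  qed
  show ?thesis using *[of p q] *[of q p] assms by (cases "p \<le> q") auto
qed

text \<open>
  A finite geometric sum: the ratio \<open>x\<close> of the two eigenvalues is a \<open>d\<close>-th root of unity, and it is 1 only
  for equal entries because \<open>\<zeta>\<close> is primitive.
\<close>

lemma eps_eq:
  assumes b: "b \<in> degs" and i: "i \<in> {1..<n}"
  shows "inverse (of_nat d) * (\<Sum>a = 1..d. tw i b ^ a * inverse (tw (Suc i) b) ^ a) = eps i b"
proof -
  define p q where "p = b ! (i - 1)" and "q = b ! i"
  have pq: "p \<in> {1..d}" "q \<in> {1..d}" unfolding p_def q_def using degs_nth[OF b] i by auto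
  define x where "x = \<zeta> ^ (p - 1) * inverse (\<zeta> ^ (q - 1))"
  have sum: "(\<Sum>a = 1..d. tw i b ^ a * inverse (tw (Suc i) b) ^ a) = (\<Sum>a = 1..d. x ^ a)"
    by (simp add: x_def tw_def p_def q_def power_mult_distrib)
  show ?thesis
  proof (cases "p = q")
    case True
    then have "x = 1" using root_nonzero by (simp add: x_def)
    then show ?thesis unfolding sum using True d_unit by (simp add: eps_def p_def q_def)
  next
    case False
    have "x ^ d = (\<zeta> ^ d) ^ (p - 1) * inverse ((\<zeta> ^ d) ^ (q - 1))"
      by (simp add: x_def power_mult_distrib power_inverse flip: power_mult) (simp add: mult.commute)
    then have "x ^ d = 1" using root by (simp add: primitive_root_def)
    have "x \<noteq> 1"
    proof
      assume "x = 1"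
      then have "\<zeta> ^ (p - 1) = \<zeta> ^ (q - 1)" using root_nonzero by (simp add: x_def field_simps)
      then have "p - 1 = q - 1" using pq by (intro root_power_inj) auto
      then show False using False pq by auto
    qed
    \<comment> \<open>The sum starts at exponent 1; this only multiplies the usual geometric sum by \<open>x\<close>.\<close>
    have "(1 - x) * (\<Sum>a<d. x ^ a) = 0" using \<open>x ^ d = 1\<close> one_diff_power_eq[of x d] by simp
    then have "(\<Sum>a<d. x ^ a) = 0" using \<open>x \<noteq> 1\<close> by simp
    moreover have "(\<Sum>a = 1..d. x ^ a) = x * (\<Sum>a<d. x ^ a)"
      using sum.atLeast1_atMost_eq[of "\<lambda>a. x ^ a" d] by (simp add: sum_distrib_left)
    ultimately have "(\<Sum>a = 1..d. x ^ a) = 0" by simp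
    then show ?thesis unfolding sum using False by (simp add: eps_def p_def q_def)
  qed
qed

lemma \<Phi>_sum:
  assumes "finite S" "\<And>a. a \<in> S \<Longrightarrow> f a \<in> carrier (monoid_alg P.G)" "t \<in> vcar W"
  shows "(\<lambda>g. \<Sum>a\<in>S. f a g) \<in> carrier (monoid_alg P.G) \<and> \<Phi> (\<lambda>g. \<Sum>a\<in>S. f a g) t = (\<Sum>a\<in>S. \<Phi> (f a) t)"
  using assms(1,2)
proof (induction S rule: finite_induct)
  interpret K: kalgebra "monoid_alg P.G :: ('k, framed_gen word set \<Rightarrow> 'k) module"
    by (intro kalgebra_monoid_alg group.is_monoid P.group_G)
  case empty
  \<comment> \<open>An algebra morphism maps 0 to 0, as it is compatible with the scalar 0.\<close>
  have "\<Phi> (0 \<odot>\<^bsub>monoid_alg P.G\<^esub> \<zero>\<^bsub>monoid_alg P.G\<^esub>) t = tensor_scale 0 (\<Phi> \<zero>\<^bsub>monoid_alg P.G\<^esub> t)"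
    by (subst alg_homD(7)[OF \<Phi>' K.zero_closed]) (simp add: EA_simps assms(3))
  then have "\<Phi> (\<lambda>g. 0) t = 0" by (simp add: monoid_alg_simps(3,4) tensor_scale_def fun_eq_iff)
  then show ?case using K.zero_closed by (simp add: monoid_alg_simps(3))
next
  interpret K: kalgebra "monoid_alg P.G :: ('k, framed_gen word set \<Rightarrow> 'k) module"
    by (intro kalgebra_monoid_alg group.is_monoid P.group_G)
  case (insert a S)
  then have 1: "f a \<in> carrier (monoid_alg P.G)" "(\<lambda>g. \<Sum>a\<in>S. f a g) \<in> carrier (monoid_alg P.G)" by auto
  have "\<Phi> (f a \<oplus>\<^bsub>monoid_alg P.G\<^esub> (\<lambda>g. \<Sum>a\<in>S. f a g)) t = \<Phi> (f a) t + \<Phi> (\<lambda>g. \<Sum>a\<in>S. f a g) t"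
    by (subst alg_homD(5)[OF \<Phi>' 1]) (simp add: EA_simps assms(3))
  then show ?case using insert K.a_closed[OF 1] by (simp add: monoid_alg_simps(2))
qed

lemma framed_E_eq:
  assumes i: "i \<in> {1..<n}"
  shows "framed_E d n i = inverse (of_nat d) \<odot>\<^bsub>monoid_alg P.G\<^esub>
    (\<lambda>g. \<Sum>a = 1..d. basis_elt (P.cls (replicate a (FT i, True) @ replicate a (FT (Suc i), False))) g)"
proof -
  have g: "FT i \<in> framed_gens n" "FT (Suc i) \<in> framed_gens n" using i by (auto intro: gens)
  have "framed_t d n i [^]\<^bsub>P.G\<^esub> a \<otimes>\<^bsub>P.G\<^esub> inv\<^bsub>P.G\<^esub> (framed_t d n (Suc i) [^]\<^bsub>P.G\<^esub> a) =
      P.cls (replicate a (FT i, True) @ replicate a (FT (Suc i), False))" for a :: nat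
    using g unfolding framed_defs P.cls_pow[OF g(1)] P.cls_inv_pow[OF g(2)] by (intro P.cls_mult) auto
  then show ?thesis
    by (simp add: framed_E_def framed_defs(1) monoid_alg_simps(4))
qed

lemma \<Phi>_E:
  assumes i: "i \<in> {1..<n}"
  shows "(framed_E d n i :: framed_gen word set \<Rightarrow> 'k) \<in> carrier (monoid_alg P.G)" "\<Phi> (framed_E d n i) = diag (eps i)"
proof -
  interpret K: kalgebra "monoid_alg P.G :: ('k, framed_gen word set \<Rightarrow> 'k) module"
    by (intro kalgebra_monoid_alg group.is_monoid P.group_G)
  let ?u = "\<lambda>a. replicate a (FT i, True) @ replicate a (FT (Suc i), False)"
  have i': "i \<in> {1..n}" "Suc i \<in> {1..n}" using i by auto
  have u: "replicate a (FT i, True) \<in> P.words" "replicate a (FT (Suc i), False) \<in> P.words" for a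
    using gens(2)[OF i'(1)] gens(2)[OF i'(2)] by auto
  have c: "basis_elt (P.cls (?u a)) \<in> carrier (monoid_alg P.G :: ('k, framed_gen word set \<Rightarrow> 'k) module)" for a
    unfolding basis_elt_carrier by (rule P.cls_in_carrier) (use u in simp)
  note sum = \<Phi>_sum[of "{1..d}" "\<lambda>a. basis_elt (P.cls (?u a))", OF finite_atLeastAtMost c]
  have S: "(\<lambda>g. \<Sum>a = 1..d. basis_elt (P.cls (?u a)) g) \<in> carrier (monoid_alg P.G :: ('k, framed_gen word set \<Rightarrow> 'k) module)"
    using sum[OF vspace_zero[OF vspace_W]] by blast
  show E: "framed_E d n i \<in> carrier (monoid_alg P.G :: ('k, framed_gen word set \<Rightarrow> 'k) module)"
    unfolding framed_E_eq[OF i] by (rule K.smult_closed[OF S])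
  show "\<Phi> (framed_E d n i) = diag (eps i)"
  proof (rule EA_eqI[OF alg_homD(3)[OF \<Phi>' E] diag_extensional])
    fix t assume t: "t \<in> vcar W"
    have "\<Phi> (framed_E d n i) t = tensor_scale (inverse (of_nat d)) (\<Sum>a = 1..d. rho (?u a) t)"
      unfolding framed_E_eq[OF i] alg_homD(7)[OF \<Phi>' S] using sum[OF t] by (simp add: EA_simps t rho_def)
    also have "(\<Sum>a = 1..d. rho (?u a) t) = (\<Sum>a = 1..d. diag (\<lambda>b. tw i b ^ a * inverse (tw (Suc i) b) ^ a) t)"
      by (intro sum.cong HOL.refl)
        (simp only: rho_append[OF u t] rho_t_pow[OF i'(1)] rho_t_pow[OF i'(2)] t diag_closed diag_diag)
    also have "tensor_scale (inverse (of_nat d)) \<dots> =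
        diag (\<lambda>b. inverse (of_nat d) * (\<Sum>a = 1..d. tw i b ^ a * inverse (tw (Suc i) b) ^ a)) t"
      by (simp only: diag_smult[OF t] diag_sum[OF t])
    also have "\<dots> = diag (eps i) t" by (rule fun_cong[OF diag_cong]) (rule eps_eq[OF _ i])
    finally show "\<Phi> (framed_E d n i) t = diag (eps i) t" .
  qed
qed

lemma E_in_ES:
  assumes i: "i \<in> {1..<n}"
  shows "diag (eps i) \<in> carrier ES"
  unfolding ES_iff
proof (intro conjI allI impI ballI)
  show "diag (eps i) \<in> carrier EA" using alg_homD(3)[OF \<Phi>' \<Phi>_E(1)[OF i]] by (simp add: \<Phi>_E(2)[OF i])
  fix g t assume g: "g permutes {1..d}" and t: "t \<in> vcar W"
  have "Hilbert_Choice.inv g p = Hilbert_Choice.inv g q \<longleftrightarrow> p = q" for p q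
    using permutes_inj[OF permutes_inv[OF g]] by (simp add: inj_eq)
  then have "diag (\<lambda>b. eps i (map (Hilbert_Choice.inv g) b)) = diag (eps i)"
    using i by (intro diag_cong) (auto simp: eps_def degs_def)
  then show "diag (eps i) (perm g t) = perm g (diag (eps i) t)"
    using perm_diag[OF g t, of "eps i"] by simp
qed

subsection \<open>The relations of the tied braid algebra\<close>

text \<open>
  The five substitutions of indices behind the relations of the tied braid algebra.
\<close>

lemma eps_swap:
  assumes b: "b \<in> degs" and i: "i \<in> {1..<n}" and j: "j \<in> {1..<n}"
  shows "eps i (swap_at i b) = eps i b"
    and "distant i j \<Longrightarrow> eps j (swap_at i b) = eps j b"
    and "adjacent i j \<Longrightarrow> eps j (swap_at i (swap_at j b)) = eps i b"
    and "adjacent i j \<Longrightarrow> eps i b * eps j b = eps j b * eps j (swap_at i b)"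
    and "adjacent i j \<Longrightarrow> eps j b * eps j (swap_at i b) = eps j (swap_at i b) * eps i (swap_at i b)"
proof -
  obtain p q where pq: "i = Suc p" "j = Suc q" "Suc p < n" "Suc q < n"
    using i j by (cases i; cases j) auto
  have len: "length b = n" using b by (simp add: degs_def)
  have sw: "swap_at (Suc r) c ! k = (if k = Suc r then c ! r else if k = r then c ! Suc r else c ! k)"
    if "length c = n" "Suc r < n" "k < n" for r k and c :: "nat list"
    using that swap_at_nth[of "Suc r" c k] by simp
  have e: "eps (Suc r) c = (if c ! r = c ! Suc r then 1 else 0)" for r c by (simp add: eps_def)
  show "eps i (swap_at i b) = eps i b" using pq len by (auto simp: e sw)
  show "eps j (swap_at i b) = eps j b" if "distant i j"
    using that pq len by (auto simp: e sw)
  show "eps j (swap_at i (swap_at j b)) = eps i b" if "adjacent i j"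
    using that pq(3,4) len unfolding pq(1,2) by (elim disjE) (auto simp: e sw)
  show "eps i b * eps j b = eps j b * eps j (swap_at i b)" if "adjacent i j"
    using that pq(3,4) len unfolding pq(1,2) by (elim disjE) (auto simp: e sw)
  show "eps j b * eps j (swap_at i b) = eps j (swap_at i b) * eps i (swap_at i b)" if "adjacent i j"
    using that pq(3,4) len unfolding pq(1,2) by (elim disjE) (auto simp: e sw)
qed

fun tied_op :: "tied_gen \<Rightarrow> (nat \<Rightarrow> 'v, 'k) tensor \<Rightarrow> (nat \<Rightarrow> 'v, 'k) tensor" where
  "tied_op (TS i) = s_op i" | "tied_op (TSinv i) = s_inv i" | "tied_op (TE i) = diag (eps i)"

lemma tied_op_in: "x \<in> tied_gens n \<Longrightarrow> tied_op x \<in> carrier ES"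
  using s_in_ES s_inv_in_ES E_in_ES by (auto simp: tied_gens_def)

lemma word_prod_tied: "t \<in> vcar W \<Longrightarrow> word_prod ES tied_op u t = foldr tied_op u t"
  by (induction u) (simp_all add: ES_simps)

lemma tied_rels_words: "tied_rels n \<subseteq> lists (tied_gens n) \<times> lists (tied_gens n)"
  unfolding tied_rels_def braid_rels_def tied_gens_def by auto

lemma braid_relations:
  assumes i: "i \<in> {1..<n}" and j: "j \<in> {1..<n}" and t: "t \<in> vcar W"
  shows "distant i j \<Longrightarrow> s_op i (s_op j t) = s_op j (s_op i t)"
    and "adjacent i j \<Longrightarrow> s_op i (s_op j (s_op i t)) = s_op j (s_op i (s_op j t))"
proof -
  have w: "(FS k, True) \<in> framed_gens n \<times> UNIV" if "k \<in> {1..<n}" for k using gens(1)[OF that] by simp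
  have 2: "rho [(FS k, True), (FS l, True)] t = s_op k (s_op l t)" if "k \<in> {1..<n}" "l \<in> {1..<n}" for k l
    using that w t by (simp add: rho_Cons rho_s)
  have 3: "rho [(FS k, True), (FS l, True), (FS k, True)] t = s_op k (s_op l (s_op k t))"
    if "k \<in> {1..<n}" "l \<in> {1..<n}" for k l
    using that w t by (simp add: rho_Cons rho_s s_closed)
  show "s_op i (s_op j t) = s_op j (s_op i t)" if "distant i j"
  proof -
    have "rho [(FS i, True), (FS j, True)] = rho [(FS j, True), (FS i, True)]"
      by (rule rho_rel, unfold framed_rels_def braid_rels_def) (use i j that in blast)
    then show ?thesis using 2[OF i j] 2[OF j i] by simp
  qed
  show "s_op i (s_op j (s_op i t)) = s_op j (s_op i (s_op j t))" if "adjacent i j"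
  proof -
    have "rho [(FS i, True), (FS j, True), (FS i, True)] = rho [(FS j, True), (FS i, True), (FS j, True)]"
      by (rule rho_rel, unfold framed_rels_def braid_rels_def) (use i j that in blast)
    then show ?thesis using 3[OF i j] 3[OF j i] by simp
  qed
qed

text \<open>
  In a relation that contains some \<open>E\<^sub>i\<close>, the diagonal operators are collected to the left of the \<open>\<sigma>\<close>'s;
  what remains to compare are their eigenvalues.
\<close>

lemma tied_relations:
  assumes "(u, v) \<in> tied_rels n" and t: "t \<in> vcar W"
  shows "foldr tied_op u t = foldr tied_op v t"
proof -
  have E2: "diag (eps i) (diag (eps j) t) = diag (eps j) (diag (eps i) t)" for i j
    by (simp add: diag_diag t mult.commute)
  have E1: "diag (eps i) (diag (eps i) t) = diag (eps i) t" for i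
    unfolding diag_diag[OF t] by (rule fun_cong[OF diag_cong]) (simp add: eps_def)
  have sE: "s_op i (diag (eps i) t) = diag (eps i) (s_op i t)" if "i \<in> {1..<n}" for i
    unfolding s_op_diag[OF that t] by (rule fun_cong[OF diag_cong]) (rule eps_swap(1)[OF _ that that])
  have sE_dist: "s_op i (diag (eps j) t) = diag (eps j) (s_op i t)"
    if "i \<in> {1..<n}" "j \<in> {1..<n}" "distant i j" for i j
    unfolding s_op_diag[OF that(1) t] by (rule fun_cong[OF diag_cong]) (rule eps_swap(2)[OF _ that])
  have Ess: "diag (eps i) (s_op j (s_op i t)) = s_op j (s_op i (diag (eps j) t))"
    and EssI: "diag (eps i) (s_op j (s_inv i t)) = s_op j (s_inv i (diag (eps j) t))"
    and EEs: "diag (eps i) (diag (eps j) (s_op i t)) = diag (eps j) (s_op i (diag (eps j) t))"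
    and EsE: "diag (eps j) (s_op i (diag (eps j) t)) = s_op i (diag (eps j) (diag (eps i) t))"
    if i: "i \<in> {1..<n}" and j: "j \<in> {1..<n}" and ij: "adjacent i j" for i j
  proof -
    note [simp] = s_op_diag[OF i] s_op_diag[OF j] s_inv_diag[OF i] diag_diag t diag_closed
      s_closed(1)[OF i] s_closed(1)[OF j] s_closed(2)[OF i]
    \<comment> \<open>Simplification moves all diagonal operators to the left.\<close>
    have "diag (\<lambda>b. eps j (swap_at i (swap_at j b))) = diag (eps i)"
      by (rule diag_cong) (rule eps_swap(3)[OF _ i j ij])
    then show "diag (eps i) (s_op j (s_op i t)) = s_op j (s_op i (diag (eps j) t))"
      "diag (eps i) (s_op j (s_inv i t)) = s_op j (s_inv i (diag (eps j) t))"
      by simp_all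
    have "diag (\<lambda>b. eps i b * eps j b) = diag (\<lambda>b. eps j b * eps j (swap_at i b))"
      by (rule diag_cong) (rule eps_swap(4)[OF _ i j ij])
    then show "diag (eps i) (diag (eps j) (s_op i t)) = diag (eps j) (s_op i (diag (eps j) t))"
      by simp
    have "diag (\<lambda>b. eps j b * eps j (swap_at i b)) = diag (\<lambda>b. eps j (swap_at i b) * eps i (swap_at i b))"
      by (rule diag_cong) (rule eps_swap(5)[OF _ i j ij])
    then show "diag (eps j) (s_op i (diag (eps j) t)) = s_op i (diag (eps j) (diag (eps i) t))"
      by simp
  qed
  show ?thesis
    using assms(1) unfolding tied_rels_def braid_rels_def
    by (elim UnE CollectE exE conjE; clarsimp simp only: prod.inject foldr.simps o_apply id_apply tied_op.simps)
      (simp_all only: foldr_Cons foldr_Nil o_apply id_apply tied_op.simps s_s_inv t E2 E1 sE sE_dist Ess EssI EEs EsE,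
        (rule braid_relations(1) braid_relations(2), assumption, assumption, rule t, assumption)+)
qed

lemma exists_Psi:
  obtains \<Psi> where "\<Psi> \<in> alg_hom (TB n) ES"
    "\<And>x. x \<in> tied_gens n \<Longrightarrow> \<Psi> (pres_alg_gen (tied_gens n) (tied_rels n) x) = tied_op x"
proof -
  interpret S: kalgebra ES by (rule kalgebra_ES)
  obtain \<Psi> where \<Psi>: "\<Psi> \<in> alg_hom (pres_alg (tied_gens n) (tied_rels n)) ES"
    "\<And>x. x \<in> tied_gens n \<Longrightarrow> \<Psi> (pres_alg_gen (tied_gens n) (tied_rels n) x) = tied_op x"
  proof (rule pres_alg_lift[OF kalgebra_ES tied_rels_words tied_op_in])
    fix u v assume uv: "(u, v) \<in> tied_rels n"
    then have "u \<in> lists (tied_gens n)" "v \<in> lists (tied_gens n)" using tied_rels_words by auto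
    then have "word_prod ES tied_op u \<in> carrier ES" "word_prod ES tied_op v \<in> carrier ES"
      by (auto intro!: S.word_prod_closed[of "tied_gens n"] tied_op_in simp del: in_lists_conv_set)
    then have "word_prod ES tied_op u \<in> carrier EA" "word_prod ES tied_op v \<in> carrier EA"
      unfolding ES_iff by blast+
    then show "word_prod ES tied_op u = word_prod ES tied_op v"
      by (intro EA_eqI EA_ext) (simp_all add: word_prod_tied tied_relations[OF uv])
  qed blast+
  show thesis by (rule that[of \<Psi>]) (use \<Psi> in \<open>simp_all add: TB_def\<close>)
qed

text \<open>
  The values on \<open>TSinv i\<close> are forced, as inverses of the values on \<open>TS i\<close>.
\<close>

lemma Psi_unique:
  assumes f: "f \<in> alg_hom (TB n) ES" and h: "h \<in> alg_hom (TB n) ES"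
    and eq: "\<forall>i\<in>{1..<n}. f (TB_s n i) = h (TB_s n i) \<and> f (TB_E n i) = h (TB_E n i)"
  shows "f = h"
proof -
  interpret S: kalgebra ES by (rule kalgebra_ES)
  let ?gen = "pres_alg_gen (tied_gens n) (tied_rels n) :: tied_gen \<Rightarrow> (tied_gen list \<Rightarrow> 'k) set"
  have inv: "f (?gen (TSinv i)) = h (?gen (TSinv i))" if i: "i \<in> {1..<n}" for i
  proof -
    have g: "TS i \<in> tied_gens n" "TSinv i \<in> tied_gens n" using i by (auto simp: tied_gens_def)
    then have c: "?gen (TS i) \<in> carrier (TB n)" "?gen (TSinv i) \<in> carrier (TB n)"
      unfolding TB_def by (auto intro: pres_alg_gen_closed)
    have r: "([TS i, TSinv i], []) \<in> tied_rels n" "([TSinv i, TS i], []) \<in> tied_rels n"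
      using i by (simp_all add: tied_rels_def)
    have m: "?gen (TS i) \<otimes>\<^bsub>TB n\<^esub> ?gen (TSinv i) = \<one>\<^bsub>TB n\<^esub>" "?gen (TSinv i) \<otimes>\<^bsub>TB n\<^esub> ?gen (TS i) = \<one>\<^bsub>TB n\<^esub>"
      unfolding TB_def by (intro pres_alg_rel_2[OF tied_rels_words] g r)+
    have k: "k (?gen (TS i)) \<otimes>\<^bsub>ES\<^esub> k (?gen (TSinv i)) = \<one>\<^bsub>ES\<^esub>"
      "k (?gen (TSinv i)) \<otimes>\<^bsub>ES\<^esub> k (?gen (TS i)) = \<one>\<^bsub>ES\<^esub>"
      if "k \<in> alg_hom (TB n) ES" for k
      using m alg_homD(4)[OF that c] alg_homD(4)[OF that c(2,1)] alg_homD(6)[OF that] by simp_all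
    have e: "f (?gen (TS i)) = h (?gen (TS i))" using eq i by (simp add: TB_s_def)
    show ?thesis
      by (rule S.inv_unique[of _ "h (?gen (TS i))"])
        (use k[OF f] k[OF h] e alg_homD(3)[OF f c(2)] alg_homD(3)[OF h c(1)] alg_homD(3)[OF h c(2)] in simp_all)
  qed
  have "f (?gen x) = h (?gen x)" if "x \<in> tied_gens n" for x
    using that eq inv by (auto simp: tied_gens_def TB_s_def TB_E_def)
  then show ?thesis
    using f h unfolding TB_def by (intro pres_alg_hom_eqI[OF kalgebra_ES tied_rels_words])
qed

end

section \<open>Surjectivity\<close>

lemma map_inv_eq_iff:
  assumes "g permutes S"
  shows "map (Hilbert_Choice.inv g) c = a \<longleftrightarrow> c = map g a"
  by (auto simp: map_idI permutes_inverses[OF assms])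

context framed_braid_action
begin

context
  fixes \<Psi> assumes \<Psi>: "\<Psi> \<in> alg_hom (TB n :: ('k, (tied_gen list \<Rightarrow> 'k) set) module) ES"
    and \<Psi>_gen: "\<And>x. x \<in> tied_gens n \<Longrightarrow> \<Psi> (pres_alg_gen (tied_gens n) (tied_rels n) x) = tied_op x"
begin

definition img where "img = \<Psi> ` carrier (TB n)"

lemma img_ops:
  assumes "f \<in> img" "h \<in> img"
  shows "f \<otimes>\<^bsub>ES\<^esub> h \<in> img" "f \<oplus>\<^bsub>ES\<^esub> h \<in> img" "c \<odot>\<^bsub>ES\<^esub> f \<in> img"
proof -
  obtain P Q where P: "P \<in> carrier (TB n)" "f = \<Psi> P" and Q: "Q \<in> carrier (TB n)" "h = \<Psi> Q"
    using assms by (auto simp: img_def)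
  note cl = quot_alg_closed[OF kalgebra_free_alg ideal_pres_ideal(1)[OF tied_rels_words],
      folded pres_alg_def, folded TB_def, OF P(1) Q(1)]
  show "f \<otimes>\<^bsub>ES\<^esub> h \<in> img"
    using imageI[OF cl(1), of \<Psi>] alg_homD(4)[OF \<Psi> P(1) Q(1)] by (simp add: P Q img_def)
  show "f \<oplus>\<^bsub>ES\<^esub> h \<in> img"
    using imageI[OF cl(2), of \<Psi>] alg_homD(5)[OF \<Psi> P(1) Q(1)] by (simp add: P Q img_def)
  show "c \<odot>\<^bsub>ES\<^esub> f \<in> img"
    using imageI[OF cl(3), of \<Psi> c] alg_homD(7)[OF \<Psi> P(1), of c] by (simp add: P img_def)
qed

lemma img_ES: "f \<in> img \<Longrightarrow> f \<in> carrier ES"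
  using alg_homD(3)[OF \<Psi>] by (auto simp: img_def)

lemma img_EA: "f \<in> img \<Longrightarrow> f \<in> carrier EA"
  using img_ES ES_iff by blast

lemma img_perm: "f \<in> img \<Longrightarrow> g permutes {1..d} \<Longrightarrow> t \<in> vcar W \<Longrightarrow> f (perm g t) = perm g (f t)"
  using img_ES ES_iff by blast

lemma tied_op_img: "x \<in> tied_gens n \<Longrightarrow> tied_op x \<in> img"
  unfolding img_def by (rule image_eqI[of _ _ "pres_alg_gen (tied_gens n) (tied_rels n) x"])
    (simp_all add: \<Psi>_gen TB_def pres_alg_gen_closed)

lemma img_eqI:
  "f \<in> img \<Longrightarrow> h \<in> extensional (vcar W) \<Longrightarrow> (\<And>t. t \<in> vcar W \<Longrightarrow> f t = h t) \<Longrightarrow> h \<in> img"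
  using EA_eqI[OF img_EA] by metis

lemma one_img: "\<one>\<^bsub>ES\<^esub> \<in> img"
proof -
  interpret F: kalgebra "free_alg (tied_gens n) :: ('k, tied_gen list \<Rightarrow> 'k) module" by (rule kalgebra_free_alg)
  have "\<one>\<^bsub>TB n\<^esub> \<in> carrier (TB n :: ('k, (tied_gen list \<Rightarrow> 'k) set) module)"
    unfolding TB_def pres_alg_def quot_alg_carrier quot_alg_simps(2) by (rule bexI[OF HOL.refl F.one_closed])
  from imageI[OF this, of \<Psi>] show ?thesis by (simp add: alg_homD(6)[OF \<Psi>] img_def)
qed

lemma diag_one_img: "diag (\<lambda>b. 1) \<in> img"
  by (rule img_eqI[OF one_img diag_extensional]) (simp add: ES_simps diag_one)

lemma
  assumes \<phi>: "diag \<phi> \<in> img"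
  shows diag_img_mult: "diag \<psi> \<in> img \<Longrightarrow> diag (\<lambda>b. \<phi> b * \<psi> b) \<in> img"
    and diag_img_add: "diag \<psi> \<in> img \<Longrightarrow> diag (\<lambda>b. \<phi> b + \<psi> b) \<in> img"
    and diag_img_smult: "diag (\<lambda>b. c * \<phi> b) \<in> img"
proof -
  show "diag (\<lambda>b. \<phi> b * \<psi> b) \<in> img" if "diag \<psi> \<in> img"
    by (rule img_eqI[OF img_ops(1)[OF \<phi> that] diag_extensional]) (simp add: ES_simps diag_diag)
  show "diag (\<lambda>b. \<phi> b + \<psi> b) \<in> img" if "diag \<psi> \<in> img"
    by (rule img_eqI[OF img_ops(2)[OF \<phi> that] diag_extensional]) (simp add: ES_simps diag_add)
  show "diag (\<lambda>b. c * \<phi> b) \<in> img"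
    by (rule img_eqI[OF img_ops(3)[OF \<phi> \<phi>] diag_extensional]) (simp add: ES_simps diag_smult)
qed

lemma diag_img_prod: "(\<And>a. a \<in> S \<Longrightarrow> diag (\<phi> a) \<in> img) \<Longrightarrow> diag (\<lambda>b. \<Prod>a\<in>S. \<phi> a b) \<in> img"
  by (induction S rule: infinite_finite_induct) (simp_all add: diag_one_img diag_img_mult)

lemma diag_img_sum: "(\<And>a. a \<in> S \<Longrightarrow> diag (\<phi> a) \<in> img) \<Longrightarrow> diag (\<lambda>b. \<Sum>a\<in>S. \<phi> a b) \<in> img"
  using diag_img_smult[OF diag_one_img, of 0]
  by (induction S rule: infinite_finite_induct) (simp_all add: diag_img_add)

definition coincide :: "nat \<Rightarrow> nat \<Rightarrow> nat list \<Rightarrow> 'k" where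
  "coincide i j b = (if b ! i = b ! j then 1 else 0)"

text \<open>
  Conjugation by \<open>\<sigma>\<close> at \<open>Suc j\<close> moves the second position from \<open>j\<close> to \<open>Suc j\<close>.  Positions are
  counted from 0 here, so that \<open>E\<close> with index \<open>Suc j\<close> compares the positions \<open>j\<close> and \<open>Suc j\<close>.
\<close>

lemma diag_coincide_less: "i < j \<Longrightarrow> j < n \<Longrightarrow> diag (coincide i j) \<in> img"
proof (induction j)
  case (Suc j)
  have k: "Suc j \<in> {1..<n}" using Suc by auto
  then have gens: "TS (Suc j) \<in> tied_gens n" "TSinv (Suc j) \<in> tied_gens n" "TE (Suc j) \<in> tied_gens n"
    by (auto simp: tied_gens_def)
  show ?case
  proof (cases "i = j")
    case True
    have "coincide i (Suc j) = eps (Suc j)" using True by (auto simp: coincide_def eps_def fun_eq_iff)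
    then show ?thesis using tied_op_img[OF gens(3)] by simp
  next
    case False
    then have IH: "diag (coincide i j) \<in> img" and ij: "i < j" using Suc by auto
    have s: "s_op (Suc j) \<in> img" "s_inv (Suc j) \<in> img" using tied_op_img[OF gens(1)] tied_op_img[OF gens(2)] by simp_all
    show ?thesis
    proof (rule img_eqI[OF img_ops(1)[OF s(1) img_ops(1)[OF IH s(2)]] diag_extensional])
      fix t assume t: "t \<in> vcar W"
      note c = s_closed(2)[OF k t]
      have "diag (\<lambda>b. coincide i j (swap_at (Suc j) b)) = diag (coincide i (Suc j))"
        using k ij by (intro diag_cong) (auto simp: coincide_def swap_at_nth degs_def)
      then show "(s_op (Suc j) \<otimes>\<^bsub>ES\<^esub> (diag (coincide i j) \<otimes>\<^bsub>ES\<^esub> s_inv (Suc j))) t = diag (coincide i (Suc j)) t"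
        using s_op_diag[OF k c] s_s_inv(1)[OF k t] by (simp add: ES_simps t c diag_closed)
    qed
  qed
qed simp

lemma diag_coincide:
  assumes "i < n" "j < n"
  shows "diag (coincide i j) \<in> img"
proof -
  have sym: "coincide i j = coincide j i" by (auto simp: coincide_def fun_eq_iff)
  have eq: "coincide i i = (\<lambda>b. 1)" by (simp add: coincide_def fun_eq_iff)
  consider "i < j" | "j < i" | "i = j" by linarith
  then show ?thesis
    using diag_coincide_less[of i j] diag_coincide_less[of j i] diag_one_img assms sym eq by cases simp_all
qed

text \<open>
  A polynomial in the functions \<open>coincide i j\<close>: for each pair of positions one factor tests whether \<open>b\<close>
  agrees with \<open>c\<close> about the equality of the two entries.
\<close>

definition pattern_indicator :: "nat list \<Rightarrow> nat list \<Rightarrow> 'k" where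
  "pattern_indicator c b = (\<Prod>i<n. \<Prod>j<n. if c ! i = c ! j then coincide i j b else 1 + (- 1) * coincide i j b)"

lemma pattern_indicator_eq:
  assumes "b \<in> degs" "c \<in> degs"
  shows "pattern_indicator c b = (if same_pattern c b then 1 else 0)"
proof -
  have l: "length b = n" "length c = n" using assms by (auto simp: degs_def)
  have t: "(if c ! i = c ! j then coincide i j b else 1 + (- 1) * coincide i j b) =
      (if (c ! i = c ! j) = (b ! i = b ! j) then 1 else 0)" for i j
    by (simp add: coincide_def)
  show ?thesis
  proof (cases "same_pattern c b")
    case True
    then show ?thesis unfolding pattern_indicator_def t using l by (auto simp: same_pattern_def intro!: prod.neutral)
  next
    case False
    then obtain i j where "i < n" "j < n" "(c ! i = c ! j) \<noteq> (b ! i = b ! j)"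
      using l by (auto simp: same_pattern_def)
    then show ?thesis unfolding pattern_indicator_def t using False by (auto simp: prod_zero_iff)
  qed
qed

lemma diag_pattern_indicator: "diag (pattern_indicator c) \<in> img"
  unfolding pattern_indicator_def
proof (intro diag_img_prod)
  fix i j assume "i \<in> {..<n}" "j \<in> {..<n}"
  then have c: "diag (coincide i j) \<in> img" by (intro diag_coincide) auto
  show "diag (\<lambda>b. if c ! i = c ! j then coincide i j b else 1 + (- 1) * coincide i j b) \<in> img"
    using diag_img_add[OF diag_one_img diag_img_smult[OF c, of "- 1"]] c
    by (cases "c ! i = c ! j") simp_all
qed

definition rep :: "nat list \<Rightarrow> nat list" where
  "rep b = (SOME c. c \<in> degs \<and> same_pattern c b)"

lemma rep:
  assumes "b \<in> degs"
  shows "rep b \<in> degs" "same_pattern (rep b) b"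
proof -
  have "b \<in> degs \<and> same_pattern b b" using assms by (simp add: same_pattern_def)
  then have "rep b \<in> degs \<and> same_pattern (rep b) b" unfolding rep_def by (rule someI)
  then show "rep b \<in> degs" "same_pattern (rep b) b" by auto
qed

lemma rep_cong: "same_pattern b c \<Longrightarrow> rep b = rep c"
  unfolding rep_def by (rule arg_cong[of _ _ Eps]) (auto simp: fun_eq_iff same_pattern_def)

text \<open>
  On words, \<open>\<phi> \<circ> rep\<close> is the combination of the pattern indicators of the chosen representatives \<open>c\<close>
  with coefficients \<open>\<phi> c\<close>.
\<close>

lemma diag_rep: "diag (\<lambda>b. \<phi> (rep b)) \<in> img"
proof -
  have "diag (\<lambda>b. \<Sum>c\<in>rep ` degs. \<phi> c * pattern_indicator c b) \<in> img"
    by (intro diag_img_sum diag_img_smult[OF diag_pattern_indicator])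
  moreover have "diag (\<lambda>b. \<Sum>c\<in>rep ` degs. \<phi> c * pattern_indicator c b) = diag (\<lambda>b. \<phi> (rep b))"
  proof (rule diag_cong)
    fix b assume b: "b \<in> degs"
    have "pattern_indicator c b = (if c = rep b then 1 else 0)" if "c \<in> rep ` degs" for c
    proof -
      obtain b' where b': "b' \<in> degs" "c = rep b'" using \<open>c \<in> rep ` degs\<close> by blast
      have "rep c = c" using rep_cong[OF rep(2)[OF b'(1)]] b'(2) by simp
      then have "same_pattern c b \<longleftrightarrow> c = rep b" using rep_cong[of c b] rep(2)[OF b] by auto
      then show ?thesis using pattern_indicator_eq[OF b] rep(1)[OF b'(1)] b'(2) by simp
    qed
    then have "(\<Sum>c\<in>rep ` degs. \<phi> c * pattern_indicator c b) = (\<Sum>c\<in>rep ` degs. if c = rep b then \<phi> c else 0)"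
      by (intro sum.cong HOL.refl) simp
    also have "\<dots> = \<phi> (rep b)" using b finite_degs by (simp add: sum.delta)
    finally show "(\<Sum>c\<in>rep ` degs. \<phi> c * pattern_indicator c b) = \<phi> (rep b)" .
  qed
  ultimately show ?thesis by simp
qed

text \<open>
  Multiplication by a power of \<open>\<tau>\<^sub>i\<close> changes the diagonal factor only; a letter \<open>\<sigma>\<^sub>i\<close> or its inverse moves
  past the diagonal factor at the price of exchanging two entries in it.
\<close>

lemma rho_normal_form:
  "u \<in> P.words \<Longrightarrow> \<exists>\<phi>. \<exists>w\<in>img. \<forall>t\<in>vcar W. rho u t = diag \<phi> (w t)"
proof (induction u)
  case Nil
  show ?case
    by (intro exI[of _ "\<lambda>b. 1"] bexI[OF _ one_img]) (simp add: rho_Nil diag_one ES_simps)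
next
  case (Cons l u)
  have l: "l \<in> framed_gens n \<times> UNIV" and u: "u \<in> P.words" using Cons by auto
  obtain \<phi> w where w: "w \<in> img" and eq: "\<forall>t\<in>vcar W. rho u t = diag \<phi> (w t)" using Cons.IH[OF u] by blast
  have step: "rho (l # u) t = rho [l] (diag \<phi> (w t))" if "t \<in> vcar W" for t
    using rho_Cons[OF l u that] eq that by simp
  have wt: "w t \<in> vcar W" if "t \<in> vcar W" for t by (rule EA_closed[OF img_EA[OF w] that])
  consider (T) i b where "i \<in> {1..n}" "l = (FT i, b)" | (S) i b where "i \<in> {1..<n}" "l = (FS i, b)"
    using l by (cases l) (auto simp: framed_gens_def)
  then show ?case
  proof cases
    case T
    have "\<exists>\<psi>. \<forall>t\<in>vcar W. rho [l] t = diag \<psi> t"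
      using T rho_t[of i] rho_t_inv[of i] by (cases b) (simp, blast, metis)
    then obtain \<psi> where "\<forall>t\<in>vcar W. rho [l] t = diag \<psi> t" by blast
    then have "rho (l # u) t = diag (\<lambda>b. \<psi> b * \<phi> b) (w t)" if "t \<in> vcar W" for t
      using that by (simp add: step wt diag_closed diag_diag)
    then show ?thesis using w by blast
  next
    case S
    have g: "TS i \<in> tied_gens n" "TSinv i \<in> tied_gens n" using S by (auto simp: tied_gens_def)
    have "\<exists>s\<in>img. \<forall>t\<in>vcar W. rho [l] t = s t \<and> (\<forall>\<phi>. s (diag \<phi> t) = diag (\<lambda>b. \<phi> (swap_at i b)) (s t))"
    proof (cases b)
      case True
      then show ?thesis
        using tied_op_img[OF g(1)] S(2) rho_s[OF S(1)] s_op_diag[OF S(1)] by (intro bexI[of _ "s_op i"]) auto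
    next
      case False
      then show ?thesis
        using tied_op_img[OF g(2)] S(2) s_inv_diag[OF S(1)]
        by (intro bexI[of _ "s_inv i"]) (auto simp: s_inv_def)
    qed
    then obtain s where s: "s \<in> img" "\<And>t. t \<in> vcar W \<Longrightarrow> rho [l] t = s t"
      "\<And>t \<phi>. t \<in> vcar W \<Longrightarrow> s (diag \<phi> t) = diag (\<lambda>b. \<phi> (swap_at i b)) (s t)" by blast
    have "rho (l # u) t = diag (\<lambda>b. \<phi> (swap_at i b)) ((s \<otimes>\<^bsub>ES\<^esub> w) t)" if "t \<in> vcar W" for t
      using that by (simp add: step wt diag_closed s ES_simps)
    then show ?thesis using img_ops(1)[OF s(1) w] by blast
  qed
qed

definition delta :: "nat list \<Rightarrow> nat list \<Rightarrow> 'k" where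
  "delta b c = (if c = b then 1 else 0)"

text \<open>
  The component of \<open>f'\<close> in each degree \<open>b\<close> is the component of \<open>f\<close> in degree \<open>rep b\<close>, conjugated by any
  permutation \<open>g\<close> that maps \<open>rep b\<close> to \<open>b\<close>.  The inverse of \<open>g\<close> is avoided by evaluating at \<open>g t\<close>.
\<close>

definition transported :: "((nat \<Rightarrow> 'v, 'k) tensor \<Rightarrow> (nat \<Rightarrow> 'v, 'k) tensor) \<Rightarrow>
    ((nat \<Rightarrow> 'v, 'k) tensor \<Rightarrow> (nat \<Rightarrow> 'v, 'k) tensor) \<Rightarrow> bool" where
  "transported f f' \<longleftrightarrow> (\<forall>b\<in>degs. \<forall>g. g permutes {1..d} \<longrightarrow> map g (rep b) = b \<longrightarrow>
     (\<forall>t\<in>vcar W. diag (delta b) (f' (perm g t)) = perm g (diag (delta (rep b)) (f t))))"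

text \<open>
  The relation is linear in the pair of operators.  For \<open>f = diag \<phi> \<circ> w\<close> one takes
  \<open>f' = diag (\<phi> \<circ> rep) \<circ> w\<close>; the factor \<open>w\<close> commutes with permutations, and in degree \<open>b\<close> both diagonal
  factors are the scalar \<open>\<phi> (rep b)\<close>.
\<close>

lemma transported_exists:
  assumes "x \<in> carrier (monoid_alg P.G)"
  shows "\<exists>f'\<in>img. transported (\<Phi> x) f'"
  using assms
proof (induction x rule: monoid_alg_induct)
  interpret K: kalgebra "monoid_alg P.G :: ('k, framed_gen word set \<Rightarrow> 'k) module"
    by (intro kalgebra_monoid_alg group.is_monoid P.group_G)
  case zero
  have "\<Phi> (\<lambda>g. 0) t = 0" if "t \<in> vcar W" for t using \<Phi>_sum[of "{}" "\<lambda>_. \<zero>\<^bsub>monoid_alg P.G\<^esub>"] that by simp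
  moreover have "diag \<phi> 0 = 0" for \<phi> by (rule linmap_zero[OF vspace_W vspace_W linmap_diag])
  moreover have "perm g 0 = 0" if "g permutes {1..d}" for g
    by (rule linmap_zero[OF vspace_W vspace_W linmap_perm[OF that]])
  moreover have "diag (\<lambda>b. 0) \<in> img" using diag_rep[of "\<lambda>b. 0"] .
  ultimately show ?case
    by (intro bexI[of _ "diag (\<lambda>b. 0)"]) (auto simp: transported_def diag_zero linmap_closed[OF linmap_perm])
next
  case (basis h)
  then obtain u where u: "u \<in> P.words" "h = P.cls u" using P.carrier_cls by blast
  obtain \<phi> w where w: "w \<in> img" and eq: "\<forall>t\<in>vcar W. rho u t = diag \<phi> (w t)"
    using rho_normal_form[OF u(1)] by blast
  show ?case
  proof (intro bexI[OF _ img_ops(1)[OF diag_rep w]])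
    show "transported (\<Phi> (basis_elt h)) (diag (\<lambda>b. \<phi> (rep b)) \<otimes>\<^bsub>ES\<^esub> w)"
      unfolding transported_def
    proof (intro ballI allI impI)
      fix b g t assume b: "b \<in> degs" and g: "g permutes {1..d}" and gb: "map g (rep b) = b" and t: "t \<in> vcar W"
      note gt = linmap_closed[OF linmap_perm[OF g] t]
      have wt: "w t \<in> vcar W" if "t \<in> vcar W" for t by (rule EA_closed[OF img_EA[OF w] that])
      have inv: "map (Hilbert_Choice.inv g) c = rep b \<longleftrightarrow> c = b" for c
        using map_inv_eq_iff[OF g, of c "rep b"] gb by simp
      have "diag (delta b) ((diag (\<lambda>b. \<phi> (rep b)) \<otimes>\<^bsub>ES\<^esub> w) (perm g t)) =
          diag (\<lambda>c. delta b c * \<phi> (rep c)) (perm g (w t))"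
        by (simp add: ES_simps gt diag_diag wt img_perm[OF w g t] linmap_closed[OF linmap_perm[OF g] wt[OF t]])
      also have "diag (\<lambda>c. delta b c * \<phi> (rep c)) =
          diag (\<lambda>c. delta (rep b) (map (Hilbert_Choice.inv g) c) * \<phi> (map (Hilbert_Choice.inv g) c))"
      proof (rule diag_cong)
        fix c
        show "delta b c * \<phi> (rep c) =
            delta (rep b) (map (Hilbert_Choice.inv g) c) * \<phi> (map (Hilbert_Choice.inv g) c)"
          using inv[of c] by (cases "c = b") (simp_all add: delta_def)
      qed
      also have "\<dots> (perm g (w t)) = perm g (diag (\<lambda>c. delta (rep b) c * \<phi> c) (w t))"
        by (rule perm_diag[OF g wt[OF t], symmetric])
      also have "\<dots> = perm g (diag (delta (rep b)) (\<Phi> (basis_elt h) t))"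
        using eq t u by (simp add: rho_def diag_diag wt)
      finally show "diag (delta b) ((diag (\<lambda>b. \<phi> (rep b)) \<otimes>\<^bsub>ES\<^esub> w) (perm g t)) =
          perm g (diag (delta (rep b)) (\<Phi> (basis_elt h) t))" .
    qed
  qed
next
  case (add x y)
  then obtain f' h' where f: "f' \<in> img" "transported (\<Phi> x) f'" and h: "h' \<in> img" "transported (\<Phi> y) h'" by blast
  have eq: "\<Phi> (\<lambda>g. x g + y g) t = \<Phi> x t + \<Phi> y t" if "t \<in> vcar W" for t
    using alg_homD(5)[OF \<Phi>' add(1,2)] that by (simp add: EA_simps monoid_alg_simps(2))
  have cl: "\<Phi> x t \<in> vcar W" "\<Phi> y t \<in> vcar W" "f' t \<in> vcar W" "h' t \<in> vcar W" if "t \<in> vcar W" for t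
    using EA_closed[OF alg_homD(3)[OF \<Phi>' add(1)] that] EA_closed[OF alg_homD(3)[OF \<Phi>' add(2)] that]
      EA_closed[OF img_EA[OF f(1)] that] EA_closed[OF img_EA[OF h(1)] that] by auto
  show ?case
  proof (intro bexI[OF _ img_ops(2)[OF f(1) h(1)]], unfold transported_def, intro ballI allI impI)
    fix b g t assume b: "b \<in> degs" and g: "g permutes {1..d}" and gb: "map g (rep b) = b" and t: "t \<in> vcar W"
    note gt = linmap_closed[OF linmap_perm[OF g] t]
    have "diag (delta b) (f' (perm g t)) = perm g (diag (delta (rep b)) (\<Phi> x t))"
      "diag (delta b) (h' (perm g t)) = perm g (diag (delta (rep b)) (\<Phi> y t))"
      using f(2) h(2) b g gb t unfolding transported_def by blast+
    then show "diag (delta b) ((f' \<oplus>\<^bsub>ES\<^esub> h') (perm g t)) =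
        perm g (diag (delta (rep b)) (\<Phi> (\<lambda>g. x g + y g) t))"
      by (simp only: ES_simps(2)[OF gt] eq[OF t] linmap_add[OF linmap_diag] linmap_add[OF linmap_perm[OF g]]
          cl gt t diag_closed)
  qed
next
  case (smult c x)
  then obtain f' where f: "f' \<in> img" "transported (\<Phi> x) f'" by blast
  have eq: "\<Phi> (\<lambda>g. c * x g) t = tensor_scale c (\<Phi> x t)" if "t \<in> vcar W" for t
    using alg_homD(7)[OF \<Phi>' smult(1), of c] that by (simp add: EA_simps monoid_alg_simps(4))
  have cl: "\<Phi> x t \<in> vcar W" "f' t \<in> vcar W" if "t \<in> vcar W" for t
    using EA_closed[OF alg_homD(3)[OF \<Phi>' smult(1)] that] EA_closed[OF img_EA[OF f(1)] that] by auto
  have ps: "perm g (tensor_scale c t) = tensor_scale c (perm g t)" if "g permutes {1..d}" "t \<in> vcar W" for g t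
    using linmap_scale[OF linmap_perm[OF that(1)] that(2), of c] by simp
  show ?case
  proof (intro bexI[OF _ img_ops(3)[OF f(1) f(1)]], unfold transported_def, intro ballI allI impI)
    fix b g t assume b: "b \<in> degs" and g: "g permutes {1..d}" and gb: "map g (rep b) = b" and t: "t \<in> vcar W"
    note gt = linmap_closed[OF linmap_perm[OF g] t]
    have "diag (delta b) (f' (perm g t)) = perm g (diag (delta (rep b)) (\<Phi> x t))"
      using f(2) b g gb t unfolding transported_def by blast
    then show "diag (delta b) ((c \<odot>\<^bsub>ES\<^esub> f') (perm g t)) =
        perm g (diag (delta (rep b)) (\<Phi> (\<lambda>g. c * x g) t))"
      by (simp only: ES_simps(3)[OF gt] eq[OF t] diag_scale ps[OF g] cl gt t diag_closed)
  qed
qed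

lemma sum_delta:
  assumes "t \<in> vcar W"
  shows "(\<Sum>b\<in>degs. diag (delta b) t) = t"
proof -
  have "(\<Sum>b\<in>degs. diag (delta b) t) = diag (\<lambda>c. \<Sum>b\<in>degs. delta b c) t"
    by (rule diag_sum[OF assms, symmetric])
  also have "diag (\<lambda>c. \<Sum>b\<in>degs. delta b c) = diag (\<lambda>c. 1)"
    by (rule diag_cong) (simp add: delta_def finite_degs)
  finally show ?thesis by (simp add: diag_one assms)
qed

text \<open>
  For an operator \<open>f\<close> that commutes with permutations, conjugation does not change \<open>f\<close>, so \<open>f\<close> and its
  transported operator have the same component in every degree.
\<close>

lemma Psi_surjective:
  assumes "\<Phi> ` carrier (monoid_alg P.G) = carrier EA"
  shows "\<Psi> ` carrier (TB n) = carrier ES"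
proof
  show "\<Psi> ` carrier (TB n) \<subseteq> carrier ES" using img_ES by (auto simp: img_def)
  show "carrier ES \<subseteq> \<Psi> ` carrier (TB n)"
  proof
    fix f assume f: "f \<in> carrier ES"
    then have fE: "f \<in> carrier EA" and fp: "\<And>g t. g permutes {1..d} \<Longrightarrow> t \<in> vcar W \<Longrightarrow> f (perm g t) = perm g (f t)"
      unfolding ES_iff by blast+
    then obtain x where "x \<in> carrier (monoid_alg P.G)" "f = \<Phi> x" using assms by blast
    then obtain f' where f': "f' \<in> img" "transported f f'" using transported_exists by blast
    have "f' t = f t" if t: "t \<in> vcar W" for t
    proof -
      have "diag (delta b) (f' t) = diag (delta b) (f t)" if b: "b \<in> degs" for b
      proof -
        obtain g where g: "g permutes {1..d}" "map g (rep b) = b"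
          by (rule same_pattern_permutation[OF rep(2)[OF b], of "{1..d}"]) (use rep(1)[OF b] b in \<open>auto simp: degs_def\<close>)
        \<comment> \<open>The relation \<open>transported\<close> speaks about vectors of the form \<open>g s\<close>.\<close>
        define s where "s = perm (Hilbert_Choice.inv g) t"
        have s: "s \<in> vcar W" unfolding s_def by (rule linmap_closed[OF linmap_perm[OF permutes_inv[OF g(1)]] t])
        have ts: "t = perm g s" unfolding s_def by (rule perm_perm_inv[OF g(1) t, symmetric])
        have "map (Hilbert_Choice.inv g) c = rep b \<longleftrightarrow> c = b" for c
          using map_inv_eq_iff[OF g(1), of c "rep b"] g(2) by simp
        then have d: "(\<lambda>c. delta (rep b) (map (Hilbert_Choice.inv g) c)) = delta b"
          by (simp add: delta_def fun_eq_iff)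
        have "diag (delta b) (f' (perm g s)) = perm g (diag (delta (rep b)) (f s))"
          using f'(2) b g s unfolding transported_def by blast
        also have "\<dots> = diag (delta b) (perm g (f s))"
          using perm_diag[OF g(1) EA_closed[OF fE s], of "delta (rep b)"] by (simp add: d)
        also have "\<dots> = diag (delta b) (f (perm g s))" by (simp add: fp[OF g(1) s])
        finally show ?thesis by (simp add: ts)
      qed
      then have "(\<Sum>b\<in>degs. diag (delta b) (f' t)) = (\<Sum>b\<in>degs. diag (delta b) (f t))"
        by (intro sum.cong HOL.refl)
      then show ?thesis
        using sum_delta[OF EA_closed[OF img_EA[OF f'(1)] t]] sum_delta[OF EA_closed[OF fE t]] by simp
    qed
    then have "f \<in> img" by (rule img_eqI[OF f'(1) EA_ext[OF fE]])
    then show "f \<in> \<Psi> ` carrier (TB n)" by (simp add: img_def)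
  qed
qed

end

end

section \<open>Schur-Weyl duality for the tied braid algebra\<close>

theorem theorem7p1:
  fixes A0 :: "('k::field, 'a::ab_group_add) bialg"
    and V0 :: "('k, 'v::ab_group_add) vspace"
    and act :: "'a \<Rightarrow> 'v \<Rightarrow> 'v"
    and R :: "('v, 'k) tensor \<Rightarrow> ('v, 'k) tensor"
    and \<zeta> :: 'k
    and d n :: nat
    and \<Phi> :: "(framed_gen word set \<Rightarrow> 'k) \<Rightarrow> ((nat \<Rightarrow> 'v, 'k) tensor \<Rightarrow> (nat \<Rightarrow> 'v, 'k) tensor)"
  assumes "d \<ge> 1" and "n \<ge> 1"
    and "of_nat d \<noteq> (0 :: 'k)" and "primitive_root d \<zeta>"
    and "is_bialgebra A0" and "is_module A0 V0 act"
    and "R \<in> linear_maps (tensor_power V0 2) (tensor_power V0 2)" and "braid_rep A0 V0 act R"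
    and "\<Phi> \<in> alg_hom (monoid_alg (framed_braid_group d n)) (End_A d A0 V0 act n)"
    and "\<forall>i\<in>{1..n}. \<Phi> (basis_elt (framed_t d n i)) = on_factor (sum_space d V0) n (tau d V0 \<zeta>) i"
    and "\<forall>i\<in>{1..<n}. \<Phi> (basis_elt (framed_s d n i)) = on_factors (sum_space d V0) n (sigma d V0 R) i"
  shows "\<exists>\<Psi>\<in>alg_hom (TB n) (End_smash d A0 V0 act n).
           (\<forall>i\<in>{1..<n}. \<Psi> (TB_s n i) = \<Phi> (basis_elt (framed_s d n i)) \<and>
                      \<Psi> (TB_E n i) = \<Phi> (framed_E d n i)) \<and>
           (\<forall>\<Psi>'\<in>alg_hom (TB n) (End_smash d A0 V0 act n).
              (\<forall>i\<in>{1..<n}. \<Psi>' (TB_s n i) = \<Psi> (TB_s n i) \<and> \<Psi>' (TB_E n i) = \<Psi> (TB_E n i))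
              \<longrightarrow> \<Psi>' = \<Psi>) \<and>
           (\<Phi> ` carrier (monoid_alg (framed_braid_group d n)) = carrier (End_A d A0 V0 act n) \<longrightarrow>
            \<Psi> ` carrier (TB n) = carrier (End_smash d A0 V0 act n))"
proof -
  have "is_vspace V0" using assms(6) by (simp add: is_module_def)
  then interpret framed_braid_action V0 d n R A0 act \<zeta> \<Phi>
    using assms linear_mapsD[OF assms(7)]
    by (intro framed_braid_action.intro flip_operator.intro direct_sum_power.intro
        flip_operator_axioms.intro framed_braid_action_axioms.intro)
  obtain \<Psi> where \<Psi>: "\<Psi> \<in> alg_hom (TB n :: ('k, (tied_gen list \<Rightarrow> 'k) set) module) ES"
    and gen: "\<And>x. x \<in> tied_gens n \<Longrightarrow> \<Psi> (pres_alg_gen (tied_gens n) (tied_rels n) x) = tied_op x"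
    by (rule exists_Psi) (rule that)
  have "\<Psi> (TB_s n i) = \<Phi> (basis_elt (framed_s d n i)) \<and> \<Psi> (TB_E n i) = \<Phi> (framed_E d n i)"
    if i: "i \<in> {1..<n}" for i
  proof -
    have "TS i \<in> tied_gens n" "TE i \<in> tied_gens n" using i by (auto simp: tied_gens_def)
    then show ?thesis
      using gen[of "TS i"] gen[of "TE i"] assms(11) i
      by (simp add: TB_s_def TB_E_def \<Phi>_E(2)[OF i] s_op_def)
  qed
  moreover have "\<Psi>' = \<Psi>" if "\<Psi>' \<in> alg_hom (TB n) ES"
    "\<forall>i\<in>{1..<n}. \<Psi>' (TB_s n i) = \<Psi> (TB_s n i) \<and> \<Psi>' (TB_E n i) = \<Psi> (TB_E n i)" for \<Psi>'
    by (rule Psi_unique[OF that(1) \<Psi> that(2)])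
  moreover have "\<Psi> ` carrier (TB n) = carrier ES"
    if "\<Phi> ` carrier (monoid_alg (framed_braid_group d n)) = carrier EA"
    using Psi_surjective[OF \<Psi> gen] that by (simp add: framed_defs)
  ultimately show ?thesis using \<Psi> by blast
qed

end
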